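(* Let $m\in\mathbb N$. For $f\in\mathbb Z^{m+\infty}_+$ let $f^\natural\in\mathbb Z^{m|\infty}_+$ be defined by $f^\natural(i)=f(i)$ for $i<0$, and $f^\natural(1)<f^\natural(2)<\cdots$ the increasing enumeration of $\mathbb Z\setminus\{f(1),f(2),\dots\}$. The map $1\otimes C$ induces a well-defined isomorphism of $\mathcal U$-modules $\natural:\widehat{\mathcal E}^{m+\infty}\to\widehat{\mathcal E}^{m|\infty}$ with the following properties: (1) $\natural(\mathcal K_f)=K_{f^\natural}$ for every $f\in\mathbb Z^{m+\infty}_+$; (2) $\natural(\bar u)=\overline{\natural(u)}$ for every $u\in\widehat{\mathcal E}^{m+\infty}$; (3) $\natural(\mathcal L_f)=L_{f^\natural}$ for every $f\in\mathbb Z^{m+\infty}_+$; (4) $\natural(\mathcal U_f)=U_{f^\natural}$ for every $f\in\mathbb Z^{m+\infty}_+$.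
   Context: Quantum group: $U_q(\mathfrak{gl}(\infty))$ is the $\mathbb Q(q)$-algebra generated by $E_a,F_a,K_a^{\pm1}$ ($a\in\mathbb Z$) with relations $K_aK_a^{-1}=1$, $K_aK_b=K_bK_a$, $K_aE_bK_a^{-1}=q^{\delta_{a,b}-\delta_{a,b+1}}E_b$, $K_aF_bK_a^{-1}=q^{\delta_{a,b+1}-\delta_{a,b}}F_b$, $E_aF_b-F_bE_a=\delta_{a,b}(K_{a,a+1}-K_{a+1,a})/(q-q^{-1})$ with $K_{a,b}=K_aK_b^{-1}$, $E_aE_b=E_bE_a$ and $F_aF_b=F_bF_a$ for $|a-b|>1$, and $E_a^2E_b+E_bE_a^2=(q+q^{-1})E_aE_bE_a$, $F_a^2F_b+F_bF_a^2=(q+q^{-1})F_aF_bF_a$ for $|a-b|=1$. $\mathcal U$ is the subalgebra generated by $E_a,F_a,K_{a,a+1}$ ($a\in\mathbb Z$). Tensor products of modules are formed with $\Delta(E_a)=1\otimes E_a+E_a\otimes K_{a+1,a}$, $\Delta(F_a)=F_a\otimes1+K_{a,a+1}\otimes F_a$, $\Delta(K_a)=K_a\otimes K_a$. The bar map on $\mathcal U$ is the ring automorphism with $\bar q=q^{-1}$, $\bar E_a=E_a$, $\bar F_a=F_a$, $\bar K_a=K_a^{-1}$; a map $\phi$ of $\mathbb Q(q)$-spaces is anti-linear if $\phi(cu)=\bar c\phi(u)$ with $\bar c(q)=c(q^{-1})$. Wedge modules: $\Lambda^m\mathbb V$ has basis $v_{a_1}\wedge\cdots\wedge v_{a_m}$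 ($a_1>\cdots>a_m$ integers) and $\Lambda^\infty\mathbb V$ has basis $v_{a_1}\wedge v_{a_2}\wedge\cdots$ ($a_1>a_2>\cdots$, $a_i=1-i$ for $i\gg0$); on a basis vector with index set $S$, $F_a$ replaces the index $a$ by $a+1$ if $a\in S,a+1\notin S$ (else gives $0$), $E_a$ replaces $a+1$ by $a$ if $a+1\in S,a\notin S$ (else $0$), and $K_{a,a+1}$ acts by $q^{[a\in S]-[a+1\in S]}$. $\Lambda^\infty\mathbb W$ has basis $w_{b_1}\wedge w_{b_2}\wedge\cdots$ ($b_1<b_2<\cdots$, $b_i=i$ for $i\gg0$); for index set $S$, $F_a$ replaces $a+1$ by $a$ if $a+1\in S,a\notin S$ (else $0$), $E_a$ replaces $a$ by $a+1$ if $a\in S,a+1\notin S$ (else $0$), $K_{a,a+1}$ acts by $q^{[a+1\in S]-[a\in S]}$. For a partition $\lambda$ with conjugate $\lambda'$ put $|\lambda\rangle=v_{\lambda_1}\wedge v_{\lambda_2-1}\wedge v_{\lambda_3-2}\wedge\cdots$ and $|\lambda'_*\rangle=w_{1-\lambda'_1}\wedge w_{2-\lambda'_2}\wedge\cdots$; $C:\Lambda^\infty\mathbb V\to\Lambda^\infty\mathbb W$ is the linear map $|\lambda\rangle\mapsto|\lambda'_*\rangle$ (a $\mathcal U$-module isomorphism). Fock spaces: $I(m|\infty)=\{-m,\dots,-1\}\cup\{1,2,\dots\}$. $\mathbb Z^{m+\infty}_+$ is the set of $f:I(m|\infty)\to\mathbb Z$ with $f(-m)>\cdots>f(-1)$,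 $f(1)>f(2)>\cdots$, $f(i)=1-i$ for $i\gg0$; $\mathbb Z^{m|\infty}_+$ the set of $f$ with $f(-m)>\cdots>f(-1)$, $f(1)<f(2)<\cdots$, $f(i)=i$ for $i\gg0$. $\mathcal E^{m+\infty}=\Lambda^m\mathbb V\otimes\Lambda^\infty\mathbb V$ with basis $\mathcal K_f=v_{f(-m)}\wedge\cdots\wedge v_{f(-1)}\otimes v_{f(1)}\wedge v_{f(2)}\wedge\cdots$ ($f\in\mathbb Z^{m+\infty}_+$), and $\mathcal E^{m|\infty}=\Lambda^m\mathbb V\otimes\Lambda^\infty\mathbb W$ with basis $K_f=v_{f(-m)}\wedge\cdots\wedge v_{f(-1)}\otimes w_{f(1)}\wedge w_{f(2)}\wedge\cdots$ ($f\in\mathbb Z^{m|\infty}_+$). $\widehat{\mathcal E}^{m+\infty}$ consists of formal sums $\sum c_f\mathcal K_f$ such that for each $n$ only finitely many $f$ with $c_f\neq0$ have $f(k)=1-k$ for all $k>n$; $\widehat{\mathcal E}^{m|\infty}$ consists of formal sums $\sum c_fK_f$ such that for each $d\in\mathbb N$ only finitely many $f$ with $c_f\ne0$ have $f(i)\ge-d$ for all $i>0$. Orderings: the Bruhat ordering on functions $I(m|\infty)\to\mathbb Z$ is the transitive closure of $f<f\cdot\tau_{ij}$ whenever $i<j$ in $I(m|\infty)$ and $f(i)<f(j)$ ($\tau_{ij}$ the transposition, $(f\cdot\tau)(k)=f(\tau(k))$); $f\in\mathbb Z^{m+\infty}_+$ is J-typical if it is minimal in $\mathbb Z^{m+\infty}_+$.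 For the super ordering let $d_i:I(m|\infty)\to\mathbb Z$, $j\mapsto-\mathrm{sgn}(i)\delta_{ij}$; write $f\downarrow g$ if $g=f-d_i+d_j$ for some $i<0<j$ with $f(i)=f(j)$, or $g=f\cdot\tau_{ij}$ for some $i<j<0$ with $f(i)>f(j)$, or $g=f\cdot\tau_{ij}$ for some $0<i<j$ with $f(i)<f(j)$; $\succ$ is the transitive closure of $\downarrow$. $f\in\mathbb Z^{m|\infty}_+$ is typical if $\{f(-m),\dots,f(-1)\}\cap\{f(1),f(2),\dots\}=\emptyset$. Bar involutions and canonical bases: the bar involution on $\widehat{\mathcal E}^{m+\infty}$ is the unique continuous anti-linear map with $\overline{\mathcal K_f}=\mathcal K_f$ for J-typical $f$, $\overline{Xu}=\bar X\bar u$ ($X\in\mathcal U$), which is an involution and satisfies $\overline{\mathcal K_f}\in\mathcal K_f+$ (possibly infinite) $\mathbb Z[q,q^{-1}]$-combination of $\mathcal K_g$, $g<f$. $\mathcal U_f,\mathcal L_f$ ($f\in\mathbb Z^{m+\infty}_+$) are the unique bar-invariant elements with $\mathcal U_f\in\mathcal K_f+\widehat\sum_{g<f}q\mathbb Z[q]\mathcal K_g$, $\mathcal L_f\in\mathcal K_f+\widehat\sum_{g<f}q^{-1}\mathbb Z[q^{-1}]\mathcal K_g$. Analogously on $\widehat{\mathcal E}^{m|\infty}$ (typical in place of J-typical, $\prec$ in place of $<$) one has the bar involution and $U_f,L_f$ ($f\in\mathbb Z^{m|\infty}_+$). *)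

theory Defs
  imports "HOL-Computational_Algebra.Polynomial" "HOL-Computational_Algebra.Fraction_Field"
begin

type_synonym qf = "rat poly fract"

definition qq :: qf where "qq = Fract [:0, 1:] 1"
definition qconst :: "rat \<Rightarrow> qf" where "qconst c = Fract [:c:] 1"

definition qpow :: "int \<Rightarrow> qf" where
  "qpow k = (if 0 \<le> k then qq ^ nat k else inverse qq ^ nat (- k))"

definition bar_q :: "qf \<Rightarrow> qf" where
  "bar_q = (THE \<phi>. (\<forall>x y. \<phi> (x + y) = \<phi> x + \<phi> y) \<and> (\<forall>x y. \<phi> (x * y) = \<phi> x * \<phi> y)
              \<and> (\<forall>c. \<phi> (qconst c) = qconst c) \<and> \<phi> qq = inverse qq)"

definition laurent_int :: "qf \<Rightarrow> bool" where
  "laurent_int x \<longleftrightarrow> (\<exists>(p::int poly) (n::nat). x = Fract (map_poly rat_of_int p) (monom 1 n))"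
definition in_qZq :: "qf \<Rightarrow> bool" where
  "in_qZq x \<longleftrightarrow> (\<exists>p::int poly. coeff p 0 = 0 \<and> x = Fract (map_poly rat_of_int p) 1)"
definition in_qinvZqinv :: "qf \<Rightarrow> bool" where
  "in_qinvZqinv x \<longleftrightarrow> (\<exists>(p::int poly) (n::nat). degree p < n \<and> x = Fract (map_poly rat_of_int p) (monom 1 n))"

(* functions on I(m|\<infinity>) = {-m..-1} \<union> {1,2,...} are represented as int \<Rightarrow> int, normalised to 0 off I(m|\<infinity>) *)
definition Dneg :: "nat \<Rightarrow> int set" where "Dneg m = {- int m .. -1}"
definition Dpos :: "int set" where "Dpos = {1..}"
definition Imi :: "nat \<Rightarrow> int set" where "Imi m = Dneg m \<union> Dpos"

definition Zplus :: "nat \<Rightarrow> (int \<Rightarrow> int) set" where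
  "Zplus m = {f. (\<forall>i. i \<notin> Imi m \<longrightarrow> f i = 0)
     \<and> (\<forall>i\<in>Dneg m. \<forall>j\<in>Dneg m. i < j \<longrightarrow> f i > f j)
     \<and> (\<forall>i\<in>Dpos. \<forall>j\<in>Dpos. i < j \<longrightarrow> f i > f j)
     \<and> (\<exists>N. \<forall>i\<ge>N. f i = 1 - i)}"

definition Zsuper :: "nat \<Rightarrow> (int \<Rightarrow> int) set" where
  "Zsuper m = {f. (\<forall>i. i \<notin> Imi m \<longrightarrow> f i = 0)
     \<and> (\<forall>i\<in>Dneg m. \<forall>j\<in>Dneg m. i < j \<longrightarrow> f i > f j)
     \<and> (\<forall>i\<in>Dpos. \<forall>j\<in>Dpos. i < j \<longrightarrow> f i < f j)
     \<and> (\<exists>N. \<forall>i\<ge>N. f i = i)}"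

type_synonym vec = "(int \<Rightarrow> int) \<Rightarrow> qf"   (* u f = coefficient of basis vector indexed by f *)

definition vzero :: vec where "vzero = (\<lambda>_. 0)"
definition vadd :: "vec \<Rightarrow> vec \<Rightarrow> vec" where "vadd u v = (\<lambda>f. u f + v f)"
definition vsmult :: "qf \<Rightarrow> vec \<Rightarrow> vec" where "vsmult c u = (\<lambda>f. c * u f)"
definition bvec :: "(int \<Rightarrow> int) \<Rightarrow> vec" where "bvec f = (\<lambda>g. if g = f then 1 else 0)"

definition Ehat_plus :: "nat \<Rightarrow> vec set" where
  "Ehat_plus m = {u. (\<forall>f. u f \<noteq> 0 \<longrightarrow> f \<in> Zplus m)
     \<and> (\<forall>n::nat. finite {f. u f \<noteq> 0 \<and> (\<forall>k > int n. f k = 1 - k)})}"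

definition Ehat_super :: "nat \<Rightarrow> vec set" where
  "Ehat_super m = {u. (\<forall>f. u f \<noteq> 0 \<longrightarrow> f \<in> Zsuper m)
     \<and> (\<forall>d::nat. finite {f. u f \<noteq> 0 \<and> (\<forall>i > 0. f i \<ge> - int d)})}"

(* continuous linear extension of a map T given on basis vectors *)
definition ext :: "((int \<Rightarrow> int) \<Rightarrow> vec) \<Rightarrow> vec \<Rightarrow> vec" where
  "ext T u = (\<lambda>g. \<Sum>f \<in> {f. u f \<noteq> 0 \<and> T f g \<noteq> 0}. u f * T f g)"

(* E a, F a, K a = K_{a,a+1}, Kinv a = K_{a+1,a} *)
datatype gen = E int | F int | K int | Kinv int

fun bar_gen :: "gen \<Rightarrow> gen" where
  "bar_gen (E a) = E a" | "bar_gen (F a) = F a" | "bar_gen (K a) = Kinv a" | "bar_gen (Kinv a) = K a"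

definition ind :: "bool \<Rightarrow> int" where "ind P = (if P then 1 else 0)"

(* exponent of K_{a,a+1} on a V-wedge resp. W-wedge with index set S *)
definition kV :: "int set \<Rightarrow> int \<Rightarrow> int" where "kV S a = ind (a \<in> S) - ind (a + 1 \<in> S)"
definition kW :: "int set \<Rightarrow> int \<Rightarrow> int" where "kW S a = ind (a + 1 \<in> S) - ind (a \<in> S)"

definition repl :: "int set \<Rightarrow> int \<Rightarrow> int \<Rightarrow> (int \<Rightarrow> int) \<Rightarrow> (int \<Rightarrow> int)" where
  "repl D b c f = (\<lambda>i. if i \<in> D \<and> f i = b then c else f i)"

definition cond_vec :: "bool \<Rightarrow> vec \<Rightarrow> vec" where "cond_vec P v = (if P then v else vzero)"

(* action on basis vectors of \<E>^{m+\<infinity>} = \<Lambda>^m V \<otimes> \<Lambda>^\<infinity> V, via the given coproduct *)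
fun gen_plus :: "nat \<Rightarrow> gen \<Rightarrow> (int \<Rightarrow> int) \<Rightarrow> vec" where
  "gen_plus m (F a) f = (let Sn = f ` Dneg m; Sp = f ` Dpos in
     vadd (cond_vec (a \<in> Sn \<and> a + 1 \<notin> Sn) (bvec (repl (Dneg m) a (a + 1) f)))
          (cond_vec (a \<in> Sp \<and> a + 1 \<notin> Sp) (vsmult (qpow (kV Sn a)) (bvec (repl Dpos a (a + 1) f)))))"
| "gen_plus m (E a) f = (let Sn = f ` Dneg m; Sp = f ` Dpos in
     vadd (cond_vec (a + 1 \<in> Sp \<and> a \<notin> Sp) (bvec (repl Dpos (a + 1) a f)))
          (cond_vec (a + 1 \<in> Sn \<and> a \<notin> Sn) (vsmult (qpow (- kV Sp a)) (bvec (repl (Dneg m) (a + 1) a f)))))"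
| "gen_plus m (K a) f = vsmult (qpow (kV (f ` Dneg m) a + kV (f ` Dpos) a)) (bvec f)"
| "gen_plus m (Kinv a) f = vsmult (qpow (- (kV (f ` Dneg m) a + kV (f ` Dpos) a))) (bvec f)"

(* action on basis vectors of \<E>^{m|\<infinity>} = \<Lambda>^m V \<otimes> \<Lambda>^\<infinity> W *)
fun gen_super :: "nat \<Rightarrow> gen \<Rightarrow> (int \<Rightarrow> int) \<Rightarrow> vec" where
  "gen_super m (F a) f = (let Sn = f ` Dneg m; Sp = f ` Dpos in
     vadd (cond_vec (a \<in> Sn \<and> a + 1 \<notin> Sn) (bvec (repl (Dneg m) a (a + 1) f)))
          (cond_vec (a + 1 \<in> Sp \<and> a \<notin> Sp) (vsmult (qpow (kV Sn a)) (bvec (repl Dpos (a + 1) a f)))))"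
| "gen_super m (E a) f = (let Sn = f ` Dneg m; Sp = f ` Dpos in
     vadd (cond_vec (a \<in> Sp \<and> a + 1 \<notin> Sp) (bvec (repl Dpos a (a + 1) f)))
          (cond_vec (a + 1 \<in> Sn \<and> a \<notin> Sn) (vsmult (qpow (- kW Sp a)) (bvec (repl (Dneg m) (a + 1) a f)))))"
| "gen_super m (K a) f = vsmult (qpow (kV (f ` Dneg m) a + kW (f ` Dpos) a)) (bvec f)"
| "gen_super m (Kinv a) f = vsmult (qpow (- (kV (f ` Dneg m) a + kW (f ` Dpos) a))) (bvec f)"

definition act_plus :: "nat \<Rightarrow> gen \<Rightarrow> vec \<Rightarrow> vec" where "act_plus m X = ext (gen_plus m X)"
definition act_super :: "nat \<Rightarrow> gen \<Rightarrow> vec \<Rightarrow> vec" where "act_super m X = ext (gen_super m X)"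

definition bruhat_step :: "nat \<Rightarrow> (int \<Rightarrow> int) \<Rightarrow> (int \<Rightarrow> int) \<Rightarrow> bool" where
  "bruhat_step m f g \<longleftrightarrow> (\<exists>i\<in>Imi m. \<exists>j\<in>Imi m. i < j \<and> f i < f j \<and> g = f(i := f j, j := f i))"

definition bruhat_less :: "nat \<Rightarrow> (int \<Rightarrow> int) \<Rightarrow> (int \<Rightarrow> int) \<Rightarrow> bool" where
  "bruhat_less m g f \<longleftrightarrow> (g, f) \<in> {(x, y). bruhat_step m x y}\<^sup>+"

definition J_typical :: "nat \<Rightarrow> (int \<Rightarrow> int) \<Rightarrow> bool" where
  "J_typical m f \<longleftrightarrow> f \<in> Zplus m \<and> \<not> (\<exists>g\<in>Zplus m. bruhat_less m g f)"

definition super_step :: "nat \<Rightarrow> (int \<Rightarrow> int) \<Rightarrow> (int \<Rightarrow> int) \<Rightarrow> bool" where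
  "super_step m f g \<longleftrightarrow>
     (\<exists>i\<in>Imi m. \<exists>j\<in>Imi m. i < 0 \<and> 0 < j \<and> f i = f j \<and> g = f(i := f i - 1, j := f j - 1))
   \<or> (\<exists>i\<in>Imi m. \<exists>j\<in>Imi m. i < j \<and> j < 0 \<and> f i > f j \<and> g = f(i := f j, j := f i))
   \<or> (\<exists>i\<in>Imi m. \<exists>j\<in>Imi m. 0 < i \<and> i < j \<and> f i < f j \<and> g = f(i := f j, j := f i))"

definition super_less :: "nat \<Rightarrow> (int \<Rightarrow> int) \<Rightarrow> (int \<Rightarrow> int) \<Rightarrow> bool" where
  "super_less m g f \<longleftrightarrow> (f, g) \<in> {(x, y). super_step m x y}\<^sup>+"

definition typical :: "nat \<Rightarrow> (int \<Rightarrow> int) \<Rightarrow> bool" where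
  "typical m f \<longleftrightarrow> f \<in> Zsuper m \<and> f ` Dneg m \<inter> f ` Dpos = {}"

(* continuous anti-linear map: \<psi>(\<Sum> c_f K_f) = \<Sum> bar(c_f) \<psi>(K_f), the sum converging coefficientwise *)
definition cont_antilinear :: "vec set \<Rightarrow> (vec \<Rightarrow> vec) \<Rightarrow> bool" where
  "cont_antilinear A \<psi> \<longleftrightarrow> (\<forall>u\<in>A. \<forall>g.
      finite {f. u f \<noteq> 0 \<and> \<psi> (bvec f) g \<noteq> 0}
    \<and> \<psi> u g = (\<Sum>f \<in> {f. u f \<noteq> 0 \<and> \<psi> (bvec f) g \<noteq> 0}. bar_q (u f) * \<psi> (bvec f) g))"

definition is_bar_plus :: "nat \<Rightarrow> (vec \<Rightarrow> vec) \<Rightarrow> bool" where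
  "is_bar_plus m \<psi> \<longleftrightarrow>
     (\<forall>u\<in>Ehat_plus m. \<psi> u \<in> Ehat_plus m) \<and> (\<forall>u. u \<notin> Ehat_plus m \<longrightarrow> \<psi> u = vzero)
   \<and> cont_antilinear (Ehat_plus m) \<psi>
   \<and> (\<forall>f. J_typical m f \<longrightarrow> \<psi> (bvec f) = bvec f)
   \<and> (\<forall>X. \<forall>u\<in>Ehat_plus m. \<psi> (act_plus m X u) = act_plus m (bar_gen X) (\<psi> u))
   \<and> (\<forall>u\<in>Ehat_plus m. \<psi> (\<psi> u) = u)
   \<and> (\<forall>f\<in>Zplus m. \<psi> (bvec f) f = 1
        \<and> (\<forall>g. laurent_int (\<psi> (bvec f) g) \<and> (g \<noteq> f \<and> \<psi> (bvec f) g \<noteq> 0 \<longrightarrow> bruhat_less m g f)))"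

definition is_bar_super :: "nat \<Rightarrow> (vec \<Rightarrow> vec) \<Rightarrow> bool" where
  "is_bar_super m \<psi> \<longleftrightarrow>
     (\<forall>u\<in>Ehat_super m. \<psi> u \<in> Ehat_super m) \<and> (\<forall>u. u \<notin> Ehat_super m \<longrightarrow> \<psi> u = vzero)
   \<and> cont_antilinear (Ehat_super m) \<psi>
   \<and> (\<forall>f. typical m f \<longrightarrow> \<psi> (bvec f) = bvec f)
   \<and> (\<forall>X. \<forall>u\<in>Ehat_super m. \<psi> (act_super m X u) = act_super m (bar_gen X) (\<psi> u))
   \<and> (\<forall>u\<in>Ehat_super m. \<psi> (\<psi> u) = u)
   \<and> (\<forall>f\<in>Zsuper m. \<psi> (bvec f) f = 1
        \<and> (\<forall>g. laurent_int (\<psi> (bvec f) g) \<and> (g \<noteq> f \<and> \<psi> (bvec f) g \<noteq> 0 \<longrightarrow> super_less m g f)))"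

(* the bar involutions (unique by the context; defined on the completions, 0 elsewhere) *)
definition bar_plus :: "nat \<Rightarrow> vec \<Rightarrow> vec" where "bar_plus m = (THE \<psi>. is_bar_plus m \<psi>)"
definition bar_super :: "nat \<Rightarrow> vec \<Rightarrow> vec" where "bar_super m = (THE \<psi>. is_bar_super m \<psi>)"

definition U_plus :: "nat \<Rightarrow> (int \<Rightarrow> int) \<Rightarrow> vec" where
  "U_plus m f = (THE x. x \<in> Ehat_plus m \<and> bar_plus m x = x \<and> x f = 1
     \<and> (\<forall>g. g \<noteq> f \<longrightarrow> in_qZq (x g) \<and> (x g \<noteq> 0 \<longrightarrow> bruhat_less m g f)))"
definition L_plus :: "nat \<Rightarrow> (int \<Rightarrow> int) \<Rightarrow> vec" where
  "L_plus m f = (THE x. x \<in> Ehat_plus m \<and> bar_plus m x = x \<and> x f = 1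
     \<and> (\<forall>g. g \<noteq> f \<longrightarrow> in_qinvZqinv (x g) \<and> (x g \<noteq> 0 \<longrightarrow> bruhat_less m g f)))"
definition U_super :: "nat \<Rightarrow> (int \<Rightarrow> int) \<Rightarrow> vec" where
  "U_super m f = (THE x. x \<in> Ehat_super m \<and> bar_super m x = x \<and> x f = 1
     \<and> (\<forall>g. g \<noteq> f \<longrightarrow> in_qZq (x g) \<and> (x g \<noteq> 0 \<longrightarrow> super_less m g f)))"
definition L_super :: "nat \<Rightarrow> (int \<Rightarrow> int) \<Rightarrow> vec" where
  "L_super m f = (THE x. x \<in> Ehat_super m \<and> bar_super m x = x \<and> x f = 1
     \<and> (\<forall>g. g \<noteq> f \<longrightarrow> in_qinvZqinv (x g) \<and> (x g \<noteq> 0 \<longrightarrow> super_less m g f)))"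

(* partition \<lambda> with |\<lambda>> = v_{f(1)} \<wedge> v_{f(2)} \<wedge> ..., i.e. \<lambda>_k = f(k) + k - 1 *)
definition part_of :: "(int \<Rightarrow> int) \<Rightarrow> nat \<Rightarrow> int" where "part_of f k = f (int k) + int k - 1"
definition conj_part :: "(int \<Rightarrow> int) \<Rightarrow> int \<Rightarrow> int" where
  "conj_part f j = int (card {k::nat. 1 \<le> k \<and> part_of f k \<ge> j})"

(* index function of (1 \<otimes> C)(\<K>_f): w_{1-\<lambda>'_1} \<wedge> w_{2-\<lambda>'_2} \<wedge> ... *)
definition C_idx :: "nat \<Rightarrow> (int \<Rightarrow> int) \<Rightarrow> (int \<Rightarrow> int)" where
  "C_idx m f = (\<lambda>i. if i \<in> Dneg m then f i else if i \<in> Dpos then i - conj_part f i else 0)"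

(* \<natural>: continuous linear extension of 1 \<otimes> C *)
definition natural_map :: "nat \<Rightarrow> vec \<Rightarrow> vec" where
  "natural_map m u = (\<lambda>g. \<Sum>f \<in> {f \<in> Zplus m. u f \<noteq> 0 \<and> C_idx m f = g}. u f)"

(* i-th smallest element (i \<ge> 1) of a set of integers bounded below *)
definition nth_incr :: "int set \<Rightarrow> int \<Rightarrow> int" where
  "nth_incr A i = (THE x. x \<in> A \<and> int (card {y \<in> A. y < x}) = i - 1)"

definition nat_idx :: "nat \<Rightarrow> (int \<Rightarrow> int) \<Rightarrow> (int \<Rightarrow> int)" where
  "nat_idx m f = (\<lambda>i. if i \<in> Dneg m then f i
                      else if i \<in> Dpos then nth_incr (- (f ` Dpos)) i else 0)"

end

theory Submission
  imports Defs
begin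

text \<open>
  An index \<open>f\<close> on either side is determined by two sets of integers: \<open>A\<close>, its values on
  \<open>{-m..-1}\<close>, and \<open>B\<close>, its values on \<open>{1..}\<close> for \<open>\<E>\<^bsup>m|\<infinity>\<^esup>\<close>, the complement of these
  values for \<open>\<E>\<^bsup>m+\<infinity>\<^esup>\<close>. The map \<open>\<natural>\<close> preserves \<open>(A, B)\<close>, and in terms of \<open>(A, B)\<close> the
  generators act by the same formulas on both sides. The two Bruhat orders need not be
  compared: both refine the order generated by moving an element of \<open>A \<inter> B\<close>
  down to a place outside \<open>A \<union> B\<close>, and this is the order that controls all supports.

  The bar involution has an explicit matrix. Call an integer active if it lies in both or in none
  of \<open>A\<close>, \<open>B\<close>. The entry at a pair of labels with equal inactive parts is a product of local factors
  depending on the height at a site, the difference of the numbers of elements of \<open>A \<inter> B\<close> to its right.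
  Commutation with \<open>E\<^sub>a\<close> and \<open>F\<^sub>a\<close> becomes an identity between the factors at \<open>a\<close> and \<open>a + 1\<close>.
  Every index is the leading term of a vector obtained from a typical one by applying
  generators \<open>E\<^sub>a\<close>, \<open>F\<^sub>a\<close>; such a vector is fixed by any bar involution, which gives uniqueness and
  involutivity, and it has coefficients in \<open>q\<int>[q]\<close> below its leading term, so it is the canonical
  basis element. The dual canonical basis is obtained from it by a
  triangular recursion with bar-invariant coefficients.
\<close>

section \<open>The bar involution of the scalars\<close>

text \<open>Both bar involutions are given by definite descriptions, so a candidate must be
  exhibited and every competitor shown equal to it. The obstacle is that descending chains are
  infinite, so nothing can be proved from the bottom upwards. Instead a target coefficient
  \<open>h\<close> is fixed and the induction runs over \<open>N f - N h\<close>, where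
  \<open>N\<close>, the sum of the elements of A, drops at every move of a pair. The shape of the
  matrix is seen on one move. Let D stand for a site in both sets and O for a site in none. If
  \<open>a\<close> lies only in A and \<open>a + 1\<close> only in B, then F_a produces O D + q D O;
  as this is bar invariant, the image of O D must be O D + (q - q^-1) D O up to further terms. A
  vector built from generators is at first controlled only through its inactive part and
  \<open>N\<close>. That its support lies below its leading label is read off afterwards from bar
  invariance, because a bar-invariant scalar in q Z[q] is zero. For the dual basis the exponents of
  these vectors have the wrong sign, which is why it is obtained by correcting coefficients.\<close>

lemma Fract_0_1 [simp]: "Fract 0 1 = 0" and Fract_1_1 [simp]: "Fract 1 1 = 1"
  by (simp_all add: Zero_fract_def One_fract_def)

lemma Fract_one_add: "Fract (a + b) 1 = Fract a 1 + Fract b 1"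
  by simp

lemma Fract_one_eq_iff: "Fract a 1 = Fract b 1 \<longleftrightarrow> a = b"
  by (simp add: eq_fract)

text \<open>Horner form: statements about the image of a polynomial in Q(q) become accessible to
  induction over \<open>pCons\<close>.\<close>

lemma Fract_one_pCons: "Fract (pCons a p) 1 = qconst a + qq * Fract p 1"
proof -
  have "pCons a p = [:a:] + [:0, 1:] * p" by simp
  then show ?thesis unfolding qconst_def qq_def by simp
qed

lemma qconst_add: "qconst (a + b) = qconst a + qconst b"
  by (simp add: qconst_def)

lemma qconst_mult: "qconst (a * b) = qconst a * qconst b"
  by (simp add: qconst_def mult.commute)

lemma qconst_0 [simp]: "qconst 0 = 0"
  by (simp add: qconst_def)

lemma qconst_1 [simp]: "qconst 1 = 1"
  by (simp add: qconst_def pCons_one)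

lemma qconst_uminus: "qconst (- a) = - qconst a"
  by (simp add: qconst_def)

lemma qq_nonzero [simp]: "qq \<noteq> 0"
  using Fract_one_eq_iff[of "[:0, 1:]" "0::rat poly"] by (simp add: qq_def)

lemma qq_power_eq_Fract: "qq ^ n = Fract (monom 1 n) 1"
proof (induction n)
  case 0
  then show ?case by simp
next
  case (Suc n)
  have "monom (1::rat) (Suc n) = [:0, 1:] * monom 1 n"
    by (simp add: monom_Suc)
  then show ?case using Suc by (simp add: qq_def)
qed

definition eval_inv :: "rat poly \<Rightarrow> qf" where
  "eval_inv p = poly (map_poly qconst p) (inverse qq)"

lemma eval_inv_pCons: "eval_inv (pCons a p) = qconst a + inverse qq * eval_inv p"
  by (simp add: eval_inv_def map_poly_pCons)

lemma eval_inv_0 [simp]: "eval_inv 0 = 0"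
  by (simp add: eval_inv_def)

lemma eval_inv_add: "eval_inv (p + r) = eval_inv p + eval_inv r"
  by (induction p r rule: poly_induct2) (simp_all add: eval_inv_pCons qconst_add algebra_simps)

lemma eval_inv_smult: "eval_inv (smult c p) = qconst c * eval_inv p"
  by (induction p) (simp_all add: eval_inv_pCons qconst_mult algebra_simps)

lemma eval_inv_mult: "eval_inv (p * r) = eval_inv p * eval_inv r"
  by (induction p) (simp_all add: eval_inv_pCons eval_inv_add eval_inv_smult algebra_simps)

lemma eval_at_inverse:
  assumes \<phi>: "\<phi> 0 = 0" "\<And>a p. \<phi> (pCons a p) = \<kappa> a + inverse qq * \<phi> p"
    and \<iota>: "\<iota> 0 = 0" "\<And>a p. \<iota> (pCons a p) = \<kappa> a + qq * \<iota> p" "\<And>p r. \<iota> (p + r) = \<iota> p + \<iota> r"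
    and \<kappa>: "\<kappa> 0 = 0" and "degree p \<le> n"
  shows "\<exists>r. degree r \<le> n \<and> coeff r n = coeff p 0 \<and> \<phi> p = \<iota> r / qq ^ n"
  using \<open>degree p \<le> n\<close>
proof (induction n arbitrary: p)
  case 0
  then obtain a where "p = [:a:]" by (auto elim: degree_eq_zeroE)
  then show ?case by (intro exI[of _ "[:a:]"]) (simp add: \<phi> \<iota>)
next
  case (Suc n)
  obtain a s where p: "p = pCons a s" by (cases p)
  have "degree s \<le> n" using Suc.prems by (cases "s = 0") (auto simp: p)
  from Suc.IH[OF this] obtain r where r: "degree r \<le> n" "\<phi> s = \<iota> r / qq ^ n"
    by blast
  have "\<iota> (monom a k) = \<kappa> a * qq ^ k" for k
    by (induction k) (simp_all add: monom_0 monom_Suc \<iota> \<kappa>)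
  then have "\<iota> (monom a (Suc n) + r) / qq ^ Suc n = \<kappa> a + inverse qq * (\<iota> r / qq ^ n)"
    by (simp add: \<iota>(3) field_simps)
  moreover have "degree (monom a (Suc n) + r) \<le> Suc n"
    using r(1) by (intro degree_add_le) (auto simp: degree_monom_le)
  moreover have "coeff (monom a (Suc n) + r) (Suc n) = a"
    using r(1) by (simp add: coeff_eq_0)
  ultimately show ?case
    using r(2) by (intro exI[of _ "monom a (Suc n) + r"]) (simp add: p \<phi>(2))
qed

lemma eval_inv_eq_Fract:
  assumes "degree p \<le> n"
  shows "\<exists>r. degree r \<le> n \<and> coeff r n = coeff p 0 \<and> eval_inv p = Fract r 1 / qq ^ n"
  using assms by (intro eval_at_inverse[where \<kappa> = qconst]) (simp_all add: eval_inv_pCons Fract_one_pCons)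

text \<open>Denominators must survive the substitution of 1/q. The constant term reappears as a
  coefficient of the reversed polynomial, so it vanishes; then a factor 1/q cancels and the
  induction goes on.\<close>

lemma eval_inv_eq_0_iff [simp]: "eval_inv p = 0 \<longleftrightarrow> p = 0"
proof
  assume *: "eval_inv p = 0"
  have "p \<noteq> 0 \<Longrightarrow> False" using *
  proof (induction p)
    case (pCons a p)
    obtain r where r: "coeff r (degree (pCons a p)) = a"
      "eval_inv (pCons a p) = Fract r 1 / qq ^ degree (pCons a p)"
      using eval_inv_eq_Fract[of "pCons a p" "degree (pCons a p)"] by auto
    have "Fract r 1 = Fract 0 1"
      using r(2) unfolding pCons.prems by simp
    then have "r = 0" unfolding Fract_one_eq_iff .
    then have "a = 0" using r by simp
    then show False using pCons by (auto simp: eval_inv_pCons)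
  qed simp
  then show "p = 0" by blast
qed simp

definition qbar_rel :: "qf \<Rightarrow> qf \<Rightarrow> bool" where
  "qbar_rel x y \<longleftrightarrow> (\<exists>a b. b \<noteq> 0 \<and> x = Fract a b \<and> y = eval_inv a / eval_inv b)"

lemma qbar_rel_Fract:
  assumes "b \<noteq> 0"
  shows "qbar_rel (Fract a b) y \<longleftrightarrow> y = eval_inv a / eval_inv b"
proof
  assume "qbar_rel (Fract a b) y"
  then obtain c d where cd: "d \<noteq> 0" "Fract a b = Fract c d" "y = eval_inv c / eval_inv d"
    unfolding qbar_rel_def by blast
  then have "a * d = c * b" using assms by (simp add: eq_fract)
  then have "eval_inv a * eval_inv d = eval_inv c * eval_inv b" by (metis eval_inv_mult)
  then have "eval_inv c / eval_inv d = eval_inv a / eval_inv b"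
    using cd(1) assms by (simp add: frac_eq_eq mult.commute)
  then show "y = eval_inv a / eval_inv b" using cd(3) by simp
qed (use assms in \<open>auto simp: qbar_rel_def\<close>)

text \<open>Substituting 1/q in numerator and denominator gives existence. A competitor agrees on
  polynomials by the Horner form and hence on fractions.\<close>

lemma bar_q_props:
  "(\<forall>x y. bar_q (x + y) = bar_q x + bar_q y) \<and> (\<forall>x y. bar_q (x * y) = bar_q x * bar_q y)
    \<and> (\<forall>c. bar_q (qconst c) = qconst c) \<and> bar_q qq = inverse qq"
  (is "?P bar_q")
proof -
  define \<phi> where "\<phi> x = (THE y. qbar_rel x y)" for x
  have \<phi>: "\<phi> (Fract a b) = eval_inv a / eval_inv b" if "b \<noteq> 0" for a b
    unfolding \<phi>_def qbar_rel_Fract[OF that] by simp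
  have eval_inv_1: "eval_inv 1 = 1" by (simp add: eval_inv_def)
  have ex: "?P \<phi>"
  proof (intro conjI allI)
    fix x y
    show "\<phi> (x + y) = \<phi> x + \<phi> y"
      by (cases x; cases y) (simp add: \<phi> eval_inv_add eval_inv_mult add_frac_eq mult.commute)
    show "\<phi> (x * y) = \<phi> x * \<phi> y"
      by (cases x; cases y) (simp add: \<phi> eval_inv_mult)
  next
    fix c show "\<phi> (qconst c) = qconst c"
      by (simp add: qconst_def[of c] \<phi> eval_inv_pCons eval_inv_1)
  next
    show "\<phi> qq = inverse qq"
    proof -
      have "\<phi> qq = eval_inv [:0, 1:] / eval_inv 1"
        unfolding qq_def by (rule \<phi>) simp
      then show ?thesis by (simp add: eval_inv_pCons eval_inv_1)
    qed
  qed
  have uniq: "\<chi> x = \<phi> x" if \<chi>: "?P \<chi>" for \<chi> x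
  proof -
    have poly: "\<chi> (Fract p 1) = eval_inv p" for p
    proof (induction p)
      case 0
      have "\<chi> 0 = 0" using \<chi> by (metis add_cancel_right_left)
      then show ?case by simp
    next
      case (pCons a p)
      then show ?case using \<chi> unfolding Fract_one_pCons eval_inv_pCons by simp
    qed
    obtain a b where x: "x = Fract a b" "b \<noteq> 0" by (cases x) auto
    then have "x * Fract b 1 = Fract a 1" by (simp add: eq_fract)
    then have "\<chi> x * eval_inv b = eval_inv a" using \<chi> poly by metis
    then show ?thesis using x by (simp add: \<phi> field_simps)
  qed
  have "\<exists>!\<phi>. ?P \<phi>"
    using ex uniq by (intro ex_ex1I) (blast, metis ext)
  then show ?thesis unfolding bar_q_def by (rule theI')
qed

lemma bar_q_add [simp]: "bar_q (x + y) = bar_q x + bar_q y"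
  using bar_q_props by blast

lemma bar_q_mult [simp]: "bar_q (x * y) = bar_q x * bar_q y"
  using bar_q_props by blast

lemma bar_q_qconst [simp]: "bar_q (qconst c) = qconst c"
  using bar_q_props by blast

lemma bar_q_qq [simp]: "bar_q qq = inverse qq"
  using bar_q_props by blast

lemma bar_q_0 [simp]: "bar_q 0 = 0"
  by (metis bar_q_qconst qconst_0)

lemma bar_q_1 [simp]: "bar_q 1 = 1"
  by (metis bar_q_qconst qconst_1)

lemma bar_q_uminus [simp]: "bar_q (- x) = - bar_q x"
  by (metis add.right_inverse bar_q_0 bar_q_add eq_neg_iff_add_eq_0 add.commute)

lemma bar_q_diff [simp]: "bar_q (x - y) = bar_q x - bar_q y"
  by (metis bar_q_add bar_q_uminus diff_conv_add_uminus)

lemma bar_q_sum: "bar_q (sum f S) = (\<Sum>x\<in>S. bar_q (f x))"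
  by (induction S rule: infinite_finite_induct) auto

lemma bar_q_power [simp]: "bar_q (x ^ n) = bar_q x ^ n"
  by (induction n) auto

lemma bar_q_eq_0_iff [simp]: "bar_q x = 0 \<longleftrightarrow> x = 0"
proof
  assume "bar_q x = 0"
  show "x = 0"
  proof (rule ccontr)
    assume "x \<noteq> 0"
    then have "bar_q x * bar_q (inverse x) = 1"
      by (metis bar_q_1 bar_q_mult right_inverse)
    then show False using \<open>bar_q x = 0\<close> by simp
  qed
qed simp

lemma bar_q_inverse [simp]: "bar_q (inverse x) = inverse (bar_q x)"
  by (cases "x = 0") (simp, metis bar_q_1 bar_q_mult inverse_unique right_inverse)

lemma bar_q_divide [simp]: "bar_q (x / y) = bar_q x / bar_q y"
  by (simp add: divide_inverse)

lemma bar_q_bar_q [simp]: "bar_q (bar_q x) = x"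
proof -
  have poly: "bar_q (bar_q (Fract p 1)) = Fract p 1" for p
    by (induction p) (simp_all add: Fract_one_pCons)
  obtain a b where x: "x = Fract a b" "b \<noteq> 0" by (cases x) auto
  then have "x = Fract a 1 / Fract b 1" by (simp add: eq_fract)
  then show ?thesis by (simp only: bar_q_divide poly)
qed

lemma qpow_power_int: "qpow k = qq powi k"
  by (auto simp: qpow_def power_int_def)

lemma qpow_0 [simp]: "qpow 0 = 1"
  by (simp add: qpow_def)

lemma qpow_1 [simp]: "qpow 1 = qq"
  by (simp add: qpow_def)

lemma qpow_minus: "qpow (- k) = inverse (qpow k)"
  by (simp add: qpow_power_int power_int_minus)

lemma qpow_nonzero [simp]: "qpow k \<noteq> 0"
  by (simp add: qpow_power_int)

lemma bar_q_qpow [simp]: "bar_q (qpow k) = qpow (- k)"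
  by (auto simp: qpow_def)

section \<open>Integrality of scalars: Z[q], q Z[q] and integral Laurent polynomials\<close>

definition ipoly :: "int poly \<Rightarrow> qf" where
  "ipoly p = Fract (map_poly rat_of_int p) 1"

lemma ipoly_pCons: "ipoly (pCons a p) = of_int a + qq * ipoly p"
proof -
  have "qconst (of_int a) = of_int a"
  proof -
    have "qconst (of_nat n) = of_nat n" for n
      by (induction n) (simp_all add: qconst_add)
    then show ?thesis
      by (cases a rule: int_cases2) (simp_all add: qconst_uminus)
  qed
  then show ?thesis by (simp add: ipoly_def map_poly_pCons Fract_one_pCons)
qed

lemma ipoly_0 [simp]: "ipoly 0 = 0"
  by (simp add: ipoly_def)

lemma ipoly_1 [simp]: "ipoly 1 = 1"
  by (simp add: ipoly_def)

lemma ipoly_add: "ipoly (p + r) = ipoly p + ipoly r"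
  by (induction p r rule: poly_induct2) (simp_all add: ipoly_pCons algebra_simps del: Fract_of_nat_eq)

lemma ipoly_smult: "ipoly (smult c p) = of_int c * ipoly p"
  by (induction p) (simp_all add: ipoly_pCons algebra_simps)

lemma ipoly_mult: "ipoly (p * r) = ipoly p * ipoly r"
  by (induction p) (simp_all add: ipoly_pCons ipoly_add ipoly_smult algebra_simps)

lemma ipoly_uminus: "ipoly (- p) = - ipoly p"
  using ipoly_smult[of "-1" p] by simp

lemma ipoly_monom: "ipoly (monom a n) = of_int a * qq ^ n"
  by (induction n) (simp_all add: monom_0 monom_Suc ipoly_pCons algebra_simps)

lemma ipoly_eq_iff [simp]: "ipoly p = ipoly r \<longleftrightarrow> p = r"
  unfolding ipoly_def Fract_one_eq_iff by (auto simp: poly_eq_iff coeff_map_poly)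

lemma bar_q_of_int [simp]: "bar_q (of_int a) = of_int a"
proof -
  have "bar_q (of_nat n) = of_nat n" for n by (induction n) auto
  then show ?thesis by (cases a rule: int_cases2) auto
qed

lemma bar_q_ipoly:
  assumes "degree p \<le> n"
  shows "\<exists>r. degree r \<le> n \<and> bar_q (ipoly p) = ipoly r / qq ^ n"
  using eval_at_inverse[of "\<lambda>p. bar_q (ipoly p)" of_int ipoly p n] assms
  by (auto simp: ipoly_pCons ipoly_add)

lemma laurent_int_iff: "laurent_int x \<longleftrightarrow> (\<exists>p n. x = ipoly p / qq ^ n)"
  unfolding laurent_int_def ipoly_def qq_power_eq_Fract by (auto simp: monom_eq_0_iff)

lemma in_qZq_iff: "in_qZq x \<longleftrightarrow> (\<exists>p. x = qq * ipoly p)"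
proof
  assume "in_qZq x"
  then obtain p where "coeff p 0 = 0" "x = ipoly p" by (auto simp: in_qZq_def ipoly_def)
  then show "\<exists>p. x = qq * ipoly p" by (cases p) (auto simp: ipoly_pCons)
next
  assume "\<exists>p. x = qq * ipoly p"
  then obtain p where "x = qq * ipoly p" by blast
  then show "in_qZq x"
    unfolding in_qZq_def ipoly_def[symmetric]
    by (intro exI[of _ "pCons 0 p"]) (simp add: ipoly_pCons)
qed

lemma in_qinvZqinv_iff:
  "in_qinvZqinv x \<longleftrightarrow> (\<exists>p n. degree p \<le> n \<and> x = ipoly p / qq ^ Suc n)"
proof
  assume "in_qinvZqinv x"
  then obtain p n where "degree p < n" "x = Fract (map_poly rat_of_int p) (monom 1 n)"
    unfolding in_qinvZqinv_def by blast
  then show "\<exists>p n. degree p \<le> n \<and> x = ipoly p / qq ^ Suc n"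
    by (intro exI[of _ p] exI[of _ "n - 1"])
      (simp add: ipoly_def qq_power_eq_Fract monom_eq_0_iff del: power_Suc)
next
  assume "\<exists>p n. degree p \<le> n \<and> x = ipoly p / qq ^ Suc n"
  then obtain p n where "degree p \<le> n" "x = ipoly p / qq ^ Suc n" by blast
  then show "in_qinvZqinv x"
    unfolding in_qinvZqinv_def qq_power_eq_Fract ipoly_def
    by (intro exI[of _ p] exI[of _ "Suc n"]) (simp add: monom_eq_0_iff)
qed

text \<open>Bar reverses coefficients and so exchanges the two lattices; facts about q^-1 Z[q^-1]
  are inherited from q Z[q].\<close>

lemma in_qinvZqinv_iff_bar: "in_qinvZqinv x \<longleftrightarrow> in_qZq (bar_q x)"
proof
  assume "in_qinvZqinv x"
  then obtain p n where "degree p \<le> n" and x: "x = ipoly p / qq ^ Suc n"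
    unfolding in_qinvZqinv_iff by blast
  with bar_q_ipoly[of p n] obtain r where "bar_q (ipoly p) = ipoly r / qq ^ n" by blast
  then have "bar_q x = qq * ipoly r" by (simp add: x field_simps)
  then show "in_qZq (bar_q x)" unfolding in_qZq_iff by blast
next
  assume "in_qZq (bar_q x)"
  then obtain p where p: "bar_q x = qq * ipoly p" unfolding in_qZq_iff by blast
  obtain r where r: "degree r \<le> degree p" "bar_q (ipoly p) = ipoly r / qq ^ degree p"
    using bar_q_ipoly[of p] by blast
  have "x = inverse qq * bar_q (ipoly p)"
    using arg_cong[OF p, of bar_q] by simp
  then have "x = ipoly r / qq ^ Suc (degree p)" by (simp add: r field_simps)
  then show "in_qinvZqinv x" unfolding in_qinvZqinv_iff using r(1) by blast
qed

lemma in_qZq_add: "in_qZq x \<Longrightarrow> in_qZq y \<Longrightarrow> in_qZq (x + y)"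
  unfolding in_qZq_iff by (auto simp: distrib_left[symmetric] ipoly_add[symmetric])

lemma in_qZq_0 [simp]: "in_qZq 0"
  unfolding in_qZq_iff by (intro exI[of _ 0]) simp

lemma in_qZq_qq [simp]: "in_qZq qq"
  unfolding in_qZq_iff by (intro exI[of _ 1]) simp

lemma in_qZq_uminus: "in_qZq x \<Longrightarrow> in_qZq (- x)"
  unfolding in_qZq_iff by (auto simp: mult_minus_right[symmetric] ipoly_uminus[symmetric] simp del: mult_minus_right)

lemma in_qZq_diff: "in_qZq x \<Longrightarrow> in_qZq y \<Longrightarrow> in_qZq (x - y)"
  using in_qZq_add[of x "- y"] in_qZq_uminus[of y] by simp

lemma in_qZq_qq_mult: "in_qZq x \<Longrightarrow> in_qZq (qq * x)"
  unfolding in_qZq_iff using ipoly_pCons[of 0] by (auto intro: exI[of _ "pCons 0 _"])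

lemma in_qinvZqinv_diff: "in_qinvZqinv x \<Longrightarrow> in_qinvZqinv y \<Longrightarrow> in_qinvZqinv (x - y)"
  unfolding in_qinvZqinv_iff_bar by (simp add: in_qZq_diff)

text \<open>Such a scalar has only positive exponents and, by invariance, only negative ones.
  Uniqueness of canonical bases rests on this.\<close>

lemma bar_invariant_in_qZq:
  assumes "in_qZq x" "bar_q x = x"
  shows "x = 0"
proof -
  obtain p where p: "x = qq * ipoly p" using assms(1) unfolding in_qZq_iff by blast
  have "in_qinvZqinv x" using assms unfolding in_qinvZqinv_iff_bar by simp
  then obtain r n where r: "degree r \<le> n" "x = ipoly r / qq ^ Suc n"
    unfolding in_qinvZqinv_iff by blast
  \<comment> \<open>One factor q comes from q Z[q] and \<open>Suc n\<close> more from the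
    denominator, while \<open>r\<close> has degree at most \<open>n\<close>.\<close>
  have "ipoly (monom 1 (Suc (Suc n)) * p) = ipoly r"
    using p r(2) unfolding ipoly_mult ipoly_monom by (simp add: field_simps)
  then have *: "monom 1 (Suc (Suc n)) * p = r" by simp
  have "p = 0"
  proof (rule ccontr)
    assume "p \<noteq> 0"
    then have "degree r = Suc (Suc n) + degree p"
      by (simp add: *[symmetric] degree_mult_eq degree_monom_eq monom_eq_0_iff)
    then show False using r(1) by simp
  qed
  then show ?thesis by (simp add: p)
qed

lemma bar_invariant_in_qinvZqinv: "in_qinvZqinv x \<Longrightarrow> bar_q x = x \<Longrightarrow> x = 0"
  by (simp add: in_qinvZqinv_iff_bar bar_invariant_in_qZq)

lemma laurent_int_ipoly [simp]: "laurent_int (ipoly p)"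
  unfolding laurent_int_iff by (intro exI[of _ p] exI[of _ 0]) simp

lemma laurent_int_0 [simp]: "laurent_int 0"
  using laurent_int_ipoly[of 0] by simp

lemma laurent_int_1 [simp]: "laurent_int 1"
  using laurent_int_ipoly[of 1] by simp

lemma laurent_int_mult: "laurent_int x \<Longrightarrow> laurent_int y \<Longrightarrow> laurent_int (x * y)"
  unfolding laurent_int_iff by (auto simp: ipoly_mult[symmetric] power_add[symmetric]) blast

lemma laurent_int_add:
  assumes "laurent_int x" "laurent_int y"
  shows "laurent_int (x + y)"
proof -
  obtain p n s k where "x = ipoly p / qq ^ n" "y = ipoly s / qq ^ k"
    using assms unfolding laurent_int_iff by blast
  then have "x + y = ipoly (p * monom 1 k + s * monom 1 n) / qq ^ (n + k)"
    unfolding ipoly_add ipoly_mult ipoly_monom by (simp add: add_frac_eq power_add mult.commute)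
  then show ?thesis unfolding laurent_int_iff by blast
qed

lemma laurent_int_uminus: "laurent_int x \<Longrightarrow> laurent_int (- x)"
  unfolding laurent_int_iff by (auto simp: minus_divide_left ipoly_uminus[symmetric] simp del: minus_divide_left[symmetric]) blast

lemma laurent_int_diff: "laurent_int x \<Longrightarrow> laurent_int y \<Longrightarrow> laurent_int (x - y)"
  using laurent_int_add[of x "- y"] laurent_int_uminus[of y] by simp

lemma laurent_int_qpow [simp]: "laurent_int (qpow k)"
proof (cases "k \<ge> 0")
  case True
  then have "qpow k = ipoly (monom 1 (nat k))" by (simp add: qpow_def ipoly_monom)
  then show ?thesis by (metis laurent_int_ipoly)
next
  case False
  then have "qpow k = ipoly 1 / qq ^ nat (- k)" by (simp add: qpow_def divide_inverse power_inverse)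
  then show ?thesis unfolding laurent_int_iff by blast
qed

lemma laurent_int_sum: "(\<And>x. x \<in> S \<Longrightarrow> laurent_int (f x)) \<Longrightarrow> laurent_int (sum f S)"
  by (induction S rule: infinite_finite_induct) (auto intro: laurent_int_add)

lemma laurent_int_prod: "(\<And>x. x \<in> S \<Longrightarrow> laurent_int (f x)) \<Longrightarrow> laurent_int (prod f S)"
  by (induction S rule: infinite_finite_induct) (auto intro: laurent_int_mult)

lemma in_qZq_laurent_int: "in_qZq x \<Longrightarrow> laurent_int x"
  unfolding in_qZq_def ipoly_def[symmetric] by auto

text \<open>A symmetric Laurent polynomial can cancel all exponents that are not negative. This
  makes the recursion for the dual canonical basis solvable.\<close>

lemma laurent_int_split:
  assumes "laurent_int x"
  shows "\<exists>c. laurent_int c \<and> bar_q c = c \<and> in_qinvZqinv (c + x)"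
proof -
  have main: "\<exists>c. laurent_int c \<and> bar_q c = c \<and> in_qZq (c + ipoly p / qq ^ n)" for p n
  proof (induction n arbitrary: p)
    case 0
    obtain a s where p: "p = pCons a s" by (cases p)
    have "in_qZq (qq * ipoly s)" unfolding in_qZq_iff by blast
    moreover have "ipoly [:- a:] = - of_int a" by (simp add: ipoly_pCons)
    ultimately show ?case using laurent_int_ipoly[of "[:- a:]"]
      by (intro exI[of _ "ipoly [:- a:]"]) (simp add: p ipoly_pCons)
  next
    case (Suc n)
    obtain a s where p: "p = pCons a s" by (cases p)
    obtain c where c: "laurent_int c" "bar_q c = c" "in_qZq (c + ipoly s / qq ^ n)"
      using Suc by blast
    \<comment> \<open>The symmetric element with pole \<open>a / q^(n+1)\<close>: subtracting it
      trades this pole for the harmless term \<open>a q^(n+1)\<close>.\<close>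
    define e where "e = of_int a * (qq ^ Suc n + inverse (qq ^ Suc n))"
    have "e = ipoly (monom a (Suc n)) + ipoly [:a:] / qq ^ Suc n"
      unfolding ipoly_monom e_def by (simp add: ipoly_pCons field_simps)
    moreover have "laurent_int (ipoly [:a:] / qq ^ Suc n)" unfolding laurent_int_iff by blast
    ultimately have "laurent_int e" by (metis laurent_int_add laurent_int_ipoly)
    then have "laurent_int (c - e)" using c(1) by (rule laurent_int_diff[rotated])
    moreover have "bar_q (c - e) = c - e"
      using c(2) by (simp add: e_def algebra_simps power_inverse)
    moreover have "in_qZq (c - e + ipoly p / qq ^ Suc n)"
    proof -
      have "c - e + ipoly p / qq ^ Suc n = (c + ipoly s / qq ^ n) - qq * ipoly (monom a n)"
        unfolding e_def p ipoly_monom by (simp add: ipoly_pCons field_simps)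
      moreover have "in_qZq (qq * ipoly (monom a n))" unfolding in_qZq_iff by blast
      ultimately show ?thesis using c(3) in_qZq_diff by metis
    qed
    ultimately show ?case by blast
  qed
  obtain p n where x: "x = ipoly p / qq ^ n" using assms unfolding laurent_int_iff by blast
  \<comment> \<open>The main claim corrects into q Z[q], so it is applied to the bar image of
    \<open>x\<close>.\<close>
  obtain r where "bar_q (ipoly p) = ipoly r / qq ^ degree p" using bar_q_ipoly[of p] by blast
  then have "bar_q x = ipoly (monom 1 n * r) / qq ^ degree p"
    unfolding x ipoly_mult ipoly_monom by (simp add: field_simps)
  then obtain c where "laurent_int c" "bar_q c = c" "in_qZq (c + bar_q x)"
    using main by metis
  then show ?thesis unfolding in_qinvZqinv_iff_bar by auto
qed

section \<open>The matrix of the bar involution\<close>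

type_synonym lab = "int set \<times> int set"

definition dset :: "lab \<Rightarrow> int set" where "dset p = fst p \<inter> snd p"

definition site :: "lab \<Rightarrow> int \<Rightarrow> bool \<times> bool" where "site p z = (z \<in> fst p, z \<in> snd p)"

definition ht :: "lab \<Rightarrow> lab \<Rightarrow> int \<Rightarrow> int" where
  "ht p s z = int (card (dset p \<inter> {z<..})) - int (card (dset s \<inter> {z<..}))"

definition mqp :: "int \<Rightarrow> qf" where "mqp k = (- inverse qq) powi k"

text \<open>At height \<open>k\<close> the active factors are \<open>(-q)\<^bsup>-k\<^esup>\<close> on the diagonal, \<open>1\<close> for \<open>O \<rightarrow> D\<close> and
  \<open>q - q\<^bsup>-2k-1\<^esup>\<close> for \<open>D \<rightarrow> O\<close>, where \<open>D\<close> means in both sets and \<open>O\<close> in none. They are forced by the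
  bar invariance of \<open>O D + q D O\<close>. The last one vanishes at \<open>k = -1\<close>, which keeps all heights nonnegative.\<close>

definition cfac :: "int \<Rightarrow> bool \<times> bool \<Rightarrow> bool \<times> bool \<Rightarrow> qf" where
  "cfac k l l' =
    (if fst l = snd l \<and> fst l' = snd l' then
       (if fst l = fst l' then mqp k else if fst l then qq - mqp k * mqp k / qq else 1)
     else if l = l' then 1 else 0)"

text \<open>Restricting to factors different from 1 makes the product finite without a chosen
  window. Far to the left all sites are O and the height is the difference of the cardinalities, so
  these factors are 1 once that difference vanishes.\<close>

definition rmat :: "lab \<Rightarrow> lab \<Rightarrow> qf" where
  "rmat p s = (if card (dset p) = card (dset s)
     then \<Prod>z | cfac (ht p s z) (site p z) (site s z) \<noteq> 1. cfac (ht p s z) (site p z) (site s z)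
     else 0)"

text \<open>A window outside of which all factors are 1: on its right the height is zero, on its
  left it is zero as soon as the cardinalities agree.\<close>

definition adm :: "int \<Rightarrow> lab \<Rightarrow> lab \<Rightarrow> bool" where
  "adm n p s \<longleftrightarrow> (\<forall>z< - n. site p z = (False, False) \<and> site s z = (False, False))
     \<and> (\<forall>z>n. site p z = site s z \<and> site p z \<noteq> (True, True))"

lemma mqp_0 [simp]: "mqp 0 = 1"
  by (simp add: mqp_def)

lemma mqp_nonzero [simp]: "mqp k \<noteq> 0"
  by (simp add: mqp_def)

lemma mqp_add: "mqp (k + l) = mqp k * mqp l"
  by (simp add: mqp_def power_int_add)

lemma mqp_plus_1: "mqp (k + 1) = - mqp k / qq"
  by (simp add: mqp_add) (simp add: mqp_def divide_inverse)

lemma mqp_minus_1: "mqp (k - 1) = - mqp k * qq"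
  using mqp_add[of k "-1"] by (simp add: mqp_def[of "-1"])

lemma laurent_int_mqp [simp]: "laurent_int (mqp k)"
proof -
  have "laurent_int (qpow (- 1))" "laurent_int (qpow 1)" by (rule laurent_int_qpow)+
  then have "laurent_int (- inverse qq)" "laurent_int (- qq)"
    by (auto simp: qpow_minus intro: laurent_int_uminus)
  then have "laurent_int ((- inverse qq) ^ n)" "laurent_int ((- qq) ^ n)" for n
    by (induction n) (simp_all add: laurent_int_mult del: mult_minus_left)
  then show ?thesis by (auto simp: mqp_def power_int_def)
qed

lemma laurent_int_cfac [simp]: "laurent_int (cfac k l l')"
proof -
  have "mqp k * mqp k / qq = mqp k * mqp k * qpow (- 1)"
    by (simp add: qpow_minus divide_inverse)
  then have "laurent_int (mqp k * mqp k / qq)"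
    by (simp only: laurent_int_mult laurent_int_mqp laurent_int_qpow)
  moreover have "laurent_int qq" using laurent_int_qpow[of 1] by simp
  ultimately show ?thesis by (auto simp: cfac_def intro: laurent_int_diff)
qed

lemma laurent_int_rmat: "laurent_int (rmat p s)"
  by (auto simp: rmat_def intro: laurent_int_prod)

lemma cfac_same_0 [simp]: "cfac 0 l l = 1"
  by (auto simp: cfac_def)

lemma rmat_refl [simp]: "rmat p p = 1"
  by (simp add: rmat_def ht_def)

lemma dset_site: "z \<in> dset p \<longleftrightarrow> site p z = (True, True)"
  by (auto simp: dset_def site_def)

lemma adm_dset:
  assumes "adm n p s"
  shows "dset p \<subseteq> {-n..n}" "dset s \<subseteq> {-n..n}" "finite (dset p)" "finite (dset s)"
proof -
  have "z \<in> {-n..n}" if "z \<in> dset p \<or> z \<in> dset s" for z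
    using assms that unfolding adm_def dset_site by (cases "z < -n"; cases "z > n") auto
  then show *: "dset p \<subseteq> {-n..n}" "dset s \<subseteq> {-n..n}" by blast+
  then show "finite (dset p)" "finite (dset s)" by (auto intro: finite_subset)
qed

lemma adm_mono:
  assumes "adm n p s" "n \<le> n'"
  shows "adm n' p s"
  using assms unfolding adm_def by (metis le_less_trans neg_le_iff_le order_less_le_trans)

lemma adm_ht_above: "adm n p s \<Longrightarrow> n \<le> z \<Longrightarrow> ht p s z = 0"
  using adm_dset[of n p s] by (simp add: ht_def) (metis Int_emptyI atLeastAtMost_iff greaterThan_iff leD order.trans subsetD)

lemma adm_ht_below:
  assumes "adm n p s" "z < -n" "card (dset p) = card (dset s)"
  shows "ht p s z = 0"
proof -
  have "dset p \<inter> {z<..} = dset p" "dset s \<inter> {z<..} = dset s"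
    using adm_dset[OF assms(1)] assms(2) by auto
  then show ?thesis using assms(3) by (simp add: ht_def)
qed

lemma rmat_window:
  assumes "adm n p s"
  shows "rmat p s = (if card (dset p) = card (dset s)
     then \<Prod>z\<in>{-n..n}. cfac (ht p s z) (site p z) (site s z) else 0)"
proof (cases "card (dset p) = card (dset s)")
  case True
  have "cfac (ht p s z) (site p z) (site s z) = 1" if "z \<notin> {-n..n}" for z
  proof (cases "z < -n")
    case z: True
    then show ?thesis using assms adm_ht_below[OF assms z True] by (simp add: adm_def)
  next
    case False
    then have "z > n" using that by auto
    then show ?thesis using assms adm_ht_above[OF assms, of z] by (simp add: adm_def)
  qed
  then have "(\<Prod>z | cfac (ht p s z) (site p z) (site s z) \<noteq> 1. cfac (ht p s z) (site p z) (site s z))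
    = (\<Prod>z\<in>{-n..n}. cfac (ht p s z) (site p z) (site s z))"
    by (intro prod.mono_neutral_left) (blast | simp)+
  then show ?thesis using True by (simp add: rmat_def)
qed (simp add: rmat_def)

section \<open>Locality and commutation with the generators\<close>

definition dl :: "bool \<times> bool \<Rightarrow> int" where "dl l = (if l = (True, True) then 1 else 0)"

lemma ht_step:
  assumes "finite (dset p)" "finite (dset s)"
  shows "ht p s (z - 1) = ht p s z + dl (site p z) - dl (site s z)"
proof -
  have *: "int (card (dset t \<inter> {z - 1<..})) = int (card (dset t \<inter> {z<..})) + dl (site t z)"
    if "finite (dset t)" for t
  proof (cases "z \<in> dset t")
    case True
    then have "dset t \<inter> {z - 1<..} = insert z (dset t \<inter> {z<..})" by auto
    then show ?thesis using that True by (simp add: dl_def dset_site[symmetric])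
  next
    case False
    have "y \<in> {z - 1<..} \<longleftrightarrow> y \<in> {z<..}" if "y \<in> dset t" for y
    proof -
      have "y \<noteq> z" using that False by blast
      then show ?thesis by auto
    qed
    then have "dset t \<inter> {z - 1<..} = dset t \<inter> {z<..}" by blast
    then show ?thesis using False by (simp add: dl_def dset_site[symmetric])
  qed
  show ?thesis by (simp add: ht_def *[OF assms(1)] *[OF assms(2)])
qed

lemma card_split_at:
  fixes a :: int
  assumes "finite S" "z < a"
  shows "card (S \<inter> {z<..}) = card (S \<inter> {z<..<a}) + card (S \<inter> {a - 1<..})"
proof -
  have "S \<inter> {z<..} = (S \<inter> {z<..<a}) \<union> (S \<inter> {a - 1<..})" using assms(2) by auto
  then show ?thesis using assms(1) by (simp add: card_Un_disjoint disjoint_iff)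
qed

text \<open>Index 1 belongs to the site \<open>a + 1\<close>, index 0 to \<open>a\<close>;
  \<open>k\<close> is the height at \<open>a + 1\<close>. All sites left of \<open>a\<close> are
  absorbed into \<open>L\<close>, whose argument is the height at \<open>a - 1\<close>.\<close>

definition two_site :: "int \<Rightarrow> (int \<Rightarrow> qf) \<Rightarrow> bool \<times> bool \<Rightarrow> bool \<times> bool \<Rightarrow> bool \<times> bool \<Rightarrow> bool \<times> bool \<Rightarrow> qf" where
  "two_site k L l1 l0 l1' l0' = cfac k l1 l1' * cfac (k + dl l1 - dl l1') l0 l0'
     * L (k + dl l1 - dl l1' + dl l0 - dl l0')"

text \<open>As a function of the labels at the sites \<open>a\<close> and \<open>a + 1\<close> only, the entry is a product of
  two local factors; the remaining sites see these labels just through the height they create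
  to their right.\<close>

lemma rmat_local:
  assumes "adm n p0 s0" "- n < a" "a + 1 < n"
  shows "\<exists>k R L. \<forall>p s. (\<forall>z. z \<noteq> a \<longrightarrow> z \<noteq> a + 1 \<longrightarrow> site p z = site p0 z \<and> site s z = site s0 z) \<longrightarrow>
       rmat p s = R * two_site k L (site p (a + 1)) (site p a) (site s (a + 1)) (site s a)"
proof -
  define k where "k = ht p0 s0 (a + 1)"
  define R where "R = (\<Prod>z\<in>{a + 2..n}. cfac (ht p0 s0 z) (site p0 z) (site s0 z))"
  \<comment> \<open>\<open>e z\<close> is the height gained strictly between \<open>z\<close> and
    \<open>a\<close>. The test of cardinalities becomes part of \<open>L\<close>: at
    \<open>- n - 1\<close> the height must have returned to zero.\<close>
  define e where "e z = int (card (dset p0 \<inter> {z<..<a})) - int (card (dset s0 \<inter> {z<..<a}))" for z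
  define L where "L j = (if j + e (- n - 1) = 0
    then \<Prod>z\<in>{- n..a - 1}. cfac (j + e z) (site p0 z) (site s0 z) else 0)" for j
  have "rmat p s = R * two_site k L (site p (a + 1)) (site p a) (site s (a + 1)) (site s a)"
    if ps: "\<forall>z. z \<noteq> a \<longrightarrow> z \<noteq> a + 1 \<longrightarrow> site p z = site p0 z \<and> site s z = site s0 z" for p s
  proof -
    have p: "site p z = site p0 z" and s: "site s z = site s0 z" if "z \<noteq> a" "z \<noteq> a + 1" for z
      using ps that by auto
    have adm: "adm n p s"
      using assms p s unfolding adm_def
      by (smt (verit, ccfv_threshold))
    note fin = adm_dset[OF adm]
    have above: "ht p s z = ht p0 s0 z" if "z \<ge> a + 1" for z
    proof -
      have "dset p \<inter> {z<..} = dset p0 \<inter> {z<..}" "dset s \<inter> {z<..} = dset s0 \<inter> {z<..}"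
        using p s that by (auto simp: dset_site)
      then show ?thesis by (simp add: ht_def)
    qed
    define j where "j = k + dl (site p (a + 1)) - dl (site s (a + 1)) + dl (site p a) - dl (site s a)"
    have ht_a: "ht p s a = k + dl (site p (a + 1)) - dl (site s (a + 1))"
      using ht_step[OF fin(3,4), of "a + 1"] above[of "a + 1"] by (simp add: k_def)
    have ht_a1: "ht p s (a - 1) = j"
      using ht_step[OF fin(3,4), of a] ht_a by (simp add: j_def)
    have below: "ht p s z = j + e z" if "z < a" for z
    proof -
      have "dset p \<inter> {z<..<a} = dset p0 \<inter> {z<..<a}" "dset s \<inter> {z<..<a} = dset s0 \<inter> {z<..<a}"
        using p s by (auto simp: dset_site)
      then show ?thesis
        unfolding ht_a1[symmetric] e_def ht_def
        using card_split_at[OF fin(3) that] card_split_at[OF fin(4) that] by simp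
    qed
    have cards: "card (dset p) = card (dset s) \<longleftrightarrow> j + e (- n - 1) = 0"
    proof -
      have "dset p \<inter> {- n - 1<..} = dset p" "dset s \<inter> {- n - 1<..} = dset s" using fin by auto
      then have "ht p s (- n - 1) = int (card (dset p)) - int (card (dset s))" by (simp add: ht_def)
      moreover have "ht p s (- n - 1) = j + e (- n - 1)" using assms(2) by (intro below) simp
      ultimately show ?thesis by simp
    qed
    let ?c = "\<lambda>z. cfac (ht p s z) (site p z) (site s z)"
    have "{- n..n} = {- n..a - 1} \<union> ({a} \<union> ({a + 1} \<union> {a + 2..n}))" using assms(2,3) by auto
    then have "prod ?c {- n..n} = prod ?c {- n..a - 1} * (?c a * (?c (a + 1) * prod ?c {a + 2..n}))"
      by (simp only:) ((subst prod.union_disjoint, (auto)[3])+, simp)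
    also have "prod ?c {a + 2..n} = R"
      unfolding R_def using p s above by (intro prod.cong) auto
    also have "?c (a + 1) = cfac k (site p (a + 1)) (site s (a + 1))"
      using above[of "a + 1"] by (simp add: k_def)
    also have "prod ?c {- n..a - 1} = (\<Prod>z\<in>{- n..a - 1}. cfac (j + e z) (site p0 z) (site s0 z))"
      using p s below by (intro prod.cong) auto
    finally show ?thesis
      unfolding rmat_window[OF adm] cards two_site_def j_def[symmetric] L_def ht_a by (simp add: mult_ac)
  qed
  then show ?thesis by blast
qed

text \<open>\<open>F\<^sub>a\<close> and \<open>E\<^sub>a\<close> differ by exchanging the two sets of a label, so they are treated together;
  the side \<open>c\<close> tells which set is moved with coefficient one.\<close>

definition EF :: "bool \<Rightarrow> int \<Rightarrow> gen" where "EF c a = (if c then F a else E a)"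

definition sel :: "bool \<Rightarrow> lab \<Rightarrow> int set" where "sel c p = (if c then fst p else snd p)"

definition mv :: "bool \<Rightarrow> int \<Rightarrow> int \<Rightarrow> lab \<Rightarrow> lab" where
  "mv c x y p = (if c then (insert y (fst p - {x}), snd p) else (fst p, insert y (snd p - {x})))"

lemma sel_mv [simp]:
  "sel c (mv c x y p) = insert y (sel c p - {x})"
  "sel (\<not> c) (mv c x y p) = sel (\<not> c) p" "sel c (mv (\<not> c) x y p) = sel c p"
  by (simp_all add: sel_def mv_def)

lemma mv_mv: "x \<in> sel c p \<Longrightarrow> y \<notin> sel c p \<Longrightarrow> mv c y x (mv c x y p) = p"
  by (cases p) (auto simp: sel_def mv_def)

lemma mv_swap: "mv c x y (prod.swap p) = prod.swap (mv (\<not> c) x y p)"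
  by (simp add: mv_def prod.swap_def)

lemma rmat_F:
  assumes "adm n p s"
  shows "(if a \<in> fst p \<and> a + 1 \<notin> fst p then rmat (mv True a (a + 1) p) s else 0)
     + (if a + 1 \<in> snd p \<and> a \<notin> snd p then qpow (- kV (fst p) a) * rmat (mv False (a + 1) a p) s else 0)
   = (if a + 1 \<in> fst s \<and> a \<notin> fst s then rmat p (mv True (a + 1) a s) else 0)
     + (if a \<in> snd s \<and> a + 1 \<notin> snd s then qpow (kV (fst s) a) * rmat p (mv False a (a + 1) s) else 0)"
proof -
  define n' where "n' = max n (\<bar>a\<bar> + 2)"
  have adm: "adm n' p s" using assms by (rule adm_mono) (simp add: n'_def)
  have n': "- n' < a" "a + 1 < n'" by (auto simp: n'_def)
  from rmat_local[OF adm n'] obtain k R L where loc: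
    "\<forall>p' s'. (\<forall>z. z \<noteq> a \<longrightarrow> z \<noteq> a + 1 \<longrightarrow> site p' z = site p z \<and> site s' z = site s z) \<longrightarrow>
       rmat p' s' = R * two_site k L (site p' (a + 1)) (site p' a) (site s' (a + 1)) (site s' a)"
    by (elim exE)
  note loc = loc[rule_format]
  have off: "site (mv c x y t) z = site t z" if "z \<noteq> x" "z \<noteq> y" for c x y t z
    using that by (auto simp: site_def mv_def)
  have r1: "rmat (mv True a (a + 1) p) s =
      R * two_site k L (True, a + 1 \<in> snd p) (False, a \<in> snd p) (site s (a + 1)) (site s a)"
    by (subst loc) (simp add: off, simp add: site_def mv_def)
  have r2: "rmat (mv False (a + 1) a p) s =
      R * two_site k L (a + 1 \<in> fst p, False) (a \<in> fst p, True) (site s (a + 1)) (site s a)"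
    by (subst loc) (simp add: off, simp add: site_def mv_def)
  have r3: "rmat p (mv True (a + 1) a s) =
      R * two_site k L (site p (a + 1)) (site p a) (False, a + 1 \<in> snd s) (True, a \<in> snd s)"
    by (subst loc) (simp add: off, simp add: site_def mv_def)
  have r4: "rmat p (mv False a (a + 1) s) =
      R * two_site k L (site p (a + 1)) (site p a) (a + 1 \<in> fst s, True) (a \<in> fst s, False)"
    by (subst loc) (simp add: off, simp add: site_def mv_def)
  show ?thesis
    unfolding r1 r2 r3 r4
    unfolding two_site_def site_def kV_def ind_def
    \<comment> \<open>The eight memberships give 256 cases, each an identity in \<open>q\<close> and
      \<open>mqp k\<close> with \<open>R\<close> and the function \<open>L\<close> left
      arbitrary.\<close>
    by (cases "a \<in> fst p"; cases "a + 1 \<in> fst p"; cases "a \<in> snd p"; cases "a + 1 \<in> snd p";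
        cases "a \<in> fst s"; cases "a + 1 \<in> fst s"; cases "a \<in> snd s"; cases "a + 1 \<in> snd s";
        simp add: cfac_def dl_def qpow_minus mqp_plus_1 mqp_minus_1; simp add: field_simps)
qed

lemma dset_swap [simp]: "dset (prod.swap p) = dset p"
  by (auto simp: dset_def)

text \<open>Exchanging A and B fixes D and O and interchanges the two inactive types, which the
  factors treat alike.\<close>

lemma rmat_swap: "rmat (prod.swap p) (prod.swap s) = rmat p s"
proof -
  have "site (prod.swap t) z = prod.swap (site t z)" for t z by (simp add: site_def)
  moreover have "cfac k (prod.swap l) (prod.swap l') = cfac k l l'" for k l l'
    by (cases l; cases l') (auto simp: cfac_def)
  moreover have "ht (prod.swap p) (prod.swap s) z = ht p s z" for z by (simp add: ht_def)
  ultimately show ?thesis by (simp add: rmat_def)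
qed

text \<open>The two sides are the coefficients of \<open>\<psi> (X K\<^sub>p)\<close> and \<open>X (\<psi> K\<^sub>p)\<close> at \<open>K\<^sub>s\<close> for \<open>X = EF c a\<close>.\<close>

lemma rmat_EF:
  assumes "adm n p s"
  shows "(if a \<in> sel c p \<and> a + 1 \<notin> sel c p then rmat (mv c a (a + 1) p) s else 0)
     + (if a + 1 \<in> sel (\<not> c) p \<and> a \<notin> sel (\<not> c) p
        then qpow (- kV (sel c p) a) * rmat (mv (\<not> c) (a + 1) a p) s else 0)
   = (if a + 1 \<in> sel c s \<and> a \<notin> sel c s then rmat p (mv c (a + 1) a s) else 0)
     + (if a \<in> sel (\<not> c) s \<and> a + 1 \<notin> sel (\<not> c) s
        then qpow (kV (sel c s) a) * rmat p (mv (\<not> c) a (a + 1) s) else 0)"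
proof (cases c)
  case True
  then have c: "c = True" by simp
  show ?thesis using rmat_F[OF assms, of a]
    by (simp only: c sel_def if_True if_False not_True_eq_False)
next
  case False
  have "adm n (prod.swap p) (prod.swap s)"
    using assms by (auto simp: adm_def site_def)
  from rmat_F[OF this, of a] show ?thesis
    using False
    by (simp only: mv_swap rmat_swap fst_swap snd_swap sel_def if_True if_False not_True_eq_False not_False_eq_True)
qed

section \<open>The order on labels\<close>

text \<open>Nonnegative heights say that the i-th largest atypical entry of \<open>p\<close> is at
  least that of \<open>s\<close>. This closed form of the order generated by moves is evidently
  transitive and can be read off the factors of the matrix.\<close>

definition dominates :: "lab \<Rightarrow> lab \<Rightarrow> bool" where
  "dominates p s \<longleftrightarrow> fst p - snd p = fst s - snd s \<and> snd p - fst p = snd s - fst s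
     \<and> card (dset p) = card (dset s) \<and> (\<forall>z. 0 \<le> ht p s z)"

lemma dominates_refl [simp]: "dominates p p"
  by (simp add: dominates_def ht_def)

lemma dominates_trans: "dominates p s \<Longrightarrow> dominates s t \<Longrightarrow> dominates p t"
  unfolding dominates_def ht_def by (metis (no_types, opaque_lifting) diff_ge_0_iff_ge order_trans)

lemma lab_eqI:
  assumes "fst p - snd p = fst s - snd s" "snd p - fst p = snd s - fst s" "dset p = dset s"
  shows "p = s"
proof (rule prod_eqI)
  show "fst p = fst s" using assms unfolding dset_def by blast
  show "snd p = snd s" using assms unfolding dset_def by blast
qed

text \<open>Heights start at zero on the far left. Read to the right, the first negative height
  would be -1 and would come from a D in \<open>p\<close> that is lost in \<open>s\<close>; the
  factor at that site vanishes.\<close>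

lemma rmat_dom:
  assumes adm: "adm n p s" and nz: "rmat p s \<noteq> 0"
  shows "dominates p s"
proof -
  have card: "card (dset p) = card (dset s)" using nz unfolding rmat_def by metis
  have fac: "cfac (ht p s z) (site p z) (site s z) \<noteq> 0" if "z \<in> {-n..n}" for z
    using nz that unfolding rmat_window[OF adm] by (auto simp: prod_zero_iff split: if_splits)
  have type: "(z \<in> fst p - snd p \<longleftrightarrow> z \<in> fst s - snd s) \<and> (z \<in> snd p - fst p \<longleftrightarrow> z \<in> snd s - fst s)" for z
  proof (cases "z \<in> {-n..n}")
    case True
    then show ?thesis using fac[OF True] by (auto simp: cfac_def site_def split: if_splits)
  next
    case False
    then have "z < - n \<or> z > n" by auto
    then have "site p z = site s z" using adm unfolding adm_def by metis
    then show ?thesis by (simp add: site_def)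
  qed
  have nonneg: "0 \<le> ht p s (- n - 1 + int i)" for i
  proof (induction i)
    case 0
    then show ?case using adm_ht_below[OF adm _ card, of "- n - 1"] by simp
  next
    case (Suc i)
    define w where "w = - n + int i"
    have w_eq: "- n - 1 + int (Suc i) = w" "- n - 1 + int i = w - 1" by (simp_all add: w_def)
    show ?case
      unfolding w_eq
    proof (rule ccontr)
      assume "\<not> 0 \<le> ht p s w"
      with Suc have w: "0 \<le> ht p s (w - 1)" "\<not> 0 \<le> ht p s w" unfolding w_eq by auto
      have "w \<le> n" using w(2) adm_ht_above[OF adm, of w] by linarith
      then have c: "cfac (ht p s w) (site p w) (site s w) \<noteq> 0" by (intro fac) (auto simp: w_def)
      have "ht p s (w - 1) = ht p s w + dl (site p w) - dl (site s w)"
        using adm_dset[OF adm] by (intro ht_step)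
      then have "ht p s w = -1 \<and> site p w = (True, True) \<and> site s w \<noteq> (True, True)"
        using w by (auto simp: dl_def split: if_splits)
      then show False using c by (cases "site s w") (auto simp: cfac_def mqp_def split: if_splits)
    qed
  qed
  have "0 \<le> ht p s z" for z
    using adm_ht_below[OF adm _ card, of z] nonneg[of "nat (z + n + 1)"] by (cases "z < - n") simp_all
  then show ?thesis using type card unfolding dominates_def by blast
qed

text \<open>Pairs move to the left from \<open>p\<close> to \<open>s\<close>. Hence lower bounds
  pass from \<open>s\<close> back to \<open>p\<close>, and upper bounds from \<open>p\<close> on to
  \<open>s\<close>.\<close>

lemma dominates_lower:
  assumes "dominates p s" "finite (dset p)" "finite (dset s)" "dset s \<subseteq> {d..}"
  shows "dset p \<subseteq> {d..}"
proof -
  have "dset s \<inter> {d - 1<..} = dset s" using assms(4) by auto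
  then have "card (dset p) \<le> card (dset p \<inter> {d - 1<..})"
    using assms(1) unfolding dominates_def ht_def by (metis diff_ge_0_iff_ge of_nat_le_iff)
  then have "dset p \<inter> {d - 1<..} = dset p"
    using assms(2) by (intro card_seteq) auto
  then have "dset p \<subseteq> {d - 1<..}" by blast
  then show ?thesis by auto
qed

lemma dominates_upper:
  assumes "dominates p s" "finite (dset s)" "dset p \<subseteq> {..d}"
  shows "dset s \<subseteq> {..d}"
proof -
  have "dset p \<inter> {d<..} = {}" using assms(3) by auto
  then have "card (dset s \<inter> {d<..}) = 0"
    using assms(1) unfolding dominates_def ht_def by (metis card.empty diff_ge_0_iff_ge le_zero_eq of_nat_le_iff)
  then have "dset s \<inter> {d<..} = {}" using assms(2) by simp
  then show ?thesis by (auto simp: disjoint_iff not_less)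
qed

text \<open>This controls the columns of the matrix: a bound for a target is a bound for all its
  sources.\<close>

lemma dominates_snd_lower:
  assumes "dominates p s" "finite (dset p)" "finite (dset s)" "snd s \<subseteq> {d..}"
  shows "snd p \<subseteq> {d..}"
proof -
  have "dset p \<subseteq> {d..}" using assms by (intro dominates_lower[OF assms(1-3)]) (auto simp: dset_def)
  moreover have "snd p - fst p \<subseteq> {d..}" using assms(1,4) unfolding dominates_def by blast
  ultimately show ?thesis unfolding dset_def by blast
qed

text \<open>The atypical entries of \<open>s\<close> are trapped between \<open>d\<close> and an
  upper bound for those of \<open>p\<close>, and together with the inactive parts they determine
  \<open>s\<close>. This puts the rows of the matrix into the completion.\<close>

lemma finite_dom_below:
  assumes "finite (dset p)"
  shows "finite {s. dominates p s \<and> finite (dset s) \<and> snd s \<subseteq> {d..}}" (is "finite ?S")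
proof -
  obtain u where u: "dset p \<subseteq> {..u}"
    using assms by (metis bdd_above.E bdd_above_finite atMost_iff subsetI)
  have "dset ` ?S \<subseteq> Pow {d..u}"
  proof (clarsimp)
    fix A B :: "int set" and x
    assume *: "dominates p (A, B)" "finite (dset (A, B))" "B \<subseteq> {d..}" "x \<in> dset (A, B)"
    then show "d \<le> x \<and> x \<le> u"
      using dominates_upper[OF *(1,2) u] by (auto simp: dset_def)
  qed
  then have "finite (dset ` ?S)" by (rule finite_subset) simp
  moreover have "inj_on dset ?S"
    by (intro inj_onI lab_eqI) (auto simp: dominates_def)
  ultimately show ?thesis by (rule finite_imageD)
qed

lemma dominates_dset_empty:
  assumes "dominates p s" "dset p = {}" "finite (dset s)"
  shows "s = p"
proof -
  have "dset s = {}" using assms by (auto simp: dominates_def)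
  then show ?thesis using assms by (intro lab_eqI) (auto simp: dominates_def)
qed

definition swp :: "lab \<Rightarrow> lab \<Rightarrow> bool" where
  "swp p s \<longleftrightarrow> (\<exists>x y. y < x \<and> x \<in> dset p \<and> y \<notin> fst p \<and> y \<notin> snd p
     \<and> s = (insert y (fst p - {x}), insert y (snd p - {x})))"

lemma card_exchange:
  assumes "finite S" "x \<in> S" "y \<notin> S"
  shows "card (insert y (S - {x})) = card S"
proof -
  have "card (insert y (S - {x})) = Suc (card (S - {x}))" using assms by (intro card_insert_disjoint) auto
  also have "\<dots> = card S" using assms by (intro card_Suc_Diff1)
  finally show ?thesis .
qed

lemma dominates_swp_chain:
  assumes "dominates p s" "finite (dset p)" "finite (dset s)"
  shows "swp\<^sup>*\<^sup>* p s"
  using assms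
proof (induction "card (dset p - dset s)" arbitrary: p rule: less_induct)
  case less
  note fin = less.prems(2,3)
  have card: "card (dset p) = card (dset s)" using less.prems(1) by (simp add: dominates_def)
  show ?case
  proof (cases "dset s \<subseteq> dset p")
    case True
    then have "dset s = dset p" using fin card by (intro card_seteq) auto
    then have "p = s" using less.prems(1) by (intro lab_eqI) (auto simp: dominates_def)
    then show ?thesis by simp
  next
    case False
    define y where "y = Max (dset s - dset p)"
    have y: "y \<in> dset s" "y \<notin> dset p" and ymax: "\<And>z. z \<in> dset s \<Longrightarrow> y < z \<Longrightarrow> z \<in> dset p"
    proof -
      have "y \<in> dset s - dset p" unfolding y_def using False fin by (intro Max_in) auto
      then show "y \<in> dset s" "y \<notin> dset p" by auto
      show "z \<in> dset p" if "z \<in> dset s" "y < z" for z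
        using that fin Max_ge[of "dset s - dset p" z] unfolding y_def[symmetric] by fastforce
    qed
    have y': "y \<notin> fst p" "y \<notin> snd p"
      using y less.prems(1) unfolding dominates_def dset_def by blast+
    \<comment> \<open>Otherwise the height at \<open>y - 1\<close>, where \<open>y\<close> itself is
      counted, would be negative.\<close>
    have "\<exists>x \<in> dset p - dset s. x > y"
    proof (rule ccontr)
      assume no: "\<not> ?thesis"
      have "dset p \<inter> {y - 1<..} \<subseteq> dset s \<inter> {y - 1<..} - {y}"
      proof
        fix z assume z: "z \<in> dset p \<inter> {y - 1<..}"
        then have "z \<noteq> y" using y(2) by blast
        then have "y < z" using z by auto
        then show "z \<in> dset s \<inter> {y - 1<..} - {y}" using z no by auto
      qed
      then have "card (dset p \<inter> {y - 1<..}) \<le> card (dset s \<inter> {y - 1<..} - {y})"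
        using fin by (intro card_mono) auto
      also have "\<dots> < card (dset s \<inter> {y - 1<..})"
        using fin y by (intro card_Diff1_less) auto
      finally have "ht p s (y - 1) < 0" by (simp add: ht_def)
      then show False using less.prems(1) unfolding dominates_def by (metis not_less)
    qed
    then obtain x where x: "x \<in> dset p" "x \<notin> dset s" "y < x" by blast
    define p' where "p' = (insert y (fst p - {x}), insert y (snd p - {x}))"
    have D: "dset p' = insert y (dset p - {x})" by (auto simp: dset_def p'_def)
    have swp: "swp p p'" unfolding swp_def p'_def using x y' by blast
    have inactive: "fst p' - snd p' = fst p - snd p" "snd p' - fst p' = snd p - fst p"
      using x y' by (auto simp: p'_def dset_def)
    have "card (dset p') = card (dset p)" unfolding D using x y fin by (intro card_exchange)
    \<comment> \<open>From \<open>y\<close> on, the new label contains all atypical entries of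
      \<open>s\<close> further right. For \<open>z < y\<close> both the removed \<open>x\<close> and
      the new \<open>y\<close> are counted, so the height is unchanged.\<close>
    moreover have "0 \<le> ht p' s z" for z
    proof (cases "y \<le> z")
      case True
      have "dset s \<inter> {z<..} \<subseteq> dset p' \<inter> {z<..}"
        unfolding D using ymax True x(2) by fastforce
      then have "card (dset s \<inter> {z<..}) \<le> card (dset p' \<inter> {z<..})"
        using fin by (intro card_mono) (auto simp: D)
      then show ?thesis by (simp add: ht_def)
    next
      case False
      then have "dset p' \<inter> {z<..} = insert y (dset p \<inter> {z<..} - {x})" unfolding D by auto
      moreover have "x \<in> dset p \<inter> {z<..}" "y \<notin> dset p \<inter> {z<..}" using x y False by auto
      ultimately have "card (dset p' \<inter> {z<..}) = card (dset p \<inter> {z<..})"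
        using fin by (metis card_exchange finite_Int)
      then have "ht p' s z = ht p s z" by (simp add: ht_def)
      then show ?thesis using less.prems(1) by (simp add: dominates_def)
    qed
    ultimately have "dominates p' s" using less.prems(1) inactive by (simp add: dominates_def)
    moreover have "card (dset p' - dset s) < card (dset p - dset s)"
    proof (rule psubset_card_mono)
      show "dset p' - dset s \<subset> dset p - dset s" using x y by (auto simp: D)
    qed (use fin in auto)
    ultimately have "swp\<^sup>*\<^sup>* p' s" using less.hyps fin by (auto simp: D)
    with swp show ?thesis by (rule converse_rtranclp_into_rtranclp)
  qed
qed


text \<open>The sum of A is the grading behind all later inductions.\<close>

lemma swp_sum_less:
  assumes "swp p s" "finite (fst p)"
  shows "\<Sum>(fst s) < \<Sum>(fst p) \<and> finite (fst s)"
proof -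
  obtain x y where xy: "y < x" "x \<in> fst p" "y \<notin> fst p" "fst s = insert y (fst p - {x})"
    using assms(1) unfolding swp_def dset_def by auto
  have "\<Sum>(fst p) = x + \<Sum>(fst p - {x})" using assms(2) xy(2) by (rule sum.remove)
  moreover have "\<Sum>(fst s) = y + \<Sum>(fst p - {x})"
    unfolding xy(4) using assms(2) xy(3) by (intro sum.insert) auto
  ultimately show ?thesis using xy assms(2) by simp
qed

text \<open>\<open>K a\<close> acts through inactive entries alone, so this implies equal weights.
  Quantifying over sides lets E and F share one argument.\<close>

definition inact :: "lab \<Rightarrow> lab \<Rightarrow> bool" where
  "inact p s \<longleftrightarrow> (\<forall>c z. z \<in> sel c p \<and> z \<notin> sel (\<not> c) p \<longleftrightarrow> z \<in> sel c s \<and> z \<notin> sel (\<not> c) s)"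

lemma inactI:
  assumes "\<And>z. z \<in> sel c p \<and> z \<notin> sel (\<not> c) p \<longleftrightarrow> z \<in> sel c s \<and> z \<notin> sel (\<not> c) s"
    "\<And>z. z \<in> sel (\<not> c) p \<and> z \<notin> sel c p \<longleftrightarrow> z \<in> sel (\<not> c) s \<and> z \<notin> sel c s"
  shows "inact p s"
  unfolding inact_def
proof (intro allI)
  fix c' z
  show "z \<in> sel c' p \<and> z \<notin> sel (\<not> c') p \<longleftrightarrow> z \<in> sel c' s \<and> z \<notin> sel (\<not> c') s"
    using assms[of z] by (cases c; cases c') simp_all
qed

text \<open>If \<open>a + 1\<close> is an atypical entry of \<open>p\<close>, then \<open>EF c a\<close> maps a vector with leading label
  \<open>mv c (a + 1) a p\<close> to one with leading label \<open>p\<close>; below, \<open>s\<close> is a label in its support.\<close>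

lemma inact_EF_same:
  assumes p: "a + 1 \<in> sel c p" "a + 1 \<in> sel (\<not> c) p" "a \<notin> sel c p"
    and s: "a + 1 \<in> sel c s" "a \<notin> sel c s" and ia: "inact (mv c (a + 1) a p) (mv c (a + 1) a s)"
  shows "inact p s \<and> a + 1 \<in> sel (\<not> c) s"
proof -
  note ia = ia[unfolded inact_def, rule_format, of _ c] ia[unfolded inact_def, rule_format, of _ "\<not> c"]
  have a: "a + 1 \<in> sel (\<not> c) s" "a \<in> sel (\<not> c) s \<longleftrightarrow> a \<in> sel (\<not> c) p"
    using ia[of "a + 1"] ia[of a] p s by auto
  have "z \<in> sel c p \<and> z \<notin> sel (\<not> c) p \<longleftrightarrow> z \<in> sel c s \<and> z \<notin> sel (\<not> c) s"
    "z \<in> sel (\<not> c) p \<and> z \<notin> sel c p \<longleftrightarrow> z \<in> sel (\<not> c) s \<and> z \<notin> sel c s" for z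
    using ia[of z] a p s by (cases "z = a"; cases "z = a + 1"; auto)+
  then have "inact p s" by (rule inactI)
  then show ?thesis using a by blast
qed

text \<open>The exponent is the point: this summand brings a factor \<open>q\<close> exactly when
  \<open>a\<close> is free in \<open>p\<close>, and no power of \<open>q\<close> otherwise.\<close>

lemma inact_EF_other:
  assumes p: "a + 1 \<in> sel c p" "a + 1 \<in> sel (\<not> c) p" "a \<notin> sel c p"
    and s: "a \<in> sel (\<not> c) s" "a + 1 \<notin> sel (\<not> c) s" and ia: "inact (mv c (a + 1) a p) (mv (\<not> c) a (a + 1) s)"
  shows "inact p s \<and> kV (sel c s) a = (if a \<in> sel (\<not> c) p then 0 else 1)"
proof -
  note ia = ia[unfolded inact_def, rule_format, of _ c] ia[unfolded inact_def, rule_format, of _ "\<not> c"]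
  have a: "a + 1 \<notin> sel c s" "a \<in> sel c s \<longleftrightarrow> a \<notin> sel (\<not> c) p"
    using ia[of "a + 1"] ia[of a] p s by auto
  have "z \<in> sel c p \<and> z \<notin> sel (\<not> c) p \<longleftrightarrow> z \<in> sel c s \<and> z \<notin> sel (\<not> c) s"
    "z \<in> sel (\<not> c) p \<and> z \<notin> sel c p \<longleftrightarrow> z \<in> sel (\<not> c) s \<and> z \<notin> sel c s" for z
    using ia[of z] a p s by (cases "z = a"; cases "z = a + 1"; auto)+
  then have "inact p s" by (rule inactI)
  then show ?thesis using a by (simp add: kV_def ind_def)
qed

section \<open>Fock spaces indexed by pairs of sets\<close>

type_synonym idx = "int \<Rightarrow> int"

lemma vzero_apply [simp]: "vzero f = 0"
  by (simp add: vzero_def)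

lemma vadd_apply [simp]: "vadd u v f = u f + v f"
  by (simp add: vadd_def)

lemma vsmult_apply [simp]: "vsmult c u f = c * u f"
  by (simp add: vsmult_def)

lemma cond_vec_apply: "cond_vec P v f = (if P then v f else 0)"
  by (simp add: cond_vec_def)

lemma bvec_apply: "bvec f g = (if g = f then 1 else 0)"
  by (simp add: bvec_def)

definition vbar :: "vec \<Rightarrow> vec" where "vbar u = (\<lambda>f. bar_q (u f))"

lemma vbar_apply [simp]: "vbar u f = bar_q (u f)"
  by (simp add: vbar_def)

lemma vbar_vbar [simp]: "vbar (vbar u) = u"
  by (simp add: vbar_def)

lemma vbar_bvec [simp]: "vbar (bvec f) = bvec f"
  by (auto simp: vbar_def bvec_def)

lemma bar_q_if [simp]: "bar_q (if b then x else y) = (if b then bar_q x else bar_q y)"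
  by simp

lemma ext_bvec [simp]: "ext M (bvec f) = M f"
proof
  fix g
  have "{k. bvec f k \<noteq> 0 \<and> M k g \<noteq> 0} = (if M f g = 0 then {} else {f})" by (auto simp: bvec_apply)
  then show "ext M (bvec f) g = M f g" by (simp add: ext_def bvec_apply)
qed

lemma ext_eq_sum:
  assumes "finite S" "{f. u f \<noteq> 0 \<and> M f g \<noteq> 0} \<subseteq> S"
  shows "ext M u g = (\<Sum>f\<in>S. u f * M f g)"
  unfolding ext_def using assms by (intro sum.mono_neutral_left) auto

lemma vbar_ext: "vbar (ext M u) = ext (\<lambda>f. vbar (M f)) (vbar u)"
  by (simp add: ext_def vbar_def bar_q_sum)

text \<open>Of the order only three facts are kept: it contains the moves, it is transitive, and it
  never increases the sum of A. The last is a weak inequality since steps that merely reorder one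
  half preserve the sum.\<close>

locale fock =
  fixes Z :: "idx set" and lb :: "idx \<Rightarrow> lab" and gn :: "gen \<Rightarrow> idx \<Rightarrow> vec"
    and lt :: "idx \<Rightarrow> idx \<Rightarrow> bool" and ul :: "lab \<Rightarrow> idx"
  defines "ul \<equiv> inv_into Z lb"
  assumes fin_fst: "f \<in> Z \<Longrightarrow> finite (fst (lb f))"
    and tail: "f \<in> Z \<Longrightarrow> \<exists>n. (\<forall>z < - n. z \<notin> snd (lb f)) \<and> (\<forall>z>n. z \<in> snd (lb f))"
    and lb_inj: "inj_on lb Z"
    and mv_closed: "p \<in> lb ` Z \<Longrightarrow> x \<in> sel c p \<Longrightarrow> y \<notin> sel c p \<Longrightarrow> y = x + 1 \<or> x = y + 1 \<Longrightarrow> mv c x y p \<in> lb ` Z"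
    and gn_EF: "f \<in> Z \<Longrightarrow> gn (EF c a) f =
       vadd (cond_vec (a \<in> sel c (lb f) \<and> a + 1 \<notin> sel c (lb f)) (bvec (ul (mv c a (a + 1) (lb f)))))
         (cond_vec (a + 1 \<in> sel (\<not> c) (lb f) \<and> a \<notin> sel (\<not> c) (lb f))
           (vsmult (qpow (kV (sel c (lb f)) a)) (bvec (ul (mv (\<not> c) (a + 1) a (lb f))))))"
    and gn_K: "f \<in> Z \<Longrightarrow> gn (K a) f = vsmult (qpow (kV (fst (lb f)) a + kW (snd (lb f)) a)) (bvec f)"
    and gn_Kinv: "f \<in> Z \<Longrightarrow> gn (Kinv a) f = vsmult (qpow (- (kV (fst (lb f)) a + kW (snd (lb f)) a))) (bvec f)"
    and lt_swp: "f \<in> Z \<Longrightarrow> g \<in> Z \<Longrightarrow> swp (lb f) (lb g) \<Longrightarrow> lt g f"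
    and lt_trans: "lt h g \<Longrightarrow> lt g f \<Longrightarrow> lt h f"
    and lt_sum: "f \<in> Z \<Longrightarrow> g \<in> Z \<Longrightarrow> lt g f \<Longrightarrow> \<Sum>(fst (lb g)) \<le> \<Sum>(fst (lb f))"
begin

text \<open>In terms of labels the finiteness conditions of both completions are lower bounds on
  B.\<close>

abbreviation low :: "nat \<Rightarrow> idx \<Rightarrow> bool" where
  "low d f \<equiv> snd (lb f) \<subseteq> {- int d..}"

definition Eh :: "vec set" where
  "Eh = {u. (\<forall>f. u f \<noteq> 0 \<longrightarrow> f \<in> Z) \<and> (\<forall>d::nat. finite {f. u f \<noteq> 0 \<and> low d f})}"

definition is_bar :: "(vec \<Rightarrow> vec) \<Rightarrow> bool" where
  "is_bar \<psi> \<longleftrightarrow>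
     (\<forall>u\<in>Eh. \<psi> u \<in> Eh) \<and> (\<forall>u. u \<notin> Eh \<longrightarrow> \<psi> u = vzero)
   \<and> cont_antilinear Eh \<psi>
   \<and> (\<forall>f\<in>Z. dset (lb f) = {} \<longrightarrow> \<psi> (bvec f) = bvec f)
   \<and> (\<forall>X. \<forall>u\<in>Eh. \<psi> (ext (gn X) u) = ext (gn (bar_gen X)) (\<psi> u))
   \<and> (\<forall>u\<in>Eh. \<psi> (\<psi> u) = u)
   \<and> (\<forall>f\<in>Z. \<psi> (bvec f) f = 1
        \<and> (\<forall>g. laurent_int (\<psi> (bvec f) g) \<and> (g \<noteq> f \<and> \<psi> (bvec f) g \<noteq> 0 \<longrightarrow> lt g f)))"

definition N :: "idx \<Rightarrow> int" where "N f = \<Sum>(fst (lb f))"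

definition rr :: "idx \<Rightarrow> vec" where
  "rr f = (\<lambda>g. if f \<in> Z \<and> g \<in> Z then rmat (lb f) (lb g) else 0)"

definition psi :: "vec \<Rightarrow> vec" where
  "psi u = (if u \<in> Eh then ext rr (vbar u) else vzero)"

text \<open>Matrices of continuous maps: rows lie in the completion, and the sources of targets with
  a common bound have a common bound. The latter makes each coefficient of an image a finite
  sum.\<close>

definition cmat :: "(idx \<Rightarrow> vec) \<Rightarrow> bool" where
  "cmat M \<longleftrightarrow> (\<forall>f\<in>Z. M f \<in> Eh) \<and> (\<forall>d::nat. \<exists>d'::nat. \<forall>f\<in>Z. \<forall>g.
     M f g \<noteq> 0 \<longrightarrow> low d g \<longrightarrow> low d' f)"

lemma EhI:
  assumes "\<And>f. u f \<noteq> 0 \<Longrightarrow> f \<in> Z" "\<And>d::nat. finite {f. u f \<noteq> 0 \<and> low d f}"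
  shows "u \<in> Eh"
  using assms by (simp add: Eh_def)

lemma Eh_supp: "u \<in> Eh \<Longrightarrow> u f \<noteq> 0 \<Longrightarrow> f \<in> Z"
  by (auto simp: Eh_def)

lemma Eh_0: "u \<in> Eh \<Longrightarrow> f \<notin> Z \<Longrightarrow> u f = 0"
  by (auto simp: Eh_def)

lemma Eh_finite: "u \<in> Eh \<Longrightarrow> finite {f. u f \<noteq> 0 \<and> low d f}"
  by (auto simp: Eh_def)

lemma Eh_subset:
  assumes "u \<in> Eh" "\<And>f. v f \<noteq> 0 \<Longrightarrow> u f \<noteq> 0"
  shows "v \<in> Eh"
proof (rule EhI)
  fix d :: nat
  have "{f. v f \<noteq> 0 \<and> low d f} \<subseteq> {f. u f \<noteq> 0 \<and> low d f}"
    using assms(2) by blast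
  then show "finite {f. v f \<noteq> 0 \<and> low d f}"
    using Eh_finite[OF assms(1)] by (rule finite_subset)
qed (use assms Eh_supp in blast)

lemma vbar_Eh: "u \<in> Eh \<Longrightarrow> vbar u \<in> Eh"
  by (erule Eh_subset) simp

lemma vadd_Eh:
  assumes "u \<in> Eh" "v \<in> Eh"
  shows "vadd u v \<in> Eh"
proof (rule EhI)
  fix d :: nat
  have "{f. vadd u v f \<noteq> 0 \<and> low d f}
      \<subseteq> {f. u f \<noteq> 0 \<and> low d f} \<union> {f. v f \<noteq> 0 \<and> low d f}" by auto
  then show "finite {f. vadd u v f \<noteq> 0 \<and> low d f}"
    by (rule finite_subset) (use assms Eh_finite in auto)
next
  fix f assume "vadd u v f \<noteq> 0"
  then show "f \<in> Z" using Eh_supp[OF assms(1), of f] Eh_supp[OF assms(2), of f] by fastforce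
qed

lemma vsmult_Eh: "u \<in> Eh \<Longrightarrow> vsmult c u \<in> Eh"
  by (erule Eh_subset) simp

lemma vzero_Eh [simp]: "vzero \<in> Eh"
  by (simp add: Eh_def)

lemma cond_vec_Eh: "(P \<Longrightarrow> u \<in> Eh) \<Longrightarrow> cond_vec P u \<in> Eh"
  by (simp add: cond_vec_def)

lemma bvec_Eh [simp]: "f \<in> Z \<Longrightarrow> bvec f \<in> Eh"
  by (rule EhI) (auto simp: bvec_apply intro: finite_subset[of _ "{f}"] split: if_splits)

lemma ex_lower:
  assumes "f \<in> Z"
  obtains d :: nat where "low d f"
proof -
  obtain n where n: "\<forall>z < - n. z \<notin> snd (lb f)" using tail[OF assms] by blast
  have "snd (lb f) \<subseteq> {- int (nat \<bar>n\<bar>)..}"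
  proof
    fix z assume "z \<in> snd (lb f)"
    then have "- n \<le> z" using n by (meson not_less)
    then show "z \<in> {- int (nat \<bar>n\<bar>)..}" by simp
  qed
  then show thesis by (rule that)
qed

section \<open>Calculus of continuous infinite matrices\<close>

lemma finite_column:
  assumes "cmat M" "u \<in> Eh"
  shows "finite {f. u f \<noteq> 0 \<and> M f g \<noteq> 0}"
proof (cases "g \<in> Z")
  case True
  then obtain d where d: "low d g" by (rule ex_lower)
  obtain d' where "\<forall>f\<in>Z. \<forall>g. M f g \<noteq> 0 \<longrightarrow> low d g \<longrightarrow> low d' f"
    using assms(1) unfolding cmat_def by blast
  then have "{f. u f \<noteq> 0 \<and> M f g \<noteq> 0} \<subseteq> {f. u f \<noteq> 0 \<and> low d' f}"
    using d Eh_supp[OF assms(2)] by blast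
  then show ?thesis using Eh_finite[OF assms(2)] by (rule finite_subset)
next
  case False
  then have "{f. u f \<noteq> 0 \<and> M f g \<noteq> 0} = {}"
    using assms Eh_0 Eh_supp unfolding cmat_def by blast
  then show ?thesis by (simp only: finite.emptyI)
qed

lemma ext_nonzero: "ext M u g \<noteq> 0 \<Longrightarrow> \<exists>f. u f \<noteq> 0 \<and> M f g \<noteq> 0"
proof (rule ccontr)
  assume "ext M u g \<noteq> 0" "\<not> (\<exists>f. u f \<noteq> 0 \<and> M f g \<noteq> 0)"
  then have "{f. u f \<noteq> 0 \<and> M f g \<noteq> 0} = {}" by blast
  then show False using \<open>ext M u g \<noteq> 0\<close> by (simp only: ext_def sum.empty)
qed

lemma finite_rows:
  assumes "cmat M" "finite S" "S \<subseteq> Z"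
  shows "finite (\<Union>f\<in>S. {g. M f g \<noteq> 0 \<and> low d g})"
  using assms Eh_finite unfolding cmat_def by blast

lemma ext_Eh:
  assumes "cmat M" "u \<in> Eh"
  shows "ext M u \<in> Eh"
proof (rule EhI)
  fix g assume "ext M u g \<noteq> 0"
  then obtain f where "u f \<noteq> 0" "M f g \<noteq> 0" using ext_nonzero by blast
  then show "g \<in> Z" using assms Eh_supp unfolding cmat_def by blast
next
  fix d :: nat
  obtain d' where d': "\<forall>f\<in>Z. \<forall>g. M f g \<noteq> 0 \<longrightarrow> low d g \<longrightarrow> low d' f"
    using assms(1) unfolding cmat_def by blast
  define S where "S = {f. u f \<noteq> 0 \<and> low d' f}"
  have S: "finite S" "S \<subseteq> Z" unfolding S_def using Eh_finite[OF assms(2)] Eh_supp[OF assms(2)] by auto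
  have "{g. ext M u g \<noteq> 0 \<and> low d g} \<subseteq> (\<Union>f\<in>S. {g. M f g \<noteq> 0 \<and> low d g})"
  proof
    fix g assume g: "g \<in> {g. ext M u g \<noteq> 0 \<and> low d g}"
    then obtain f where f: "u f \<noteq> 0" "M f g \<noteq> 0" using ext_nonzero by blast
    then have "f \<in> S" unfolding S_def using d' g Eh_supp[OF assms(2)] by blast
    then show "g \<in> (\<Union>f\<in>S. {g. M f g \<noteq> 0 \<and> low d g})" using f g by blast
  qed
  then show "finite {g. ext M u g \<noteq> 0 \<and> low d g}"
    using finite_rows[OF assms(1) S] by (rule finite_subset)
qed

lemma cmat_ext:
  assumes "cmat M" "cmat M'"
  shows "cmat (\<lambda>f. ext M' (M f))"
  unfolding cmat_def
proof (intro conjI ballI allI)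
  fix f assume "f \<in> Z"
  then show "ext M' (M f) \<in> Eh" using assms ext_Eh by (simp add: cmat_def)
next
  fix d :: nat
  obtain d1 where d1: "\<forall>f\<in>Z. \<forall>g. M' f g \<noteq> 0 \<longrightarrow> low d g \<longrightarrow> low d1 f"
    using assms(2) unfolding cmat_def by blast
  obtain d2 where d2: "\<forall>f\<in>Z. \<forall>g. M f g \<noteq> 0 \<longrightarrow> low d1 g \<longrightarrow> low d2 f"
    using assms(1) unfolding cmat_def by blast
  have "low d2 f"
    if f: "f \<in> Z" and nz: "ext M' (M f) h \<noteq> 0" and h: "low d h" for f h
  proof -
    obtain g where g: "M f g \<noteq> 0" "M' g h \<noteq> 0" using ext_nonzero[OF nz] by blast
    then have "g \<in> Z" using assms(1) f Eh_supp unfolding cmat_def by blast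
    then show ?thesis using d1 d2 g f h by blast
  qed
  then show "\<exists>d'::nat. \<forall>f\<in>Z. \<forall>h. ext M' (M f) h \<noteq> 0 \<longrightarrow> low d h
      \<longrightarrow> low d' f" by blast
qed

lemma ext_ext:
  assumes "cmat M" "cmat M'" "u \<in> Eh"
  shows "ext M' (ext M u) = ext (\<lambda>f. ext M' (M f)) u"
proof
  fix h
  show "ext M' (ext M u) h = ext (\<lambda>f. ext M' (M f)) u h"
  proof (cases "h \<in> Z")
    case False
    then show ?thesis
      using ext_Eh[OF assms(2) ext_Eh[OF assms(1,3)]] ext_Eh[OF cmat_ext[OF assms(1,2)] assms(3)]
      by (simp add: Eh_0)
  next
    case True
    then obtain d where d: "low d h" by (rule ex_lower)
    obtain d1 where d1: "\<forall>f\<in>Z. \<forall>g. M' f g \<noteq> 0 \<longrightarrow> low d g \<longrightarrow> low d1 f"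
      using assms(2) unfolding cmat_def by blast
    obtain d2 where d2: "\<forall>f\<in>Z. \<forall>g. M f g \<noteq> 0 \<longrightarrow> low d1 g \<longrightarrow> low d2 f"
      using assms(1) unfolding cmat_def by blast
    \<comment> \<open>For the fixed target \<open>h\<close> only sources in \<open>S\<close> and
      intermediate indices in \<open>G\<close> contribute; both sets are finite, so the double sum
      may be interchanged.\<close>
    define S where "S = {f. u f \<noteq> 0 \<and> low d2 f}"
    define G where "G = (\<Union>f\<in>S. {g. M f g \<noteq> 0 \<and> low d1 g})"
    have S: "finite S" "S \<subseteq> Z" unfolding S_def using Eh_finite[OF assms(3)] Eh_supp[OF assms(3)] by auto
    have G: "finite G" unfolding G_def using finite_rows[OF assms(1) S] .
    have MZ: "g \<in> Z" if "f \<in> Z" "M f g \<noteq> 0" for f g using that assms(1) Eh_supp unfolding cmat_def by blast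
    have key: "f \<in> S \<and> g \<in> G" if "u f \<noteq> 0" "M f g \<noteq> 0" "M' g h \<noteq> 0" for f g
    proof -
      have f: "f \<in> Z" using that assms(3) Eh_supp by blast
      then have "low d1 g" using that d d1 MZ by blast
      then show ?thesis unfolding G_def S_def using that d2 f by blast
    qed
    have "ext M' (ext M u) h = (\<Sum>g\<in>G. ext M u g * M' g h)"
      using ext_nonzero[of M u] key by (intro ext_eq_sum[OF G]) blast
    also have "\<dots> = (\<Sum>g\<in>G. \<Sum>f\<in>S. u f * M f g * M' g h)"
    proof (rule sum.cong)
      fix g assume "g \<in> G"
      show "ext M u g * M' g h = (\<Sum>f\<in>S. u f * M f g * M' g h)"
      proof (cases "M' g h = 0")
        case False
        then have "ext M u g = (\<Sum>f\<in>S. u f * M f g)"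
          using key by (intro ext_eq_sum[OF S(1)]) blast
        then show ?thesis by (simp add: sum_distrib_right)
      qed simp
    qed simp
    also have "\<dots> = (\<Sum>f\<in>S. \<Sum>g\<in>G. u f * M f g * M' g h)" by (rule sum.swap)
    also have "\<dots> = (\<Sum>f\<in>S. u f * ext M' (M f) h)"
    proof (rule sum.cong)
      fix f assume "f \<in> S"
      then have "ext M' (M f) h = (\<Sum>g\<in>G. M f g * M' g h)"
        using key by (intro ext_eq_sum[OF G]) (auto simp: S_def)
      then show "(\<Sum>g\<in>G. u f * M f g * M' g h) = u f * ext M' (M f) h"
        by (simp add: sum_distrib_left mult.assoc)
    qed simp
    also have "\<dots> = ext (\<lambda>f. ext M' (M f)) u h"
      using ext_nonzero[of M'] key by (intro ext_eq_sum[OF S(1), symmetric]) blast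
    finally show ?thesis .
  qed
qed

lemma cmat_vbar: "cmat M \<Longrightarrow> cmat (\<lambda>f. vbar (M f))"
  by (simp add: cmat_def vbar_Eh)

lemma ext_cong:
  assumes "u \<in> Eh" "\<And>f. f \<in> Z \<Longrightarrow> M f = M' f"
  shows "ext M u = ext M' u"
proof -
  have "u f = 0 \<or> M f g = M' f g" for f g
    using assms Eh_supp[of u f] by metis
  then show ?thesis unfolding ext_def
    by (intro HOL.ext sum.cong Collect_cong) (metis mult_zero_left)+
qed

lemma ext_vadd:
  assumes "cmat M" "u \<in> Eh" "v \<in> Eh"
  shows "ext M (vadd u v) = vadd (ext M u) (ext M v)"
proof
  fix g
  define S where "S = {f. u f \<noteq> 0 \<and> M f g \<noteq> 0} \<union> {f. v f \<noteq> 0 \<and> M f g \<noteq> 0}"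
  have S: "finite S" using finite_column[OF assms(1)] assms(2,3) by (simp add: S_def)
  have "ext M w g = (\<Sum>f\<in>S. w f * M f g)" if "\<And>f. w f \<noteq> 0 \<Longrightarrow> u f \<noteq> 0 \<or> v f \<noteq> 0" for w
    using that by (intro ext_eq_sum[OF S]) (auto simp: S_def)
  then have "ext M (vadd u v) g = (\<Sum>f\<in>S. vadd u v f * M f g)" "ext M u g = (\<Sum>f\<in>S. u f * M f g)"
    "ext M v g = (\<Sum>f\<in>S. v f * M f g)" by fastforce+
  then show "ext M (vadd u v) g = vadd (ext M u) (ext M v) g"
    by (simp add: sum.distrib distrib_right)
qed

lemma ext_vsmult: "ext M (vsmult c u) = vsmult c (ext M u)"
proof (cases "c = 0")
  case False
  then show ?thesis by (auto simp: ext_def sum_distrib_left mult.assoc)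
qed (auto simp: ext_def)

lemma ext_vzero [simp]: "ext M vzero = vzero"
  by (auto simp: ext_def)

lemma ext_cond_vec: "ext M (cond_vec P u) = cond_vec P (ext M u)"
  by (simp add: cond_vec_def)

section \<open>The generators and the candidate bar involution on indices\<close>

lemma lab_fin:
  assumes "f \<in> Z"
  shows "finite (dset (lb f))"
  using fin_fst[OF assms] by (simp add: dset_def)

lemma ul_in: "p \<in> lb ` Z \<Longrightarrow> ul p \<in> Z"
  unfolding ul_def by (rule inv_into_into)

lemma lb_ul: "p \<in> lb ` Z \<Longrightarrow> lb (ul p) = p"
  unfolding ul_def by (simp add: f_inv_into_f)

lemma ul_lb: "f \<in> Z \<Longrightarrow> ul (lb f) = f"
  unfolding ul_def using lb_inj by (rule inv_into_f_f)

lemma ex_adm: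
  assumes "f \<in> Z" "g \<in> Z"
  obtains n where "adm n (lb f) (lb g)"
proof -
  obtain n1 n2 where n1: "\<forall>z < - n1. z \<notin> snd (lb f)" "\<forall>z>n1. z \<in> snd (lb f)"
    and n2: "\<forall>z < - n2. z \<notin> snd (lb g)" "\<forall>z>n2. z \<in> snd (lb g)"
    using tail assms by metis
  have "finite (abs ` (fst (lb f) \<union> fst (lb g)))" using assms fin_fst by simp
  then obtain n3 where n3: "\<forall>y \<in> abs ` (fst (lb f) \<union> fst (lb g)). y \<le> n3"
    by (metis bdd_above_finite bdd_above.E)
  define n where "n = max n3 (max n1 n2)"
  have fst: "z \<notin> fst (lb f) \<and> z \<notin> fst (lb g)" if "z < - n \<or> z > n" for z
  proof -
    have "\<not> \<bar>z\<bar> \<le> n3" using that by (auto simp: n_def)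
    then show ?thesis using n3 by auto
  qed
  have "adm n (lb f) (lb g)"
    unfolding adm_def
  proof (intro conjI allI impI)
    fix z assume z: "z < - n"
    then have "z < - n1" "z < - n2" by (auto simp: n_def)
    then show "site (lb f) z = (False, False)" "site (lb g) z = (False, False)"
      using n1 n2 fst[of z] z by (simp_all add: site_def)
  next
    fix z assume z: "z > n"
    then have "z > n1" "z > n2" by (auto simp: n_def)
    then show "site (lb f) z = site (lb g) z" "site (lb f) z \<noteq> (True, True)"
      using n1 n2 fst[of z] z by (simp_all add: site_def)
  qed
  then show thesis by (rule that)
qed

lemma rr_nz: "rr f g \<noteq> 0 \<Longrightarrow> f \<in> Z \<and> g \<in> Z \<and> dominates (lb f) (lb g)"
  unfolding rr_def by (metis ex_adm rmat_dom)

lemma rr_refl [simp]: "f \<in> Z \<Longrightarrow> rr f f = 1"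
  by (simp add: rr_def)

lemma dominates_row_Eh:
  assumes "f \<in> Z" "\<And>g. u g \<noteq> 0 \<Longrightarrow> g \<in> Z \<and> dominates (lb f) (lb g)"
  shows "u \<in> Eh"
proof (rule EhI)
  fix d :: nat
  let ?S = "{g. u g \<noteq> 0 \<and> low d g}"
  have "lb ` ?S \<subseteq> {s. dominates (lb f) s \<and> finite (dset s) \<and> snd s \<subseteq> {- int d..}}"
    using assms lab_fin by auto
  then have "finite (lb ` ?S)"
    by (rule finite_subset) (rule finite_dom_below[OF lab_fin[OF assms(1)]])
  moreover have "inj_on lb ?S"
    using lb_inj by (rule inj_on_subset) (use assms in auto)
  ultimately show "finite ?S" by (rule finite_imageD)
qed (use assms in blast)

text \<open>Domination passes lower bounds on B back to the source, so \<open>d\<close> itself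
  serves as \<open>d'\<close>.\<close>

lemma cmat_dom:
  assumes "\<And>f g. M f g \<noteq> 0 \<Longrightarrow> f \<in> Z \<Longrightarrow> g \<in> Z \<and> dominates (lb f) (lb g)"
  shows "cmat M"
  unfolding cmat_def
proof (intro conjI ballI allI)
  fix f assume "f \<in> Z"
  then show "M f \<in> Eh" using assms by (intro dominates_row_Eh) auto
next
  fix d :: nat
  have "low d f" if "f \<in> Z" "M f g \<noteq> 0" "low d g" for f g
    using assms[OF that(2,1)] that by (intro dominates_snd_lower[of "lb f" "lb g"]) (auto intro: lab_fin)
  then show "\<exists>d'::nat. \<forall>f\<in>Z. \<forall>g. M f g \<noteq> 0 \<longrightarrow> low d g \<longrightarrow> low d' f"
    by blast
qed

lemma cmat_rr: "cmat rr"
  using rr_nz by (intro cmat_dom) blast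

lemma gen_cases:
  obtains c a where "X = EF c a" | a where "X = K a" | a where "X = Kinv a"
proof (cases X)
  case (E a)
  then show ?thesis using that(1)[of False a] by (simp add: EF_def)
next
  case (F a)
  then show ?thesis using that(1)[of True a] by (simp add: EF_def)
qed (use that in auto)

lemma bar_gen_EF [simp]: "bar_gen (EF c a) = EF c a"
  by (simp add: EF_def)

lemma lb_ul_mv: "f \<in> Z \<Longrightarrow> x \<in> sel c (lb f) \<Longrightarrow> y \<notin> sel c (lb f) \<Longrightarrow> y = x + 1 \<or> x = y + 1 \<Longrightarrow>
    lb (ul (mv c x y (lb f))) = mv c x y (lb f) \<and> ul (mv c x y (lb f)) \<in> Z"
  by (simp add: lb_ul ul_in mv_closed)

lemma cmat_gn: "cmat (gn X)"
proof -
  \<comment> \<open>A generator moves an entry by one place, so a lower bound is weakened by at most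
    one.\<close>
  have shift: "snd p \<subseteq> {- int (d + 1)..}"
    if "snd (mv c x y p) \<subseteq> {- int d..}" "y = x + 1 \<or> x = y + 1" for c p x y and d :: nat
    using that by (cases c) (force simp: mv_def)+
  have rows: "gn X f \<in> Eh" if f: "f \<in> Z" for f
  proof (cases X rule: gen_cases)
    case (1 c a)
    then show ?thesis using f mv_closed[of "lb f" a c "a + 1"] mv_closed[of "lb f" "a + 1" "\<not> c" a]
      by (auto simp: gn_EF intro!: vadd_Eh cond_vec_Eh vsmult_Eh bvec_Eh ul_in)
  qed (use f in \<open>auto simp: gn_K gn_Kinv intro: vsmult_Eh\<close>)
  have cols: "snd (lb f) \<subseteq> {- int (d + 1)..}"
    if f: "f \<in> Z" and nz: "gn X f g \<noteq> 0" and g: "low d g" for f g and d :: nat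
  proof (cases X rule: gen_cases)
    case (1 c a)
    then have "a \<in> sel c (lb f) \<and> a + 1 \<notin> sel c (lb f) \<and> g = ul (mv c a (a + 1) (lb f))
        \<or> a + 1 \<in> sel (\<not> c) (lb f) \<and> a \<notin> sel (\<not> c) (lb f) \<and> g = ul (mv (\<not> c) (a + 1) a (lb f))"
      using nz f by (auto simp: gn_EF cond_vec_apply bvec_apply split: if_splits)
    then have "lb g = mv c a (a + 1) (lb f) \<or> lb g = mv (\<not> c) (a + 1) a (lb f)"
      using lb_ul_mv[OF f, of a c "a + 1"] lb_ul_mv[OF f, of "a + 1" "\<not> c" a] by metis
    then show ?thesis using g shift[of c a "a + 1"] shift[of "\<not> c" "a + 1" a] by metis
  qed (use f nz g in \<open>auto simp: gn_K gn_Kinv bvec_apply split: if_splits\<close>)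
  show ?thesis unfolding cmat_def using rows cols by blast
qed

lemma ext_two_columns:
  assumes "u \<in> Eh"
    and col: "\<And>g. g \<in> Z \<Longrightarrow> M g h = (if P \<and> g = g1 then c1 else 0) + (if Q \<and> g = g2 then c2 else 0)"
  shows "ext M u h = (if P then c1 * u g1 else 0) + (if Q then c2 * u g2 else 0)"
proof -
  have "{f. u f \<noteq> 0 \<and> M f h \<noteq> 0} \<subseteq> {g1, g2}"
    using col Eh_supp[OF assms(1)] by (fastforce split: if_splits)
  then have "ext M u h = (\<Sum>f\<in>{g1, g2}. u f * M f h)" by (intro ext_eq_sum) auto
  also have "\<dots> = (\<Sum>f\<in>{g1, g2}. u f * (if P \<and> f = g1 then c1 else 0) + u f * (if Q \<and> f = g2 then c2 else 0))"
    using col Eh_0[OF assms(1)] by (intro sum.cong refl) (metis distrib_left mult_zero_left add_0)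
  also have "\<dots> = (if P then c1 * u g1 else 0) + (if Q then c2 * u g2 else 0)"
    by (cases P; cases Q; cases "g1 = g2") (auto simp: mult.commute distrib_left)
  finally show ?thesis .
qed

text \<open>Moves by one place are reversible; this turns the rows of a generator into its
  columns.\<close>

lemma ul_mv_eq_iff:
  assumes "g \<in> Z" "h \<in> Z" "y = x + 1 \<or> x = y + 1"
  shows "x \<in> sel c (lb g) \<and> y \<notin> sel c (lb g) \<and> h = ul (mv c x y (lb g))
    \<longleftrightarrow> (y \<in> sel c (lb h) \<and> x \<notin> sel c (lb h)) \<and> g = ul (mv c y x (lb h))"
proof -
  have *: "(y' \<in> sel c (lb h) \<and> x' \<notin> sel c (lb h)) \<and> g = ul (mv c y' x' (lb h))"
    if "g \<in> Z" "x' \<in> sel c (lb g)" "y' \<notin> sel c (lb g)" "h = ul (mv c x' y' (lb g))" "y' = x' + 1 \<or> x' = y' + 1"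
    for g h x' y'
  proof -
    have "lb h = mv c x' y' (lb g)" using that lb_ul_mv by blast
    then show ?thesis using that by (auto simp: mv_mv ul_lb)
  qed
  show ?thesis using *[of g x y h] *[of h y x g] assms by blast
qed

lemma ext_EF:
  assumes "u \<in> Eh" "h \<in> Z"
  shows "ext (gn (EF c a)) u h =
      (if a + 1 \<in> sel c (lb h) \<and> a \<notin> sel c (lb h) then u (ul (mv c (a + 1) a (lb h))) else 0)
    + (if a \<in> sel (\<not> c) (lb h) \<and> a + 1 \<notin> sel (\<not> c) (lb h)
       then qpow (kV (sel c (lb h)) a) * u (ul (mv (\<not> c) a (a + 1) (lb h))) else 0)"
proof -
  let ?P = "a + 1 \<in> sel c (lb h) \<and> a \<notin> sel c (lb h)" and ?k1 = "ul (mv c (a + 1) a (lb h))"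
    and ?Q = "a \<in> sel (\<not> c) (lb h) \<and> a + 1 \<notin> sel (\<not> c) (lb h)" and ?k2 = "ul (mv (\<not> c) a (a + 1) (lb h))"
  have "gn (EF c a) g h = (if ?P \<and> g = ?k1 then 1 else 0) + (if ?Q \<and> g = ?k2 then qpow (kV (sel c (lb h)) a) else 0)"
    if g: "g \<in> Z" for g
  proof -
    have 1: "gn (EF c a) g h =
        (if a \<in> sel c (lb g) \<and> a + 1 \<notin> sel c (lb g) \<and> h = ul (mv c a (a + 1) (lb g)) then 1 else 0)
      + (if a + 1 \<in> sel (\<not> c) (lb g) \<and> a \<notin> sel (\<not> c) (lb g) \<and> h = ul (mv (\<not> c) (a + 1) a (lb g))
         then qpow (kV (sel c (lb g)) a) else 0)"
      using g by (simp add: gn_EF cond_vec_apply bvec_apply)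
    \<comment> \<open>The exponent may be read at the target instead of the source, because a move
      in one set leaves the other set alone.\<close>
    have 2: "(if a + 1 \<in> sel (\<not> c) (lb g) \<and> a \<notin> sel (\<not> c) (lb g) \<and> h = ul (mv (\<not> c) (a + 1) a (lb g))
         then qpow (kV (sel c (lb g)) a) else 0)
      = (if a + 1 \<in> sel (\<not> c) (lb g) \<and> a \<notin> sel (\<not> c) (lb g) \<and> h = ul (mv (\<not> c) (a + 1) a (lb g))
         then qpow (kV (sel c (lb h)) a) else 0)"
      using g lb_ul_mv[of g "a + 1" "\<not> c" a] by (intro if_cong refl) simp
    from 1[unfolded 2] show ?thesis
      unfolding ul_mv_eq_iff[OF g assms(2) disjI1[OF refl]] ul_mv_eq_iff[OF g assms(2) disjI2[OF refl]]
        conj_assoc .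
  qed
  then show ?thesis
    using ext_two_columns[where M = "gn (EF c a)" and h = h and P = ?P and Q = ?Q and ?g1.0 = ?k1 and ?g2.0 = ?k2
        and ?c1.0 = 1 and ?c2.0 = "qpow (kV (sel c (lb h)) a)", OF assms(1)] by simp
qed

lemma ext_rr_gn:
  assumes f: "f \<in> Z"
  shows "ext rr (vbar (gn X f)) = ext (gn (bar_gen X)) (rr f)"
proof
  fix h
  have gnEh: "gn Y f \<in> Eh" for Y using cmat_gn f by (simp add: cmat_def)
  have rrEh: "rr f \<in> Eh" using cmat_rr f by (simp add: cmat_def)
  show "ext rr (vbar (gn X f)) h = ext (gn (bar_gen X)) (rr f) h"
  proof (cases "h \<in> Z")
    case False
    then show ?thesis
      using ext_Eh[OF cmat_rr vbar_Eh[OF gnEh]] ext_Eh[OF cmat_gn rrEh] by (simp add: Eh_0)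
  next
    case h: True
    obtain n where adm: "adm n (lb f) (lb h)" using ex_adm[OF f h] .
    \<comment> \<open>Nonzero entries join labels with equal inactive parts, so \<open>K a\<close>
      has the same eigenvalue at both ends.\<close>
    have kinv: "kV (fst (lb f)) a + kW (snd (lb f)) a = kV (fst (lb h)) a + kW (snd (lb h)) a"
      if "rr f h \<noteq> 0" for a
    proof -
      have "(z \<in> fst (lb f) - snd (lb f)) = (z \<in> fst (lb h) - snd (lb h))"
        "(z \<in> snd (lb f) - fst (lb f)) = (z \<in> snd (lb h) - fst (lb h))" for z
        using rr_nz[OF that] unfolding dominates_def by blast+
      from this[of a] this[of "a + 1"] show ?thesis by (auto simp: kV_def kW_def ind_def)
    qed
    have bK: "ext rr (vbar (vsmult c (bvec f))) h = bar_q c * rr f h" for c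
    proof -
      have "vbar (vsmult c (bvec f)) = vsmult (bar_q c) (bvec f)" by (auto simp: bvec_apply)
      then show ?thesis by (simp add: ext_vsmult)
    qed
    have dK: "ext (gn (K a)) (rr f) h = qpow (kV (fst (lb h)) a + kW (snd (lb h)) a) * rr f h"
      "ext (gn (Kinv a)) (rr f) h = qpow (- (kV (fst (lb h)) a + kW (snd (lb h)) a)) * rr f h" for a
      using ext_two_columns[OF rrEh, of "gn (K a)" h True h "qpow (kV (fst (lb h)) a + kW (snd (lb h)) a)" False]
        ext_two_columns[OF rrEh, of "gn (Kinv a)" h True h "qpow (- (kV (fst (lb h)) a + kW (snd (lb h)) a))" False]
      by (auto simp: gn_K gn_Kinv bvec_apply)
    show ?thesis
    proof (cases X rule: gen_cases)
      case (1 c a)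
      have "vbar (gn (EF c a) f) =
        vadd (cond_vec (a \<in> sel c (lb f) \<and> a + 1 \<notin> sel c (lb f)) (bvec (ul (mv c a (a + 1) (lb f)))))
         (cond_vec (a + 1 \<in> sel (\<not> c) (lb f) \<and> a \<notin> sel (\<not> c) (lb f))
           (vsmult (qpow (- kV (sel c (lb f)) a)) (bvec (ul (mv (\<not> c) (a + 1) a (lb f))))))"
        using f by (auto simp: gn_EF cond_vec_apply bvec_apply)
      then have "ext rr (vbar (gn (EF c a) f)) h =
        (if a \<in> sel c (lb f) \<and> a + 1 \<notin> sel c (lb f) then rr (ul (mv c a (a + 1) (lb f))) h else 0)
        + (if a + 1 \<in> sel (\<not> c) (lb f) \<and> a \<notin> sel (\<not> c) (lb f)
           then qpow (- kV (sel c (lb f)) a) * rr (ul (mv (\<not> c) (a + 1) a (lb f))) h else 0)"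
        using f by (simp add: ext_vadd cmat_rr cond_vec_Eh vsmult_Eh lb_ul_mv ext_cond_vec ext_vsmult)
          (simp add: cond_vec_apply)
      also have "\<dots> = ext (gn (EF c a)) (rr f) h"
        unfolding ext_EF[OF rrEh h] using rmat_EF[OF adm, of a c] f h by (simp add: rr_def lb_ul_mv cong: if_cong)
      finally show ?thesis by (simp add: 1)
    next
      case (2 a)
      then show ?thesis using f kinv[of a] bK by (cases "rr f h = 0") (auto simp: gn_K dK)
    next
      case (3 a)
      then show ?thesis using f kinv[of a] bK by (cases "rr f h = 0") (auto simp: gn_Kinv dK add.commute)
    qed
  qed
qed

text \<open>Unit moves suffice even across occupied places: if \<open>x - 1\<close> is occupied, its
  entry goes to \<open>y\<close> first and \<open>x\<close> then takes its place, which gives the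
  same set.\<close>

lemma mv_far:
  assumes "p \<in> lb ` Z" "x \<in> sel c p" "y \<notin> sel c p" "y < x"
  shows "mv c x y p \<in> lb ` Z"
  using assms
proof (induction "nat (x - y)" arbitrary: p x rule: less_induct)
  case less
  consider "x = y + 1" | "x - 1 \<notin> sel c p" "y < x - 1" | "x - 1 \<in> sel c p" "y < x - 1"
    using less.prems by force
  then show ?case
  proof cases
    case 1
    then show ?thesis using less.prems by (intro mv_closed) auto
  next
    case 2
    have "mv c x (x - 1) p \<in> lb ` Z" using less.prems 2 by (intro mv_closed) auto
    then have "mv c (x - 1) y (mv c x (x - 1) p) \<in> lb ` Z"
      using less.prems 2 by (intro less.hyps) auto
    moreover have "mv c (x - 1) y (mv c x (x - 1) p) = mv c x y p"
      using 2 by (cases c) (auto simp: mv_def sel_def)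
    ultimately show ?thesis by simp
  next
    case 3
    have "mv c (x - 1) y p \<in> lb ` Z" using less.prems 3 by (intro less.hyps) auto
    then have "mv c x (x - 1) (mv c (x - 1) y p) \<in> lb ` Z"
      using less.prems 3 by (intro mv_closed[of "mv c (x - 1) y p"]) auto
    moreover have "mv c x (x - 1) (mv c (x - 1) y p) = mv c x y p"
      using 3 by (cases c) (auto simp: mv_def sel_def)
    ultimately show ?thesis by simp
  qed
qed

lemma swp_closed:
  assumes "p \<in> lb ` Z" "swp p s"
  shows "s \<in> lb ` Z"
proof -
  obtain x y where xy: "y < x" "x \<in> fst p" "x \<in> snd p" "y \<notin> fst p" "y \<notin> snd p"
    and s: "s = mv False x y (mv True x y p)"
    using assms(2) unfolding swp_def dset_def by (auto simp: mv_def)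
  have "mv True x y p \<in> lb ` Z" using assms(1) xy by (intro mv_far[of p]) (auto simp: sel_def)
  then show ?thesis unfolding s using xy by (intro mv_far[of "mv True x y p"]) (auto simp: sel_def mv_def)
qed

text \<open>Every label on the chain of moves belongs to an index, so \<open>lt_swp\<close> applies
  to each move.\<close>

lemma dominates_lt:
  assumes "f \<in> Z" "g \<in> Z" "dominates (lb f) (lb g)" "f \<noteq> g"
  shows "lt g f" "N g < N f"
proof -
  have "swp\<^sup>*\<^sup>* (lb f) (lb g)" using assms lab_fin by (intro dominates_swp_chain) auto
  then have "g = f \<or> lt g f \<and> N g < N f" using assms(2)
  proof (induction "lb g" arbitrary: g rule: rtranclp_induct)
    case base
    then show ?case using assms(1) lb_inj by (auto dest: inj_onD)
  next
    case (step s)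
    have "s \<in> lb ` Z"
      using step(1) by (induction rule: rtranclp_induct) (use assms(1) swp_closed in auto)
    then obtain k where k: "k \<in> Z" "lb k = s" by blast
    have "lt g k" "N g < N k"
      using lt_swp[OF k(1) step.prems] swp_sum_less[of "lb k" "lb g"] step(2) k fin_fst by (auto simp: N_def)
    moreover have "k = f \<or> lt k f \<and> N k < N f" using step(3)[OF k(2)[symmetric] k(1)] .
    ultimately show ?case using lt_trans by auto
  qed
  then show "lt g f" "N g < N f" using assms(4) by auto
qed

lemma dominates_N: "f \<in> Z \<Longrightarrow> g \<in> Z \<Longrightarrow> dominates (lb f) (lb g) \<Longrightarrow> N g \<le> N f"
  using dominates_lt[of f g] by (cases "f = g") auto

section \<open>Vectors generated from typical ones\<close>

text \<open>The fixed vectors of any bar involution form such a set. Membership in all stable sets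
  therefore yields a single vector fixed both by \<open>psi\<close> and by an arbitrary
  competitor.\<close>

definition stable :: "vec set \<Rightarrow> bool" where
  "stable Q \<longleftrightarrow> (\<forall>f\<in>Z. dset (lb f) = {} \<longrightarrow> bvec f \<in> Q)
     \<and> (\<forall>c a. \<forall>u\<in>Q \<inter> Eh. ext (gn (EF c a)) u \<in> Q)"

text \<open>The support is controlled only by data that can be followed through one generator;
  domination is recovered later from bar invariance.\<close>

definition premonic :: "idx \<Rightarrow> vec \<Rightarrow> bool" where
  "premonic f x \<longleftrightarrow> x \<in> Eh \<and> x f = 1 \<and> (\<forall>g. x g \<noteq> 0 \<longrightarrow> inact (lb f) (lb g) \<and> N g \<le> N f)
     \<and> (\<forall>g. g \<noteq> f \<longrightarrow> in_qZq (x g))"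

lemma N_mv:
  assumes "f \<in> Z" "x \<in> sel c (lb f)" "y \<notin> sel c (lb f)" "y = x + 1 \<or> x = y + 1"
  shows "N (ul (mv c x y (lb f))) = N f + (if c then y - x else 0)"
proof -
  have "N (ul (mv c x y (lb f))) = \<Sum>(fst (mv c x y (lb f)))" using lb_ul_mv[OF assms] by (simp add: N_def)
  also have "\<dots> = N f + (if c then y - x else 0)"
  proof (cases c)
    case True
    then show ?thesis using assms fin_fst[OF assms(1)] sum.remove[of "fst (lb f)" x "\<lambda>z. z"]
      by (simp add: N_def mv_def sel_def)
  qed (simp add: N_def mv_def)
  finally show ?thesis .
qed

text \<open>Let \<open>a + 1\<close> be an atypical entry of \<open>f\<close> and \<open>a\<close> not one. If \<open>a\<close> is free, \<open>EF c a\<close> creates the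
  pair from an index of smaller atypicality; otherwise it moves the pair one step to the right.\<close>

lemma premonic_EF:
  assumes f: "f \<in> Z" and a: "a + 1 \<in> dset (lb f)" "a \<notin> sel c (lb f)"
    and x: "premonic (ul (mv c (a + 1) a (lb f))) x"
  shows "premonic f (ext (gn (EF c a)) x)"
proof -
  define g where "g = ul (mv c (a + 1) a (lb f))"
  have a': "a + 1 \<in> sel c (lb f)" "a + 1 \<in> sel (\<not> c) (lb f)" "a \<notin> sel c (lb f)"
    using a by (auto simp: dset_def sel_def)
  have g: "lb g = mv c (a + 1) a (lb f)" "g \<in> Z" using lb_ul_mv[OF f a'(1,3)] by (auto simp: g_def)
  have Ng: "N g = N f + (if c then -1 else 0)" using N_mv[OF f a'(1,3)] by (simp add: g_def)
  have x: "x \<in> Eh" "x g = 1" "\<And>k. x k \<noteq> 0 \<Longrightarrow> inact (lb g) (lb k) \<and> N k \<le> N g" "\<And>k. k \<noteq> g \<Longrightarrow> in_qZq (x k)"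
    using x unfolding premonic_def g_def by auto
  define y where "y = ext (gn (EF c a)) x"
  have Eh: "y \<in> Eh" unfolding y_def using cmat_gn x(1) by (rule ext_Eh)
  have val: "(y h \<noteq> 0 \<longrightarrow> inact (lb f) (lb h) \<and> N h \<le> N f) \<and> (h = f \<longrightarrow> y h = 1) \<and> (h \<noteq> f \<longrightarrow> in_qZq (y h))"
    if h: "h \<in> Z" for h
  proof -
    let ?P = "a + 1 \<in> sel c (lb h) \<and> a \<notin> sel c (lb h)" and ?Q = "a \<in> sel (\<not> c) (lb h) \<and> a + 1 \<notin> sel (\<not> c) (lb h)"
    let ?k1 = "ul (mv c (a + 1) a (lb h))" and ?k2 = "ul (mv (\<not> c) a (a + 1) (lb h))"
    have F: "y h = (if ?P then x ?k1 else 0) + (if ?Q then qpow (kV (sel c (lb h)) a) * x ?k2 else 0)"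
      unfolding y_def using ext_EF[OF x(1) h] .
    have k1: "inact (lb f) (lb h) \<and> N h \<le> N f \<and> a + 1 \<in> sel (\<not> c) (lb h)" if "?P" "x ?k1 \<noteq> 0"
      using inact_EF_same[OF a'] that x(3)[OF that(2)] lb_ul_mv[OF h] g(1) Ng N_mv[OF h, of "a + 1" c a]
      by (auto split: if_splits)
    have k2: "inact (lb f) (lb h) \<and> N h \<le> N f \<and> kV (sel c (lb h)) a = (if a \<in> sel (\<not> c) (lb f) then 0 else 1)"
      if "?Q" "x ?k2 \<noteq> 0"
    proof -
      have "N ?k2 = N h + (if c then 0 else 1)" using N_mv[OF h, of a "\<not> c" "a + 1"] that by simp
      then have "N h \<le> N f" using x(3)[OF that(2)] Ng by (simp split: if_splits)
      then show ?thesis using inact_EF_other[OF a'] that x(3)[OF that(2)] lb_ul_mv[OF h] g(1) by auto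
    qed
    have k1f: "h = f" if "?P" "?k1 = g"
    proof -
      have "mv c (a + 1) a (lb h) = mv c (a + 1) a (lb f)" using that lb_ul_mv[OF h] g(1) by metis
      then have "lb h = lb f" using mv_mv[of "a + 1" c "lb h" a] mv_mv[of "a + 1" c "lb f" a] that a' by metis
      then show ?thesis using lb_inj f h by (auto dest: inj_onD)
    qed
    have k2g: "?k2 \<noteq> g" if "?Q" "a \<in> sel (\<not> c) (lb f)"
    proof
      assume "?k2 = g"
      then have "mv (\<not> c) a (a + 1) (lb h) = mv c (a + 1) a (lb f)" using that lb_ul_mv[OF h] g(1) by metis
      then have "sel (\<not> c) (mv (\<not> c) a (a + 1) (lb h)) = sel (\<not> c) (lb f)" by simp
      then have "a \<in> sel (\<not> c) (mv (\<not> c) a (a + 1) (lb h))" using that(2) by blast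
      then show False by simp
    qed
    \<comment> \<open>The two summands never meet: a nonzero first one forces \<open>a + 1\<close>
      into the other set of \<open>h\<close>, which the second excludes. Hence no coefficients are
      added.\<close>
    consider (1) "?P" "x ?k1 \<noteq> 0" | (2) "\<not> (?P \<and> x ?k1 \<noteq> 0)" "?Q" "x ?k2 \<noteq> 0"
      | (3) "\<not> (?P \<and> x ?k1 \<noteq> 0)" "\<not> (?Q \<and> x ?k2 \<noteq> 0)" by blast
    then show ?thesis
    proof cases
      case 1
      then have e: "y h = x ?k1" using F k1[OF 1] by simp
      have "?k1 = g \<longleftrightarrow> h = f" using k1f[OF 1(1)] by (auto simp: g_def)
      then show ?thesis unfolding e using k1[OF 1] x(2) x(4)[of ?k1] by metis
    next
      case 2
      then have e: "y h = qpow (kV (sel c (lb h)) a) * x ?k2" using F by auto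
      \<comment> \<open>If \<open>a\<close> is occupied the power of \<open>q\<close> is trivial,
        and \<open>k2g\<close> shows that the coefficient is not the leading one of
        \<open>x\<close>. If \<open>a\<close> is free the factor \<open>q\<close> takes care even of
        the leading one.\<close>
      have "in_qZq (y h)"
      proof (cases "a \<in> sel (\<not> c) (lb f)")
        case True
        then show ?thesis unfolding e using k2[OF 2(2,3)] k2g[OF 2(2)] x(4) by auto
      next
        case False
        then show ?thesis unfolding e using k2[OF 2(2,3)] x(2) x(4)[of ?k2] in_qZq_qq_mult
          by (cases "?k2 = g") auto
      qed
      moreover have "h \<noteq> f" using 2 a' by auto
      ultimately show ?thesis using k2[OF 2(2,3)] by auto
    next
      case 3
      then have "y h = 0" using F by auto
      moreover have "h \<noteq> f" using 3 a' x(2) by (auto simp: g_def)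
      ultimately show ?thesis by auto
    qed
  qed
  then show ?thesis
    unfolding premonic_def y_def[symmetric] using Eh f Eh_supp[OF Eh] Eh_0[OF Eh] in_qZq_0 by metis
qed

text \<open>The outer induction is on the number of atypical entries, the inner one on the distance
  from the least of them, \<open>b\<close>, to an empty place \<open>y\<close>. Moving one half of
  the pair at \<open>b\<close> down by one undoes a generator.\<close>

lemma premonic_ex:
  assumes "f \<in> Z"
  shows "\<exists>x. premonic f x \<and> (\<forall>Q. stable Q \<longrightarrow> x \<in> Q)"
  using assms
proof (induction "card (dset (lb f))" arbitrary: f rule: less_induct)
  case less
  have atypical: "\<exists>x. premonic g x \<and> (\<forall>Q. stable Q \<longrightarrow> x \<in> Q)"
    if "g \<in> Z" "card (dset (lb g)) = card (dset (lb f))" "b \<in> dset (lb g)" "\<And>z. z \<in> dset (lb g) \<Longrightarrow> b \<le> z"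
      "y < b" "\<And>c. y \<notin> sel c (lb g)" for g b y
    using that
  proof (induction "nat (b - y)" arbitrary: g b rule: less_induct)
    case inner: less
    define a where "a = b - 1"
    have b: "b = a + 1" by (simp add: a_def)
    have D: "a + 1 \<in> dset (lb g)" "a + 1 \<in> sel c (lb g)" and fin: "finite (dset (lb g))" for c
      using inner.prems(3) lab_fin[OF inner.prems(1)] by (auto simp: b dset_def sel_def)
    have a: "a \<notin> dset (lb g)" using inner.prems(4)[of a] b by auto
    \<comment> \<open>As \<open>b\<close> is the least atypical entry, \<open>a\<close> lies in at
      most one of the two sets; \<open>c\<close> names a set avoiding it.\<close>
    define c where "c \<longleftrightarrow> a \<notin> fst (lb g)"
    have c: "a \<notin> sel c (lb g)" using a by (auto simp: c_def sel_def dset_def)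
    define k where "k = ul (mv c (a + 1) a (lb g))"
    have k: "k \<in> Z" "lb k = mv c (a + 1) a (lb g)"
      using lb_ul_mv[OF inner.prems(1) D(2) c] by (auto simp: k_def)
    have Dk: "dset (lb k) = (if a \<in> sel (\<not> c) (lb g) then insert a (dset (lb g) - {a + 1}) else dset (lb g) - {a + 1})"
      by (cases c) (auto simp: k dset_def mv_def sel_def)
    have "\<exists>x. premonic k x \<and> (\<forall>Q. stable Q \<longrightarrow> x \<in> Q)"
    proof (cases "a \<in> sel (\<not> c) (lb g)")
      case False
      then have "card (dset (lb k)) < card (dset (lb f))"
        using D(1) fin inner.prems(2) Dk by (metis card_Diff1_less)
      then show ?thesis using less.hyps k(1) by blast
    next
      case True
      \<comment> \<open>\<open>a\<close> is occupied while \<open>y\<close> is empty in both sets,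
        so the pair stops short of \<open>y\<close>.\<close>
      then have y: "y < a" using inner.prems(5) inner.prems(6)[of "\<not> c"] b by (cases "y = a") auto
      show ?thesis
      proof (rule inner.hyps[of a k])
        show "card (dset (lb k)) = card (dset (lb f))"
          using card_exchange[OF fin D(1) a] inner.prems(2) True by (simp add: Dk)
        show "a \<le> z" if "z \<in> dset (lb k)" for z using that inner.prems(4)[of z] True by (auto simp: Dk b)
        show "y \<notin> sel c' (lb k)" for c'
          using inner.prems(6)[of c'] y by (cases "c' = c") (auto simp: k)
      qed (use k(1) y b Dk True in auto)
    qed
    then obtain x where x: "premonic k x" "\<forall>Q. stable Q \<longrightarrow> x \<in> Q" by blast
    then have "premonic g (ext (gn (EF c a)) x)"
      using premonic_EF[OF inner.prems(1) D(1) c] by (simp add: k_def)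
    moreover have "\<forall>Q. stable Q \<longrightarrow> ext (gn (EF c a)) x \<in> Q" using x by (auto simp: stable_def premonic_def)
    ultimately show ?case by blast
  qed
  show ?case
  proof (cases "dset (lb f) = {}")
    case True
    have "premonic f (bvec f)" using less.prems by (auto simp: premonic_def inact_def bvec_apply)
    then show ?thesis using True less.prems by (intro exI[of _ "bvec f"]) (auto simp: stable_def)
  next
    case False
    define b where "b = Min (dset (lb f))"
    have b: "b \<in> dset (lb f)" "\<And>z. z \<in> dset (lb f) \<Longrightarrow> b \<le> z"
      using False lab_fin[OF less.prems] by (auto simp: b_def)
    obtain n where n: "adm n (lb f) (lb f)" using ex_adm[OF less.prems less.prems] .
    \<comment> \<open>Left of the window both sets are empty, which supplies the empty place for the
      inner induction.\<close>
    define y where "y = min b (- n) - 1"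
    have "y < - n" "y < b" by (auto simp: y_def)
    then have "y \<notin> sel c (lb f)" for c using n by (auto simp: adm_def site_def sel_def)
    then show ?thesis using atypical[OF less.prems refl b] \<open>y < b\<close> by blast
  qed
qed

text \<open>A triangular array killed by a unitriangular family is zero. There may be infinitely
  many indices below \<open>f\<close>, so \<open>h\<close> is fixed and only those with
  \<open>N\<close> at least \<open>N h\<close> are visited. \<open>S\<close> may be any finite set
  covering the support, which spares computing it exactly.\<close>

lemma vanishing:
  assumes D: "\<And>f h. f \<in> Z \<Longrightarrow> D f h \<noteq> 0 \<Longrightarrow> N h \<le> N f"
    and comb: "\<And>f. f \<in> Z \<Longrightarrow> \<exists>y. y f = 1 \<and> (\<forall>g. y g \<noteq> 0 \<longrightarrow> g = f \<or> g \<in> Z \<and> N g < N f)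
       \<and> (\<forall>h. \<exists>S. finite S \<and> {g. y g \<noteq> 0 \<and> D g h \<noteq> 0} \<subseteq> S \<and> (\<Sum>g\<in>S. y g * D g h) = (0::qf))"
    and "f \<in> Z"
  shows "D f h = 0"
  using \<open>f \<in> Z\<close>
proof (induction "nat (N f - N h)" arbitrary: f rule: less_induct)
  case less
  show ?case
  proof (rule ccontr)
    assume nz: "D f h \<noteq> 0"
    from comb[OF less.prems] obtain y
      where y: "y f = 1" "\<forall>g. y g \<noteq> 0 \<longrightarrow> g = f \<or> g \<in> Z \<and> N g < N f"
        and *: "\<forall>h. \<exists>S. finite S \<and> {g. y g \<noteq> 0 \<and> D g h \<noteq> 0} \<subseteq> S \<and> (\<Sum>g\<in>S. y g * D g h) = 0"
      by blast
    from *[rule_format, of h] obtain S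
      where S: "finite S" "{g. y g \<noteq> 0 \<and> D g h \<noteq> 0} \<subseteq> S" "(\<Sum>g\<in>S. y g * D g h) = 0"
      by blast
    have "f \<in> S" using S(2) y(1) nz by auto
    have "y g * D g h = 0" if "g \<noteq> f" for g
    proof (rule ccontr)
      assume "y g * D g h \<noteq> 0"
      then have g: "g \<in> Z" "N g < N f" "D g h \<noteq> 0" using that y(2) by auto
      then have "N h \<le> N g" using D by blast
      then show False using less.hyps[of g] g by auto
    qed
    then have "(\<Sum>g\<in>S. y g * D g h) = (\<Sum>g\<in>{f}. y g * D g h)"
      using \<open>f \<in> S\<close> S(1) by (intro sum.mono_neutral_right) auto
    then show False using S(3) y(1) nz by simp
  qed
qed

lemma psi_Eh: "psi u \<in> Eh"
  by (simp add: psi_def ext_Eh cmat_rr vbar_Eh)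

lemma psi_bvec: "f \<in> Z \<Longrightarrow> psi (bvec f) = rr f"
  by (simp add: psi_def)

lemma psi_eq: "u \<in> Eh \<Longrightarrow> psi u = ext rr (vbar u)"
  by (simp add: psi_def)

lemma rr_typical:
  assumes "f \<in> Z" "dset (lb f) = {}"
  shows "rr f = bvec f"
proof
  fix g
  have "g = f" if "rr f g \<noteq> 0"
    using rr_nz[OF that] dominates_dset_empty[of "lb f" "lb g"] assms lab_fin lb_inj by (auto dest: inj_onD)
  then show "rr f g = bvec f g" using assms(1) by (auto simp: bvec_apply)
qed

lemma psi_gn:
  assumes "u \<in> Eh"
  shows "psi (ext (gn X) u) = ext (gn (bar_gen X)) (psi u)"
proof -
  have "psi (ext (gn X) u) = ext rr (ext (\<lambda>f. vbar (gn X f)) (vbar u))"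
    using assms cmat_gn by (simp add: psi_eq ext_Eh vbar_ext)
  also have "\<dots> = ext (\<lambda>f. ext rr (vbar (gn X f))) (vbar u)"
    by (rule ext_ext[OF cmat_vbar[OF cmat_gn] cmat_rr vbar_Eh[OF assms]])
  also have "\<dots> = ext (\<lambda>f. ext (gn (bar_gen X)) (rr f)) (vbar u)"
    using assms vbar_Eh ext_rr_gn by (intro ext_cong)
  also have "\<dots> = ext (gn (bar_gen X)) (psi u)"
    using assms cmat_gn cmat_rr vbar_Eh by (simp add: psi_eq ext_ext)
  finally show ?thesis .
qed

lemma psi_psi_ext:
  assumes "u \<in> Eh"
  shows "psi (psi u) = ext (\<lambda>f. ext rr (vbar (rr f))) u"
  using assms cmat_rr cmat_vbar[OF cmat_rr]
  by (simp add: psi_eq ext_Eh vbar_Eh vbar_ext ext_ext)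

lemma stable_fixed:
  assumes "\<And>f. f \<in> Z \<Longrightarrow> dset (lb f) = {} \<Longrightarrow> \<psi> (bvec f) = bvec f"
    and "\<And>X u. u \<in> Eh \<Longrightarrow> \<psi> (ext (gn X) u) = ext (gn (bar_gen X)) (\<psi> u)"
  shows "stable {u. \<psi> u = u}"
  using assms by (simp add: stable_def)

lemma psi_diff:
  assumes "u \<in> Eh" "v \<in> Eh"
  shows "psi (\<lambda>f. u f - v f) = (\<lambda>f. psi u f - psi v f)" and "(\<lambda>f. u f - v f) \<in> Eh"
proof -
  have e: "(\<lambda>f. u f - v f) = vadd u (vsmult (- 1) v)" by auto
  show Eh: "(\<lambda>f. u f - v f) \<in> Eh" unfolding e using assms by (intro vadd_Eh vsmult_Eh)
  have "vbar (\<lambda>f. u f - v f) = vadd (vbar u) (vsmult (- 1) (vbar v))" by auto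
  then have "ext rr (vbar (\<lambda>f. u f - v f)) = vadd (ext rr (vbar u)) (vsmult (- 1) (ext rr (vbar v)))"
    using assms by (simp add: ext_vadd cmat_rr vbar_Eh vsmult_Eh ext_vsmult)
  then show "psi (\<lambda>f. u f - v f) = (\<lambda>f. psi u f - psi v f)"
    using assms Eh by (auto simp: psi_eq)
qed

text \<open>A coefficient in a maximal position of a fixed vector of \<open>psi\<close> is itself bar invariant.\<close>

lemma fixed_vanishes:
  assumes P: "\<And>c. P c \<Longrightarrow> bar_q c = c \<Longrightarrow> c = 0"
    and u: "u \<in> Eh" "psi u = u" "\<And>g. u g \<noteq> 0 \<Longrightarrow> N g \<le> b"
    and S: "\<And>g. g \<in> S \<Longrightarrow> P (u g)" "\<And>g h. g \<in> S \<Longrightarrow> rr h g \<noteq> 0 \<Longrightarrow> u h \<noteq> 0 \<Longrightarrow> h \<in> S" "g \<in> S"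
  shows "u g = 0"
proof (rule ccontr)
  assume "u g \<noteq> 0"
  \<comment> \<open>\<open>N\<close> is bounded by \<open>b\<close> on the support, so a position of
    maximal \<open>N\<close> exists; the difference is taken in \<open>nat\<close> to use a
    minimum.\<close>
  define k where "k = (ARG_MIN (\<lambda>g. nat (b - N g)) g. g \<in> S \<and> u g \<noteq> 0)"
  have k: "k \<in> S" "u k \<noteq> 0" and kmax: "\<And>h. h \<in> S \<Longrightarrow> u h \<noteq> 0 \<Longrightarrow> nat (b - N k) \<le> nat (b - N h)"
    using arg_min_nat_lemma[of "\<lambda>g. g \<in> S \<and> u g \<noteq> 0" g "\<lambda>g. nat (b - N g)"] \<open>u g \<noteq> 0\<close> S(3)
    unfolding k_def by blast+
  have kZ: "k \<in> Z" using k u(1) Eh_supp by blast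
  \<comment> \<open>Any other contribution to position \<open>k\<close> would come from a position
    of larger \<open>N\<close> inside \<open>S\<close>.\<close>
  have "h = k" if "u h \<noteq> 0" "rr h k \<noteq> 0" for h
  proof (rule ccontr)
    assume "h \<noteq> k"
    then have "N k < N h" using rr_nz[OF that(2)] dominates_lt by blast
    then show False using kmax[OF S(2)[OF k(1) that(2,1)] that(1)] u(3)[OF that(1)] by linarith
  qed
  then have "{h. vbar u h \<noteq> 0 \<and> rr h k \<noteq> 0} \<subseteq> {k}" by auto
  then have "ext rr (vbar u) k = (\<Sum>h\<in>{k}. vbar u h * rr h k)" by (intro ext_eq_sum) auto
  then have "u k = bar_q (u k)" using u(1,2) kZ by (simp add: psi_eq)
  then show False using P[OF S(1)[OF k(1)]] k by simp
qed

text \<open>Phrased by labels alone, so that it can be carried from one Fock space to the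
  other.\<close>

definition monic :: "(qf \<Rightarrow> bool) \<Rightarrow> idx \<Rightarrow> vec \<Rightarrow> bool" where
  "monic P f x \<longleftrightarrow> x \<in> Eh \<and> x f = 1 \<and> (\<forall>g. x g \<noteq> 0 \<longrightarrow> g \<in> Z \<and> dominates (lb f) (lb g)) \<and> (\<forall>g. g \<noteq> f \<longrightarrow> P (x g))"

text \<open>Positions not dominated by \<open>f\<close> are closed under passing to sources, so
  \<open>fixed_vanishes\<close> empties all of them at once.\<close>

lemma premonic_monic:
  assumes f: "f \<in> Z" and x: "premonic f x" "psi x = x"
  shows "monic in_qZq f x"
proof -
  have xEh: "x \<in> Eh" using x(1) by (simp add: premonic_def)
  have "x g = 0" if "\<not> (g \<in> Z \<and> dominates (lb f) (lb g))" for g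
  proof (rule fixed_vanishes[of in_qZq x "N f" "{g. \<not> (g \<in> Z \<and> dominates (lb f) (lb g))}", OF bar_invariant_in_qZq xEh x(2)])
    show "N g \<le> N f" if "x g \<noteq> 0" for g using that x(1) by (simp add: premonic_def)
    show "in_qZq (x g)" if "g \<in> {g. \<not> (g \<in> Z \<and> dominates (lb f) (lb g))}" for g
      using that x(1) f by (cases "g = f") (auto simp: premonic_def)
    show "h \<in> {g. \<not> (g \<in> Z \<and> dominates (lb f) (lb g))}"
      if "g \<in> {g. \<not> (g \<in> Z \<and> dominates (lb f) (lb g))}" "rr h g \<noteq> 0" for g h
      using that rr_nz[OF that(2)] dominates_trans by blast
  qed (use that in auto)
  then show ?thesis using x(1) by (auto simp: monic_def premonic_def)
qed

lemma monic_qZq_ex: "f \<in> Z \<Longrightarrow> \<exists>x. monic in_qZq f x \<and> psi x = x"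
  using premonic_ex[of f] premonic_monic stable_fixed[of psi] psi_bvec rr_typical psi_gn by fastforce

lemma monic_N:
  assumes "monic P f x" "f \<in> Z"
  shows "x g \<noteq> 0 \<Longrightarrow> g = f \<or> g \<in> Z \<and> N g < N f"
  using assms dominates_lt[of f g] by (auto simp: monic_def)

text \<open>The square of \<open>psi\<close> is linear, and its difference from the identity kills a
  unitriangular family of fixed vectors.\<close>

lemma psi_psi:
  assumes "u \<in> Eh"
  shows "psi (psi u) = u"
proof -
  define T where "T f = ext rr (vbar (rr f))" for f
  have cT: "cmat T" unfolding T_def using cmat_rr cmat_vbar by (intro cmat_ext)
  define D where "D f h = T f h - bvec f h" for f h
  have D0: "D f h = 0" if "f \<in> Z" for f h
  proof (rule vanishing[where D = D, OF _ _ that])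
    fix f h assume f: "f \<in> Z" and nz: "D f h \<noteq> 0"
    then consider "h = f" | "T f h \<noteq> 0" by (auto simp: D_def bvec_apply split: if_splits)
    then show "N h \<le> N f"
    proof cases
      case 2
      then obtain g where "vbar (rr f) g \<noteq> 0" "rr g h \<noteq> 0" using ext_nonzero unfolding T_def by blast
      then have "N g \<le> N f" "N h \<le> N g" using rr_nz dominates_N by auto
      then show ?thesis by simp
    qed simp
  next
    fix f assume f: "f \<in> Z"
    obtain x where x: "monic in_qZq f x" "psi x = x" using monic_qZq_ex[OF f] by blast
    then have xEh: "x \<in> Eh" by (simp add: monic_def)
    have "ext T x = x" using x(2) psi_psi_ext[OF xEh] by (simp add: T_def[abs_def])
    have "\<exists>S. finite S \<and> {g. x g \<noteq> 0 \<and> D g h \<noteq> 0} \<subseteq> S \<and> (\<Sum>g\<in>S. x g * D g h) = 0" for h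
    proof -
      \<comment> \<open>\<open>h\<close> is added for the column of the identity matrix.\<close>
      define S where "S = insert h {g. x g \<noteq> 0 \<and> T g h \<noteq> 0}"
      have S: "finite S" unfolding S_def using finite_column[OF cT xEh] by simp
      have "(\<Sum>g\<in>S. x g * T g h) = x h"
      proof -
        have "(\<Sum>g\<in>S. x g * T g h) = ext T x h"
          by (rule ext_eq_sum[OF S, symmetric]) (auto simp: S_def)
        then show ?thesis by (simp only: \<open>ext T x = x\<close>)
      qed
      moreover have "(\<Sum>g\<in>S. x g * bvec g h) = x h"
      proof -
        have "(\<Sum>g\<in>S. x g * bvec g h) = (\<Sum>g\<in>S. if g = h then x h else 0)"
          by (intro sum.cong) (auto simp: bvec_apply)
        then show ?thesis using S by (simp add: S_def)
      qed
      ultimately have "(\<Sum>g\<in>S. x g * D g h) = 0"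
        by (simp add: D_def right_diff_distrib sum_subtractf)
      moreover have "{g. x g \<noteq> 0 \<and> D g h \<noteq> 0} \<subseteq> S"
        by (auto simp: S_def D_def bvec_apply split: if_splits)
      ultimately show ?thesis using S by blast
    qed
    then show "\<exists>y. y f = 1 \<and> (\<forall>g. y g \<noteq> 0 \<longrightarrow> g = f \<or> g \<in> Z \<and> N g < N f)
       \<and> (\<forall>h. \<exists>S. finite S \<and> {g. y g \<noteq> 0 \<and> D g h \<noteq> 0} \<subseteq> S \<and> (\<Sum>g\<in>S. y g * D g h) = 0)"
      using x(1) monic_N[OF x(1) f] by (intro exI[of _ x]) (auto simp: monic_def)
  qed
  then have "T f = bvec f" if "f \<in> Z" for f using that by (auto simp: D_def)
  then have "psi (psi u) = ext bvec u"
    unfolding psi_psi_ext[OF assms] T_def[symmetric] using assms by (intro ext_cong) auto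
  also have "\<dots> = u"
  proof
    fix g
    have "{f. u f \<noteq> 0 \<and> bvec f g \<noteq> 0} = (if u g = 0 then {} else {g})" by (auto simp: bvec_apply)
    then show "ext bvec u g = u g" by (simp add: ext_def bvec_apply)
  qed
  finally show ?thesis .
qed

lemma is_bar_psi: "is_bar psi"
  unfolding is_bar_def
proof (intro conjI ballI allI impI)
  show "cont_antilinear Eh psi"
    unfolding cont_antilinear_def
  proof (intro ballI allI conjI)
    fix u g assume u: "u \<in> Eh"
    have S: "{f. u f \<noteq> 0 \<and> psi (bvec f) g \<noteq> 0} = {f. vbar u f \<noteq> 0 \<and> rr f g \<noteq> 0}"
      using Eh_supp[OF u] psi_bvec by force
    then show "finite {f. u f \<noteq> 0 \<and> psi (bvec f) g \<noteq> 0}"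
      using finite_column[OF cmat_rr vbar_Eh[OF u]] by simp
    show "psi u g = (\<Sum>f | u f \<noteq> 0 \<and> psi (bvec f) g \<noteq> 0. bar_q (u f) * psi (bvec f) g)"
      unfolding S psi_eq[OF u] ext_def using Eh_supp[OF u] psi_bvec by (intro sum.cong) auto
  qed
next
  fix f g assume f: "f \<in> Z"
  show "laurent_int (psi (bvec f) g)" using f by (simp add: psi_bvec rr_def laurent_int_rmat)
  show "lt g f" if "g \<noteq> f \<and> psi (bvec f) g \<noteq> 0"
    using that rr_nz[of f g] dominates_lt[of f g] f by (auto simp: psi_bvec)
qed (auto simp: psi_Eh psi_bvec rr_typical psi_gn psi_psi, simp add: psi_def)

lemma is_bar_cont:
  assumes "is_bar \<psi>" "u \<in> Eh"
  shows "finite {f. u f \<noteq> 0 \<and> \<psi> (bvec f) g \<noteq> 0}"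
    and "\<psi> u g = (\<Sum>f | u f \<noteq> 0 \<and> \<psi> (bvec f) g \<noteq> 0. bar_q (u f) * \<psi> (bvec f) g)"
  using assms by (simp_all add: is_bar_def cont_antilinear_def)

text \<open>A vector generated from typical ones is fixed by both maps. By antilinearity the
  difference of their matrices kills its conjugate \<open>vbar x\<close>, which is unitriangular as
  well.\<close>

lemma is_bar_unique:
  assumes "is_bar \<psi>"
  shows "\<psi> = psi"
proof -
  have bars: "\<phi> = psi \<or> \<phi> = \<psi> \<Longrightarrow> is_bar \<phi>" for \<phi> using assms is_bar_psi by blast
  define D where "D f h = \<psi> (bvec f) h - psi (bvec f) h" for f h
  have lower: "h = f \<or> h \<in> Z \<and> lt h f" if "f \<in> Z" "\<phi> (bvec f) h \<noteq> 0" "is_bar \<phi>" for \<phi> f h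
    using that unfolding is_bar_def by (metis Eh_supp bvec_Eh)
  have D0: "D f h = 0" if "f \<in> Z" for f h
  proof (rule vanishing[where D = D, OF _ _ that])
    fix f h assume f: "f \<in> Z" and "D f h \<noteq> 0"
    then have "\<psi> (bvec f) h \<noteq> 0 \<or> psi (bvec f) h \<noteq> 0" by (auto simp: D_def)
    then have "h = f \<or> h \<in> Z \<and> lt h f" using lower f assms is_bar_psi by blast
    then show "N h \<le> N f" using lt_sum[OF f] by (auto simp: N_def)
  next
    fix f assume f: "f \<in> Z"
    have st: "stable {u. \<phi> u = u}" if "is_bar \<phi>" for \<phi>
      using that by (intro stable_fixed) (auto simp: is_bar_def)
    obtain x where x: "monic in_qZq f x" "\<psi> x = x" "psi x = x"
      using premonic_ex[OF f] premonic_monic[OF f] st[OF assms] st[OF is_bar_psi] by blast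
    then have xEh: "x \<in> Eh" by (simp add: monic_def)
    have "\<exists>S. finite S \<and> {g. vbar x g \<noteq> 0 \<and> D g h \<noteq> 0} \<subseteq> S \<and> (\<Sum>g\<in>S. vbar x g * D g h) = 0" for h
    proof -
      define S where "S = {g. x g \<noteq> 0 \<and> \<psi> (bvec g) h \<noteq> 0} \<union> {g. x g \<noteq> 0 \<and> psi (bvec g) h \<noteq> 0}"
      have S: "finite S" using is_bar_cont(1)[OF _ xEh] assms is_bar_psi by (simp add: S_def)
      have val: "\<phi> x h = (\<Sum>g\<in>S. vbar x g * \<phi> (bvec g) h)" if "\<phi> = psi \<or> \<phi> = \<psi>" for \<phi>
      proof -
        have "\<phi> x h = (\<Sum>f | x f \<noteq> 0 \<and> \<phi> (bvec f) h \<noteq> 0. bar_q (x f) * \<phi> (bvec f) h)"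
          using is_bar_cont(2)[OF bars[OF that] xEh] .
        also have "\<dots> = (\<Sum>g\<in>S. vbar x g * \<phi> (bvec g) h)"
          unfolding vbar_apply using S that by (intro sum.mono_neutral_left) (auto simp: S_def)
        finally show ?thesis .
      qed
      have "(\<Sum>g\<in>S. vbar x g * D g h) = 0"
        using val[of psi] val[of \<psi>] x by (simp add: D_def right_diff_distrib sum_subtractf)
      moreover have "{g. vbar x g \<noteq> 0 \<and> D g h \<noteq> 0} \<subseteq> S" by (auto simp: S_def D_def)
      ultimately show ?thesis using S by blast
    qed
    then show "\<exists>y. y f = 1 \<and> (\<forall>g. y g \<noteq> 0 \<longrightarrow> g = f \<or> g \<in> Z \<and> N g < N f)
       \<and> (\<forall>h. \<exists>S. finite S \<and> {g. y g \<noteq> 0 \<and> D g h \<noteq> 0} \<subseteq> S \<and> (\<Sum>g\<in>S. y g * D g h) = 0)"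
      using x(1) monic_N[OF x(1) f] by (intro exI[of _ "vbar x"]) (auto simp: monic_def)
  qed
  then have eq: "\<psi> (bvec f) g = psi (bvec f) g" if "f \<in> Z" for f g using that by (auto simp: D_def)
  show ?thesis
  proof (intro HOL.ext)
    fix u g
    show "\<psi> u g = psi u g"
    proof (cases "u \<in> Eh")
      case True
      have val: "\<phi> u g = (\<Sum>f | u f \<noteq> 0 \<and> \<phi> (bvec f) g \<noteq> 0. bar_q (u f) * \<phi> (bvec f) g)"
        if "\<phi> = psi \<or> \<phi> = \<psi>" for \<phi>
        using is_bar_cont(2)[OF bars[OF that] True] .
      have "{f. u f \<noteq> 0 \<and> \<psi> (bvec f) g \<noteq> 0} = {f. u f \<noteq> 0 \<and> psi (bvec f) g \<noteq> 0}"
        using eq Eh_supp[OF True] by auto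
      then show ?thesis unfolding val[OF disjI1[OF refl]] val[OF disjI2[OF refl]]
        using eq Eh_supp[OF True] by (intro sum.cong) auto
    next
      case False
      then show ?thesis using assms is_bar_psi unfolding is_bar_def by metis
    qed
  qed
qed

lemma The_is_bar: "(THE \<psi>. is_bar \<psi>) = psi"
  using is_bar_psi is_bar_unique by (rule the_equality)

section \<open>Canonical and dual canonical bases\<close>

definition canonical :: "(qf \<Rightarrow> bool) \<Rightarrow> idx \<Rightarrow> vec \<Rightarrow> bool" where
  "canonical P f x \<longleftrightarrow> x \<in> Eh \<and> psi x = x \<and> x f = 1 \<and> (\<forall>g. g \<noteq> f \<longrightarrow> P (x g) \<and> (x g \<noteq> 0 \<longrightarrow> lt g f))"

lemma canonicalI:
  assumes "f \<in> Z" "monic P f x" "psi x = x"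
  shows "canonical P f x"
  using assms dominates_lt[of f] by (auto simp: canonical_def monic_def)

text \<open>A competitor is confined by \<open>lt\<close> and not by domination. The condition on
  sums still bounds \<open>N\<close> on its support, so \<open>fixed_vanishes\<close> applies to the
  difference with \<open>S\<close> the set of all positions.\<close>

lemma canonical_unique:
  assumes P: "\<And>c. P c \<Longrightarrow> bar_q c = c \<Longrightarrow> c = 0" "\<And>c c'. P c \<Longrightarrow> P c' \<Longrightarrow> P (c - c')" "P 0"
    and f: "f \<in> Z" and x: "canonical P f x" and y: "canonical P f y"
  shows "x = y"
proof
  fix g
  have supp: "N g \<le> N f" if "x g \<noteq> 0 \<or> y g \<noteq> 0" for g
    using that x y f lt_sum[OF f, of g] Eh_supp[of _ g] unfolding canonical_def N_def by (cases "g = f") auto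
  have "P (x g - y g)" for g
    using x y P(2,3) unfolding canonical_def by (cases "g = f") auto
  then have "x g - y g = 0"
    using fixed_vanishes[of P "\<lambda>g. x g - y g" "N f" UNIV g, OF P(1)] psi_diff[of x y] x y supp
    unfolding canonical_def by force
  then show "x g = y g" by simp
qed

lemma The_canonical:
  assumes "\<And>c. P c \<Longrightarrow> bar_q c = c \<Longrightarrow> c = 0" "\<And>c c'. P c \<Longrightarrow> P c' \<Longrightarrow> P (c - c')" "P 0"
    and "f \<in> Z" "canonical P f x"
  shows "(THE x. canonical P f x) = x"
  using assms canonical_unique[of P f] by (intro the_equality) blast+

definition uu :: "idx \<Rightarrow> vec" where "uu f = (SOME x. monic in_qZq f x \<and> psi x = x)"

lemma uu: "f \<in> Z \<Longrightarrow> monic in_qZq f (uu f) \<and> psi (uu f) = uu f"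
  using someI_ex[OF monic_qZq_ex] by (simp add: uu_def)

text \<open>The bar-invariant coefficients expressing the dual canonical basis through the canonical one.\<close>

function cc :: "idx \<Rightarrow> idx \<Rightarrow> qf" where
  "cc f h = (if h = f then 1 else if f \<in> Z \<and> h \<in> Z \<and> dominates (lb f) (lb h)
     then (SOME c. laurent_int c \<and> bar_q c = c \<and> in_qinvZqinv (c +
       (\<Sum>g | g \<in> Z \<and> g \<noteq> h \<and> dominates (lb f) (lb g) \<and> dominates (lb g) (lb h). cc f g * uu g h)))
     else 0)"
  by pat_completeness auto
termination
proof (relation "measure (\<lambda>(f, h). nat (N f - N h))")
  fix f h g
  assume "h \<noteq> f" "f \<in> Z \<and> h \<in> Z \<and> dominates (lb f) (lb h)"
    "g \<in> {g \<in> Z. g \<noteq> h \<and> dominates (lb f) (lb g) \<and> dominates (lb g) (lb h)}"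
  \<comment> \<open>The recursion runs downwards from \<open>f\<close>: the coefficient at
    \<open>h\<close> calls only those at strictly larger \<open>N\<close>.\<close>
  then have "N g \<le> N f" "N h < N g" using dominates_N dominates_lt by auto
  then show "((f, g), f, h) \<in> measure (\<lambda>(f, h). nat (N f - N h))" by simp
qed simp

declare cc.simps [simp del]

lemma laurent_int_uu:
  assumes "f \<in> Z"
  shows "laurent_int (uu f g)"
  using uu[OF assms] in_qZq_laurent_int unfolding monic_def by (cases "g = f") auto

lemma cc_props:
  assumes "f \<in> Z"
  shows "laurent_int (cc f h) \<and> bar_q (cc f h) = cc f h \<and>
    (h \<in> Z \<longrightarrow> h \<noteq> f \<longrightarrow> dominates (lb f) (lb h) \<longrightarrow> in_qinvZqinv (cc f h +
       (\<Sum>g | g \<in> Z \<and> g \<noteq> h \<and> dominates (lb f) (lb g) \<and> dominates (lb g) (lb h). cc f g * uu g h)))"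
proof (induction "nat (N f - N h)" arbitrary: h rule: less_induct)
  case less
  show ?case
  proof (cases "h \<noteq> f \<and> h \<in> Z \<and> dominates (lb f) (lb h)")
    case True
    define t where "t = (\<Sum>g | g \<in> Z \<and> g \<noteq> h \<and> dominates (lb f) (lb g) \<and> dominates (lb g) (lb h). cc f g * uu g h)"
    have "laurent_int t"
      unfolding t_def
    proof (intro laurent_int_sum laurent_int_mult)
      fix g assume g: "g \<in> {g \<in> Z. g \<noteq> h \<and> dominates (lb f) (lb g) \<and> dominates (lb g) (lb h)}"
      then have "N g \<le> N f" "N h < N g" using dominates_N[OF assms] dominates_lt True by auto
      then show "laurent_int (cc f g)" using less by simp
      show "laurent_int (uu g h)" using g laurent_int_uu by simp
    qed
    then have "\<exists>c. laurent_int c \<and> bar_q c = c \<and> in_qinvZqinv (c + t)" by (rule laurent_int_split)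
    then have "laurent_int (SOME c. laurent_int c \<and> bar_q c = c \<and> in_qinvZqinv (c + t)) \<and>
        bar_q (SOME c. laurent_int c \<and> bar_q c = c \<and> in_qinvZqinv (c + t))
          = (SOME c. laurent_int c \<and> bar_q c = c \<and> in_qinvZqinv (c + t)) \<and>
        in_qinvZqinv ((SOME c. laurent_int c \<and> bar_q c = c \<and> in_qinvZqinv (c + t)) + t)"
      by (rule someI_ex)
    moreover have "cc f h = (SOME c. laurent_int c \<and> bar_q c = c \<and> in_qinvZqinv (c + t))"
      using True assms unfolding t_def by (subst cc.simps) simp
    ultimately show ?thesis unfolding t_def by simp
  next
    case False
    then have "cc f h = 1 \<or> cc f h = 0" by (subst (1 2) cc.simps) auto
    then show ?thesis using False by auto
  qed
qed

lemma cc_dom: "f \<in> Z \<Longrightarrow> cc f h \<noteq> 0 \<Longrightarrow> h \<in> Z \<and> dominates (lb f) (lb h)"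
  by (subst (asm) cc.simps) (auto split: if_splits)

lemma uu_dom: "f \<in> Z \<Longrightarrow> uu f h \<noteq> 0 \<Longrightarrow> h \<in> Z \<and> dominates (lb f) (lb h)"
  using uu[of f] by (simp add: monic_def)

text \<open>The combination of canonical basis vectors may be infinite, so its invariance is deduced
  by \<open>ext_ext\<close> from that of the coefficients \<open>cc f\<close> and of the vectors
  \<open>uu g\<close>.\<close>

lemma monic_qinvZqinv_ex:
  assumes f: "f \<in> Z"
  shows "\<exists>x. monic in_qinvZqinv f x \<and> psi x = x"
proof (intro exI conjI)
  have cEh: "cc f \<in> Eh" using cc_dom[OF f] by (intro dominates_row_Eh[OF f]) auto
  have cuu: "cmat uu" using uu_dom by (intro cmat_dom) blast
  have vc: "vbar (cc f) = cc f" using cc_props[OF f] by auto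
  have "psi (ext uu (cc f)) = ext rr (ext (\<lambda>g. vbar (uu g)) (cc f))"
    using cEh cuu by (simp add: psi_eq ext_Eh vbar_ext vc)
  also have "\<dots> = ext (\<lambda>g. ext rr (vbar (uu g))) (cc f)"
    by (rule ext_ext[OF cmat_vbar[OF cuu] cmat_rr cEh])
  also have "\<dots> = ext uu (cc f)"
  proof (intro ext_cong[OF cEh])
    fix g assume "g \<in> Z"
    then have "uu g \<in> Eh" "psi (uu g) = uu g" using uu[of g] by (auto simp: monic_def)
    then show "ext rr (vbar (uu g)) = uu g" by (simp add: psi_eq)
  qed
  finally show "psi (ext uu (cc f)) = ext uu (cc f)" .
  have Eh: "ext uu (cc f) \<in> Eh" using cuu cEh by (rule ext_Eh)
  have dominates: "h \<in> Z \<and> dominates (lb f) (lb h)" if nz: "ext uu (cc f) h \<noteq> 0" for h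
  proof -
    obtain g where g: "cc f g \<noteq> 0" "uu g h \<noteq> 0" using ext_nonzero[OF nz] by blast
    then have "g \<in> Z" "dominates (lb f) (lb g)" using cc_dom[OF f] by auto
    then show ?thesis using uu_dom[of g h] g dominates_trans by blast
  qed
  \<comment> \<open>The coefficient at \<open>h\<close> is \<open>cc f h\<close> plus precisely the
    sum that \<open>cc f h\<close> was chosen to correct.\<close>
  have val: "ext uu (cc f) h = cc f h +
      (\<Sum>g | g \<in> Z \<and> g \<noteq> h \<and> dominates (lb f) (lb g) \<and> dominates (lb g) (lb h). cc f g * uu g h)"
    if h: "h \<in> Z" for h
  proof -
    define S where "S = {g. g \<in> Z \<and> g \<noteq> h \<and> dominates (lb f) (lb g) \<and> dominates (lb g) (lb h)}"
    obtain d where d: "low d h" using ex_lower[OF h] .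
    have "lb ` S \<subseteq> {s. dominates (lb f) s \<and> finite (dset s) \<and> snd s \<subseteq> {- int d..}}"
    proof (rule image_subsetI)
      fix g assume g: "g \<in> S"
      then show "lb g \<in> {s. dominates (lb f) s \<and> finite (dset s) \<and> snd s \<subseteq> {- int d..}}"
        using lab_fin h dominates_snd_lower[of "lb g" "lb h", OF _ _ _ d] by (simp add: S_def)
    qed
    then have "finite (lb ` S)" by (rule finite_subset) (rule finite_dom_below[OF lab_fin[OF f]])
    moreover have "inj_on lb S" using lb_inj by (rule inj_on_subset) (auto simp: S_def)
    ultimately have S: "finite S" by (rule finite_imageD)
    have "{g. cc f g \<noteq> 0 \<and> uu g h \<noteq> 0} \<subseteq> insert h S"
      using cc_dom[OF f] uu_dom by (auto simp: S_def)
    then have "ext uu (cc f) h = (\<Sum>g\<in>insert h S. cc f g * uu g h)" using S by (intro ext_eq_sum) auto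
    also have "\<dots> = cc f h * uu h h + (\<Sum>g\<in>S. cc f g * uu g h)" using S by (intro sum.insert) (auto simp: S_def)
    also have "uu h h = 1" using uu[OF h] by (simp add: monic_def)
    finally show ?thesis by (simp add: S_def)
  qed
  have "{g. g \<in> Z \<and> g \<noteq> f \<and> dominates (lb f) (lb g) \<and> dominates (lb g) (lb f)} = {}"
    using dominates_lt(2)[OF f] dominates_lt(2)[OF _ f] by (metis (mono_tags, lifting) empty_Collect_eq order_less_asym)
  then have "ext uu (cc f) f = cc f f" using val[OF f] by (simp only: sum.empty add_0_right)
  moreover have "cc f f = 1" by (simp add: cc.simps)
  moreover have "in_qinvZqinv (ext uu (cc f) h)" if "h \<noteq> f" for h
  proof (cases "ext uu (cc f) h = 0")
    case True
    then show ?thesis by (simp add: in_qinvZqinv_iff_bar)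
  next
    case False
    then show ?thesis using dominates[OF False] val cc_props[OF f, of h] that by simp
  qed
  ultimately show "monic in_qinvZqinv f (ext uu (cc f))" using Eh dominates by (simp add: monic_def)
qed

end

section \<open>The two index sets\<close>

text \<open>The sign is 1 for decreasing and -1 for increasing sequences, so both index sets share
  one theory.\<close>

definition sdec :: "int set \<Rightarrow> int \<Rightarrow> idx \<Rightarrow> bool" where
  "sdec D s f \<longleftrightarrow> (\<forall>i\<in>D. \<forall>j\<in>D. i < j \<longrightarrow> s * f j < s * f i)"

lemma sdec_inj: "sdec D s f \<Longrightarrow> inj_on f D"
  unfolding sdec_def by (intro inj_onI) (metis less_irrefl linorder_neqE)

text \<open>The values are assigned in order from the least position on: at a first difference one
  of the sequences would have to skip a common value.\<close>

lemma sdec_unique: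
  assumes f: "sdec D s f" and g: "sdec D s g" and im: "f ` D = g ` D" and lower: "\<forall>i\<in>D. b \<le> i"
    and s: "s \<noteq> 0"
    and "i \<in> D"
  shows "f i = g i"
  using \<open>i \<in> D\<close>
proof (induction "nat (i - b)" arbitrary: i rule: less_induct)
  case less
  have eq: "f k = g k" if "k \<in> D" "k < i" for k
    using less.hyps[of k] that lower by fastforce
  have le: "s * u i \<le> s * v i"
    if u: "sdec D s u" and v: "sdec D s v" and im: "u ` D = v ` D" and eq: "\<And>k. k \<in> D \<Longrightarrow> k < i \<Longrightarrow> u k = v k" for u v
  proof -
    obtain k where k: "k \<in> D" "u i = v k" using im less.prems by (metis imageE imageI)
    have "\<not> k < i"
    proof
      assume "k < i"
      then have "u i = u k" using k eq by simp
      then show False using u k less.prems \<open>k < i\<close> unfolding sdec_def by fastforce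
    qed
    then show ?thesis using v k less.prems unfolding sdec_def by (cases "k = i") (auto simp: not_less less_le)
  qed
  have "s * f i = s * g i" by (rule antisym[OF le[OF f g im eq] le[OF g f im[symmetric] eq[symmetric]]])
  then show ?case using s by simp
qed

lemma repl_image:
  assumes "x \<in> f ` D"
  shows "repl D x y f ` D = insert y (f ` D - {x})"
  using assms by (auto simp: repl_def image_iff)

lemma repl_off: "i \<notin> D \<Longrightarrow> repl D x y f i = f i"
  by (simp add: repl_def)

lemma repl_image_off: "D \<inter> D' = {} \<Longrightarrow> repl D x y f ` D' = f ` D'"
  by (intro image_cong refl) (auto simp: repl_def)

lemma sdec_repl_off:
  assumes "D \<inter> D' = {}"
  shows "sdec D' s (repl D x y f) \<longleftrightarrow> sdec D' s f"
proof -
  have "repl D x y f i = f i" if "i \<in> D'" for i using that assms by (intro repl_off) auto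
  then show ?thesis by (simp add: sdec_def)
qed

text \<open>No integer lies strictly between a value and its free neighbour, so the order of the
  sequence survives.\<close>

lemma repl_sdec:
  assumes "sdec D s f" "y \<notin> f ` D" "y = x + 1 \<or> x = y + 1" "s = 1 \<or> s = -1"
  shows "sdec D s (repl D x y f)"
  unfolding sdec_def
proof (intro ballI impI)
  fix i j assume ij: "i \<in> D" "j \<in> D" "i < j"
  have "s * f j < s * f i" "f i \<noteq> y" "f j \<noteq> y" using assms(1,2) ij unfolding sdec_def by auto
  then show "s * repl D x y f j < s * repl D x y f i"
    using assms(3,4) ij by (auto simp: repl_def)
qed

lemma fun_swap_image:
  assumes "i \<in> D" "j \<in> D"
  shows "(h(i := h j, j := h i)) ` D = h ` D"
proof (intro equalityI subsetI)
  fix v assume "v \<in> h ` D"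
  then obtain k where k: "k \<in> D" "v = h k" by blast
  have "v = (h(i := h j, j := h i)) (if k = i then j else if k = j then i else k)" using k by auto
  moreover have "(if k = i then j else if k = j then i else k) \<in> D" using k assms by simp
  ultimately show "v \<in> (h(i := h j, j := h i)) ` D" by blast
qed (use assms in \<open>auto split: if_splits\<close>)

lemma fun_swap_inj_on:
  assumes "i \<in> D" "j \<in> D" "inj_on h D"
  shows "inj_on (h(i := h j, j := h i)) D"
proof (rule inj_onI)
  fix x y assume xy: "x \<in> D" "y \<in> D" "(h(i := h j, j := h i)) x = (h(i := h j, j := h i)) y"
  define t where "t k = (if k = i then j else if k = j then i else k)" for k
  have "h (t x) = h (t y)" using xy(3) by (auto simp: t_def split: if_splits)
  moreover have "t x \<in> D" "t y \<in> D" using xy assms by (auto simp: t_def)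
  ultimately have "t x = t y" using assms(3) by (auto dest: inj_onD)
  then show "x = y" by (auto simp: t_def split: if_splits)
qed

text \<open>Selection sort: one swap puts the extreme value at \<open>l\<close>, and the rest is
  sorted recursively. The relation is abstract because sorting climbs in both orders, by Bruhat
  steps in one and by reversed super steps in the other.\<close>

lemma sort_interval:
  fixes l u s :: int
  assumes step: "\<And>h i j. l \<le> i \<Longrightarrow> i < j \<Longrightarrow> j \<le> u \<Longrightarrow> s * h i < s * h j \<Longrightarrow> R h (h(i := h j, j := h i))"
    and f: "sdec {l..u} s f" and h: "inj_on h {l..u}" "h ` {l..u} = f ` {l..u}" "\<And>i. i \<notin> {l..u} \<Longrightarrow> h i = f i"
  shows "R\<^sup>*\<^sup>* h f"
  using assms
proof (induction "nat (u + 1 - l)" arbitrary: l h rule: less_induct)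
  case less
  show ?case
  proof (cases "l \<le> u")
    case False
    then have "h = f" using less.prems(5) by auto
    then show ?thesis by simp
  next
    case True
    have lu: "{l..u} = insert l {l + 1..u}" using True by auto
    have rec: "R\<^sup>*\<^sup>* k f" if k: "inj_on k {l..u}" "k ` {l..u} = f ` {l..u}" "\<And>i. i \<notin> {l..u} \<Longrightarrow> k i = f i" "k l = f l" for k
    proof (rule less.hyps[of "l + 1"])
      have "inj_on f {l..u}" using less.prems(2) by (rule sdec_inj)
      then have "f ` {l + 1..u} = f ` {l..u} - {f l}" unfolding lu by (subst (asm) inj_on_insert) auto
      moreover have "k ` {l + 1..u} = k ` {l..u} - {k l}" using k(1) unfolding lu by (subst (asm) inj_on_insert) auto
      ultimately show "k ` {l + 1..u} = f ` {l + 1..u}" using k by simp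
      show "inj_on k {l + 1..u}" using k(1) by (rule inj_on_subset) auto
      show "sdec {l + 1..u} s f" using less.prems(2) by (auto simp: sdec_def)
      show "k i = f i" if "i \<notin> {l + 1..u}" for i using k(3,4) that by (cases "i = l") auto
    qed (use True less.prems(1) in auto)
    show ?thesis
    proof (cases "h l = f l")
      case True
      then show ?thesis using rec less.prems by blast
    next
      case False
      have lin: "l \<in> {l..u}" using True by simp
      then obtain p where p: "p \<in> {l..u}" "h p = f l" using less.prems(4) by (metis imageE imageI)
      have "p \<noteq> l" using False p by auto
      obtain q where q: "q \<in> {l..u}" "h l = f q" using less.prems(4) lin by (metis imageE imageI)
      have "q \<noteq> l" using False q by auto
      \<comment> \<open>\<open>f l\<close> is the extreme value, so bringing it to \<open>l\<close>
        removes an inversion.\<close>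
      then have "s * h l < s * h p" using less.prems(2) q p lin unfolding sdec_def by auto
      then have R: "R h (h(l := h p, p := h l))" using p \<open>p \<noteq> l\<close> by (intro less.prems(1)) auto
      have "R\<^sup>*\<^sup>* (h(l := h p, p := h l)) f"
      proof (rule rec)
        show "inj_on (h(l := h p, p := h l)) {l..u}"
          using lin p(1) less.prems(3) by (rule fun_swap_inj_on)
        have "(h(l := h p, p := h l)) ` {l..u} = h ` {l..u}"
          using lin p(1) by (rule fun_swap_image)
        then show "(h(l := h p, p := h l)) ` {l..u} = f ` {l..u}" using less.prems(4) by simp
      qed (use less.prems(5) lin p \<open>p \<noteq> l\<close> in auto)
      with R show ?thesis by (rule converse_rtranclp_into_rtranclp)
    qed
  qed
qed

lemma Dneg_Dpos [simp]: "Dneg m \<inter> Dpos = {}" "Dpos \<inter> Dneg m = {}"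
  by (auto simp: Dneg_def Dpos_def)

lemma Dpos_not_Dneg: "i \<in> Dpos \<Longrightarrow> i \<notin> Dneg m"
  by (auto simp: Dneg_def Dpos_def)

lemma finite_Dneg [simp]: "finite (Dneg m)"
  by (simp add: Dneg_def)

text \<open>The positive half is infinite, but beyond \<open>M\<close> it is already in place, so
  sorting an interval is enough.\<close>

lemma sort_chain:
  assumes neg: "\<And>h i j. i \<in> Dneg m \<Longrightarrow> j \<in> Dneg m \<Longrightarrow> i < j \<Longrightarrow> h i < h j \<Longrightarrow> R h (h(i := h j, j := h i))"
    and pos: "\<And>h i j. i \<in> Dpos \<Longrightarrow> j \<in> Dpos \<Longrightarrow> i < j \<Longrightarrow> s * h i < s * h j \<Longrightarrow> R h (h(i := h j, j := h i))"
    and f: "sdec (Dneg m) 1 f" "sdec Dpos s f"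
    and h: "inj_on h (Dneg m)" "inj_on h Dpos" "h ` Dneg m = f ` Dneg m" "h ` Dpos = f ` Dpos"
      "\<And>i. i \<notin> Imi m \<Longrightarrow> h i = f i" "\<And>i. i > M \<Longrightarrow> h i = f i"
  shows "R\<^sup>*\<^sup>* h f"
proof -
  define k where "k i = (if i \<in> Dneg m then f i else h i)" for i
  have "R\<^sup>*\<^sup>* h k"
  proof (rule sort_interval[where l = "- int m" and u = "-1" and s = 1])
    show "R h (h(i := h j, j := h i))" if "- int m \<le> i" "i < j" "j \<le> - 1" "1 * h i < 1 * h j" for h i j
      using that by (intro neg) (auto simp: Dneg_def)
  qed (use f h in \<open>auto simp: Dneg_def[symmetric] k_def sdec_def\<close>)
  moreover have "R\<^sup>*\<^sup>* k f"
  proof (rule sort_interval[where l = 1 and u = M and s = s])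
    show "R h (h(i := h j, j := h i))" if "1 \<le> i" "i < j" "j \<le> M" "s * h i < s * h j" for h i j
      using that by (intro pos) (auto simp: Dpos_def)
    have sub: "{1..M} = Dpos - {M<..}" and dp: "{1..M} \<subseteq> Dpos" by (auto simp: Dpos_def)
    have kh: "k i = h i" if "i \<in> Dpos" for i using that by (simp add: k_def Dpos_not_Dneg)
    show "sdec {1..M} s f" using f(2) dp unfolding sdec_def by blast
    have "inj_on k Dpos" using h(2) kh inj_on_cong[of Dpos k h] by blast
    then show "inj_on k {1..M}" using dp by (rule inj_on_subset)
    have "k ` {1..M} = h ` (Dpos - Dpos \<inter> {M<..})" using kh by (intro image_cong) (auto simp: Dpos_def)
    also have "\<dots> = h ` Dpos - h ` (Dpos \<inter> {M<..})" using h(2) by (intro inj_on_image_set_diff) auto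
    also have "h ` (Dpos \<inter> {M<..}) = f ` (Dpos \<inter> {M<..})" using h(6) by (intro image_cong) auto
    also have "h ` Dpos - f ` (Dpos \<inter> {M<..}) = f ` (Dpos - Dpos \<inter> {M<..})"
      unfolding h(4) using sdec_inj[OF f(2)] by (intro inj_on_image_set_diff[symmetric]) auto
    also have "Dpos - Dpos \<inter> {M<..} = {1..M}" by (auto simp: Dpos_def)
    finally show "k ` {1..M} = f ` {1..M}" .
    show "k i = f i" if "i \<notin> {1..M}" for i
      using that h(5)[of i] h(6)[of i] by (cases "i > M") (auto simp: k_def Imi_def Dpos_def)
  qed
  ultimately show ?thesis by (rule rtranclp_trans)
qed

lemma sum_fun_swap:
  fixes f :: idx
  assumes "finite D" "i \<in> D" "j \<in> D" "i \<noteq> j"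
  shows "sum (f(i := f j, j := f i)) D = sum f D"
proof -
  have *: "sum g D = g i + (g j + sum g (D - {i} - {j}))" for g :: idx
    using assms by (simp add: sum.remove[of D i] sum.remove[of "D - {i}" j])
  have "sum (f(i := f j, j := f i)) (D - {i} - {j}) = sum f (D - {i} - {j})"
    by (intro sum.cong) auto
  then show ?thesis unfolding *[of f] *[of "f(i := f j, j := f i)"] using assms(4) by simp
qed

lemma sum_fun_upd_off: "i \<notin> D \<Longrightarrow> sum (f(i := c)) D = sum (f :: idx) D"
  by (intro sum.cong) auto

section \<open>The two index sets, their labels and their orders\<close>

definition lbP :: "nat \<Rightarrow> idx \<Rightarrow> lab" where "lbP m f = (f ` Dneg m, - (f ` Dpos))"

definition lbS :: "nat \<Rightarrow> idx \<Rightarrow> lab" where "lbS m f = (f ` Dneg m, f ` Dpos)"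

lemma Zplus_iff: "f \<in> Zplus m \<longleftrightarrow> (\<forall>i. i \<notin> Imi m \<longrightarrow> f i = 0) \<and> sdec (Dneg m) 1 f \<and> sdec Dpos 1 f
    \<and> (\<exists>n. \<forall>i\<ge>n. f i = 1 - i)"
  by (simp add: Zplus_def sdec_def)

lemma Zsuper_iff: "f \<in> Zsuper m \<longleftrightarrow> (\<forall>i. i \<notin> Imi m \<longrightarrow> f i = 0) \<and> sdec (Dneg m) 1 f \<and> sdec Dpos (-1) f
    \<and> (\<exists>n. \<forall>i\<ge>n. f i = i)"
  by (simp add: Zsuper_def sdec_def)

definition ZZ :: "nat \<Rightarrow> int \<Rightarrow> (int \<Rightarrow> int) \<Rightarrow> idx set" where
  "ZZ m s t = {f. (\<forall>i. i \<notin> Imi m \<longrightarrow> f i = 0) \<and> sdec (Dneg m) 1 f \<and> sdec Dpos s f \<and> (\<exists>n. \<forall>i\<ge>n. f i = t i)}"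

lemma Zplus_ZZ: "Zplus m = ZZ m 1 (\<lambda>i. 1 - i)"
  by (simp add: set_eq_iff ZZ_def Zplus_iff)

lemma Zsuper_ZZ: "Zsuper m = ZZ m (-1) (\<lambda>i. i)"
  by (simp add: set_eq_iff ZZ_def Zsuper_iff)

text \<open>From position \<open>k\<close> on the prescribed tail avoids \<open>x\<close>, so the
  replacement leaves it alone.\<close>

lemma repl_ZZ:
  assumes f: "f \<in> ZZ m s t" and D: "D = Dneg m \<or> D = Dpos" and y: "y \<notin> f ` D" "y = x + 1 \<or> x = y + 1"
    and s: "s = 1 \<or> s = -1" and t: "\<forall>i\<ge>k. t i \<noteq> x"
  shows "repl D x y f \<in> ZZ m s t"
proof -
  obtain n where n: "\<forall>i\<ge>n. f i = t i" using f unfolding ZZ_def by blast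
  have "\<forall>i\<ge>max n k. repl D x y f i = t i" using n t by (auto simp: repl_def)
  moreover have "sdec (Dneg m) 1 (repl D x y f) \<and> sdec Dpos s (repl D x y f)"
    using D f y s repl_sdec[of "Dneg m" 1 f y x] repl_sdec[of Dpos s f y x]
    unfolding ZZ_def by (auto simp: sdec_repl_off)
  moreover have "\<forall>i. i \<notin> Imi m \<longrightarrow> repl D x y f i = 0"
    using f D unfolding ZZ_def by (auto simp: repl_def Imi_def)
  ultimately show ?thesis unfolding ZZ_def by blast
qed

lemma repl_Zplus:
  assumes "f \<in> Zplus m" "D = Dneg m \<or> D = Dpos" "y \<notin> f ` D" "y = x + 1 \<or> x = y + 1"
  shows "repl D x y f \<in> Zplus m"
  using assms unfolding Zplus_ZZ by (intro repl_ZZ[where k = "2 - x"]) auto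

lemma repl_Zsuper:
  assumes "f \<in> Zsuper m" "D = Dneg m \<or> D = Dpos" "y \<notin> f ` D" "y = x + 1 \<or> x = y + 1"
  shows "repl D x y f \<in> Zsuper m"
  using assms unfolding Zsuper_ZZ by (intro repl_ZZ[where k = "x + 1"]) auto

lemma seq_eqI:
  assumes "sdec (Dneg m) 1 f" "sdec (Dneg m) 1 g" "sdec Dpos s f" "sdec Dpos s g"
    "f ` Dneg m = g ` Dneg m" "f ` Dpos = g ` Dpos" "\<And>i. i \<notin> Imi m \<Longrightarrow> f i = g i" "s \<noteq> 0"
  shows "f = g"
proof
  fix i
  show "f i = g i"
    using sdec_unique[OF assms(1,2,5), of "- int m"] sdec_unique[OF assms(3,4,6), of 1] assms(7)[of i] assms(8)
    by (cases "i \<in> Dneg m"; cases "i \<in> Dpos") (auto simp: Dneg_def Dpos_def Imi_def)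
qed

lemma cond_vec_cong: "P = Q \<Longrightarrow> (Q \<Longrightarrow> u = v) \<Longrightarrow> cond_vec P u = cond_vec Q v"
  by (simp add: cond_vec_def)

text \<open>Complementing the positive values turns exponents of V-wedges into those of W-wedges:
  the map C at the level of weights.\<close>

lemma kV_Compl: "kV (- S) a = - kV S a" "kW (- S) a = kV S a"
  by (auto simp: kV_def kW_def ind_def)

lemma kW_kV: "kW S a = - kV S a"
  by (simp add: kV_def kW_def)

text \<open>A value leaves the negative half only in exchange for a larger one from the positive
  half.\<close>

lemma bruhat_sum_le:
  assumes "bruhat_step m f g"
  shows "sum f (Dneg m) \<le> sum g (Dneg m)"
proof -
  obtain i j where ij: "i \<in> Imi m" "j \<in> Imi m" "i < j" "f i < f j" and g: "g = f(i := f j, j := f i)"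
    using assms unfolding bruhat_step_def by blast
  show ?thesis
  proof (cases "j \<in> Dneg m")
    case True
    then have "i \<in> Dneg m" using ij by (auto simp: Imi_def Dneg_def Dpos_def)
    then show ?thesis unfolding g using True ij sum_fun_swap[of "Dneg m" i j f] by simp
  next
    case False
    then have "sum g (Dneg m) = sum (f(i := f j)) (Dneg m)" unfolding g by (rule sum_fun_upd_off)
    then show ?thesis using ij by (auto simp: fun_upd_def intro!: sum_mono)
  qed
qed

lemma bruhat_less_sum_le:
  assumes "bruhat_less m g f"
  shows "sum g (Dneg m) \<le> sum f (Dneg m)"
proof -
  have "(g, f) \<in> {(x, y). bruhat_step m x y}\<^sup>+" using assms by (simp add: bruhat_less_def)
  then show ?thesis
    by (induction rule: trancl_induct) (auto dest: bruhat_sum_le)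
qed

lemma super_sum_le:
  assumes "super_step m f g"
  shows "sum g (Dneg m) \<le> sum f (Dneg m)"
  using assms unfolding super_step_def
proof (elim disjE bexE conjE)
  fix i j assume g: "g = f(i := f i - 1, j := f j - 1)"
  have "g k \<le> f k" for k by (simp add: g)
  then show ?thesis by (intro sum_mono)
next
  fix i j assume ij: "i \<in> Imi m" "j \<in> Imi m" "i < j" "j < 0" and g: "g = f(i := f j, j := f i)"
  then have "i \<in> Dneg m" "j \<in> Dneg m" by (auto simp: Imi_def Dneg_def Dpos_def)
  then show ?thesis unfolding g using ij sum_fun_swap[of "Dneg m" i j f] by simp
next
  fix i j assume ij: "0 < i" "i < j" and g: "g = f(i := f j, j := f i)"
  then have "g k = f k" if "k \<in> Dneg m" for k using that by (auto simp: Dneg_def)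
  then show ?thesis by (intro sum_mono) auto
qed

lemma super_less_sum_le:
  assumes "super_less m g f"
  shows "sum g (Dneg m) \<le> sum f (Dneg m)"
proof -
  have "(f, g) \<in> {(x, y). super_step m x y}\<^sup>+" using assms by (simp add: super_less_def)
  then show ?thesis
  proof (induction rule: trancl_induct)
    case (step y z)
    then have "sum z (Dneg m) \<le> sum y (Dneg m)" by (intro super_sum_le) simp
    then show ?case using step by simp
  qed (auto dest: super_sum_le)
qed

lemma sum_image_Dneg: "sdec (Dneg m) 1 f \<Longrightarrow> \<Sum>(f ` Dneg m) = sum f (Dneg m)"
  by (simp add: sum.reindex[OF sdec_inj])

lemma inj_on_fun_upd_new:
  assumes "inj_on g D" "y \<notin> g ` (D - {p})"
  shows "inj_on (g(p := y)) D"
  using assms by (auto simp: inj_on_def)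

lemma image_fun_upd:
  assumes "inj_on g D" "p \<in> D"
  shows "g(p := y) ` D = insert y (g ` D - {g p})"
  using assms by (auto simp: inj_on_def image_iff)

text \<open>Undoing a move overwrites one entry in each half of \<open>g\<close> and gives the right
  values in possibly wrong places; sorting finishes. The intermediate functions need not be indices,
  since both orders live on all functions.\<close>

lemma sort_update:
  assumes neg: "\<And>h i j. i \<in> Dneg m \<Longrightarrow> j \<in> Dneg m \<Longrightarrow> i < j \<Longrightarrow> h i < h j \<Longrightarrow> R h (h(i := h j, j := h i))"
    and pos: "\<And>h i j. i \<in> Dpos \<Longrightarrow> j \<in> Dpos \<Longrightarrow> i < j \<Longrightarrow> s * h i < s * h j \<Longrightarrow> R h (h(i := h j, j := h i))"
    and fg: "f \<in> ZZ m s t" "g \<in> ZZ m s t" and p: "p \<in> Dneg m" "p' \<in> Dpos"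
    and x: "x \<notin> g ` Dneg m" "x' \<notin> g ` Dpos"
    and im: "f ` Dneg m = insert x (g ` Dneg m - {g p})" "f ` Dpos = insert x' (g ` Dpos - {g p'})"
  shows "R\<^sup>*\<^sup>* (g(p := x, p' := x')) f"
proof -
  define h where "h = g(p := x, p' := x')"
  have gi: "inj_on g (Dneg m)" "inj_on g Dpos" using fg(2) sdec_inj by (auto simp: ZZ_def)
  have eq: "\<And>i. i \<in> Dneg m \<Longrightarrow> h i = (g(p := x)) i" "\<And>i. i \<in> Dpos \<Longrightarrow> h i = (g(p' := x')) i"
    using p Dpos_not_Dneg[of _ m] by (auto simp: h_def)
  obtain n1 n2 where n: "\<forall>i\<ge>n1. f i = t i" "\<forall>i\<ge>n2. g i = t i" using fg unfolding ZZ_def by blast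
  have "R\<^sup>*\<^sup>* h f"
  proof (rule sort_chain[where R = R and m = m and s = s and M = "max p' (max n1 n2)", OF neg pos])
    show "h ` Dneg m = f ` Dneg m" using image_fun_upd[OF gi(1) p(1)] im(1) eq(1) by (simp cong: image_cong)
    show "h ` Dpos = f ` Dpos" using image_fun_upd[OF gi(2) p(2)] im(2) eq(2) by (simp cong: image_cong)
    show "inj_on h (Dneg m)"
      using inj_on_fun_upd_new[OF gi(1), of x p] x inj_on_cong[of "Dneg m" h "g(p := x)", OF eq(1)] by auto
    show "inj_on h Dpos"
      using inj_on_fun_upd_new[OF gi(2), of x' p'] x inj_on_cong[of Dpos h "g(p' := x')", OF eq(2)] by auto
    show "h i = f i" if "i \<notin> Imi m" for i
      using that p fg unfolding ZZ_def h_def Imi_def by auto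
    show "h i = f i" if "i > max p' (max n1 n2)" for i
      using that p n by (auto simp: h_def Dneg_def Dpos_def)
  qed (use fg in \<open>auto simp: ZZ_def\<close>)
  then show ?thesis by (simp add: h_def)
qed

lemma swp_bruhat:
  assumes f: "f \<in> Zplus m" and g: "g \<in> Zplus m" and swp: "swp (lbP m f) (lbP m g)"
  shows "bruhat_less m g f"
proof -
  obtain x y where xy: "y < x" "x \<in> f ` Dneg m" "x \<notin> f ` Dpos" "y \<notin> f ` Dneg m" "y \<in> f ` Dpos"
    and im: "g ` Dneg m = insert y (f ` Dneg m - {x})" "- (g ` Dpos) = insert y (- (f ` Dpos) - {x})"
    using swp unfolding swp_def lbP_def dset_def by auto
  have impos: "g ` Dpos = insert x (f ` Dpos - {y})" using im(2) xy by (auto simp: set_eq_iff)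
  obtain p where p: "p \<in> Dneg m" "g p = y" using im(1) by (metis imageE insertI1)
  obtain p' where p': "p' \<in> Dpos" "g p' = x" using impos by (metis imageE insertI1)
  have "(bruhat_step m)\<^sup>*\<^sup>* (g(p := x, p' := y)) f"
  proof (rule sort_update[where m = m and s = 1])
    show "bruhat_step m h (h(i := h j, j := h i))" if "i \<in> Dneg m" "j \<in> Dneg m" "i < j" "h i < h j" for h i j
      using that unfolding bruhat_step_def Imi_def by blast
    show "bruhat_step m h (h(i := h j, j := h i))" if "i \<in> Dpos" "j \<in> Dpos" "i < j" "1 * h i < 1 * h j" for h i j
      using that unfolding bruhat_step_def Imi_def by auto
  qed (use f g p p' im impos xy in \<open>auto simp: Zplus_ZZ\<close>)
  \<comment> \<open>B is a complement here, so undoing a move exchanges \<open>y\<close> in the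
    negative half with the larger \<open>x\<close> in the positive half, a single Bruhat
    step.\<close>
  moreover have "bruhat_step m g (g(p := x, p' := y))"
  proof -
    have "p < p'" using p p' by (auto simp: Dneg_def Dpos_def)
    then show ?thesis
      unfolding bruhat_step_def using p p' xy
      by (intro bexI[of _ p] bexI[of _ p']) (auto simp: Imi_def)
  qed
  ultimately have "(bruhat_step m)\<^sup>+\<^sup>+ g f" by (meson rtranclp_into_tranclp2)
  then show ?thesis by (simp add: bruhat_less_def tranclp_unfold)
qed

lemma swp_super:
  assumes f: "f \<in> Zsuper m" and g: "g \<in> Zsuper m" and swp: "swp (lbS m f) (lbS m g)"
  shows "super_less m g f"
proof -
  obtain x y where xy: "y < x" "x \<in> f ` Dneg m" "x \<in> f ` Dpos" "y \<notin> f ` Dneg m" "y \<notin> f ` Dpos"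
    and im: "g ` Dneg m = insert y (f ` Dneg m - {x})" "g ` Dpos = insert y (f ` Dpos - {x})"
    using swp unfolding swp_def lbS_def dset_def by auto
  obtain p where p: "p \<in> Dneg m" "g p = y" using im(1) by (metis imageE insertI1)
  obtain p' where p': "p' \<in> Dpos" "g p' = y" using im(2) by (metis imageE insertI1)
  have pp: "p < 0" "0 < p'" using p p' by (auto simp: Dneg_def Dpos_def)
  \<comment> \<open>Both entries climb together from \<open>y\<close> to \<open>x\<close>, with one
    reversed atypical step for each unit.\<close>
  define h where "h k = g(p := y + k, p' := y + k)" for k
  have "(\<lambda>k l. super_step m l k)\<^sup>*\<^sup>* (g(p := x, p' := x)) f"
  proof (rule sort_update[where m = m and s = "-1"])
    show "super_step m (h(i := h j, j := h i)) h" if "i \<in> Dneg m" "j \<in> Dneg m" "i < j" "h i < h j" for h i j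
      unfolding super_step_def using that
      by (intro disjI2 disjI1 bexI[of _ i] bexI[of _ j]) (auto simp: Imi_def Dneg_def)
    show "super_step m (h(i := h j, j := h i)) h" if "i \<in> Dpos" "j \<in> Dpos" "i < j" "-1 * h i < -1 * h j" for h i j
      unfolding super_step_def using that
      by (intro disjI2 bexI[of _ i] bexI[of _ j]) (auto simp: Imi_def Dpos_def)
  qed (use f g p p' im xy in \<open>auto simp: Zsuper_ZZ\<close>)
  then have "(\<lambda>k l. super_step m l k)\<^sup>*\<^sup>* (h (x - y)) f" by (simp add: h_def)
  moreover have "(\<lambda>k l. super_step m l k)\<^sup>+\<^sup>+ g (h (int (Suc k)))" for k
  proof -
    have step: "super_step m (h (int (Suc k))) (h (int k))" for k
      unfolding super_step_def using p p' pp
      by (intro disjI1 bexI[of _ p] bexI[of _ p']) (auto simp: h_def Imi_def fun_upd_twist)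
    have "h (int 0) = g" using p p' by (auto simp: h_def)
    with step[of 0] have "super_step m (h (int (Suc 0))) g" by simp
    then have base: "(\<lambda>k l. super_step m l k)\<^sup>+\<^sup>+ g (h (int (Suc 0)))"
      by (intro tranclp.r_into_trancl)
    show ?thesis
    proof (induction k)
      case (Suc k)
      show ?case
        by (rule tranclp.trancl_into_trancl[where r = "\<lambda>k l. super_step m l k", OF Suc step])
    qed (rule base)
  qed
  from this[of "nat (x - y) - 1"] have "(\<lambda>k l. super_step m l k)\<^sup>+\<^sup>+ g (h (x - y))" using xy(1) by simp
  ultimately have "(\<lambda>k l. super_step m l k)\<^sup>+\<^sup>+ g f" by simp
  then have "(super_step m)\<inverse>\<inverse>\<^sup>+\<^sup>+ g f" by (simp add: conversep_iff[abs_def])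
  then have "(super_step m)\<^sup>+\<^sup>+ f g" by (simp add: tranclp_converse)
  then show ?thesis by (simp add: super_less_def tranclp_unfold)
qed

lemma Zplus_lbP_inj: "inj_on (lbP m) (Zplus m)"
proof (rule inj_onI)
  fix f g assume fg: "f \<in> Zplus m" "g \<in> Zplus m" "lbP m f = lbP m g"
  have "f ` Dpos = g ` Dpos" using fg(3) unfolding lbP_def by (simp add: compl_eq_compl_iff)
  then show "f = g" using fg by (intro seq_eqI[where m = m and s = 1]) (auto simp: Zplus_iff lbP_def)
qed

lemma Zsuper_lbS_inj: "inj_on (lbS m) (Zsuper m)"
proof (rule inj_onI)
  fix f g assume fg: "f \<in> Zsuper m" "g \<in> Zsuper m" "lbS m f = lbS m g"
  then show "f = g" by (intro seq_eqI[where m = m and s = "-1"]) (auto simp: Zsuper_iff lbS_def)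
qed

lemma lbP_tail:
  assumes "f \<in> Zplus m"
  shows "\<exists>n. (\<forall>z < - n. z \<notin> snd (lbP m f)) \<and> (\<forall>z>n. z \<in> snd (lbP m f))"
proof -
  obtain n where n: "\<forall>i\<ge>n. f i = 1 - i" using assms unfolding Zplus_iff by blast
  have le: "f i \<le> f 1" if "i \<in> Dpos" for i
  proof -
    have "sdec Dpos (1) f" using assms by (simp add: Zplus_iff)
    from this[unfolded sdec_def, rule_format, of 1 i] that show ?thesis
      by (cases "i = 1") (auto simp: Dpos_def)
  qed
  have "z \<in> f ` Dpos" if "z < - (max (max n 0) (f 1))" for z
    using n that by (intro image_eqI[of _ _ "1 - z"]) (auto simp: Dpos_def)
  moreover have "z \<notin> f ` Dpos" if "z > max (max n 0) (f 1)" for z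
    using le that by fastforce
  ultimately show ?thesis by (intro exI[of _ "max (max n 0) (f 1)"]) (auto simp: lbP_def)
qed

lemma lbS_tail:
  assumes "f \<in> Zsuper m"
  shows "\<exists>n. (\<forall>z < - n. z \<notin> snd (lbS m f)) \<and> (\<forall>z>n. z \<in> snd (lbS m f))"
proof -
  obtain n where n: "\<forall>i\<ge>n. f i = i" using assms unfolding Zsuper_iff by blast
  have le: "f 1 \<le> f i" if "i \<in> Dpos" for i
  proof -
    have "sdec Dpos (- 1) f" using assms by (simp add: Zsuper_iff)
    from this[unfolded sdec_def, rule_format, of 1 i] that show ?thesis
      by (cases "i = 1") (auto simp: Dpos_def)
  qed
  have "z \<in> f ` Dpos" if "z > max (max n 0) (- f 1)" for z
    using n that by (intro image_eqI[of _ _ z]) (auto simp: Dpos_def)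
  moreover have "z \<notin> f ` Dpos" if "z < - (max (max n 0) (- f 1))" for z
    using le that by fastforce
  ultimately show ?thesis by (intro exI[of _ "max (max n 0) (- f 1)"]) (auto simp: lbS_def)
qed

lemma inv_mv_lbP:
  assumes "f \<in> Zplus m" "x \<in> sel c (lbP m f)" "y \<notin> sel c (lbP m f)" "y = x + 1 \<or> x = y + 1"
  shows "inv_into (Zplus m) (lbP m) (mv c x y (lbP m f)) = (if c then repl (Dneg m) x y f else repl Dpos y x f)"
    "mv c x y (lbP m f) \<in> lbP m ` Zplus m"
proof -
  define g where "g = (if c then repl (Dneg m) x y f else repl Dpos y x f)"
  have g: "g \<in> Zplus m"
    using assms by (cases c) (auto simp: g_def sel_def lbP_def intro!: repl_Zplus)
  have lb: "lbP m g = mv c x y (lbP m f)"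
    using assms by (cases c) (auto simp: g_def sel_def mv_def lbP_def repl_image repl_image_off)
  show "inv_into (Zplus m) (lbP m) (mv c x y (lbP m f)) = (if c then repl (Dneg m) x y f else repl Dpos y x f)"
    unfolding g_def[symmetric] by (intro inv_into_f_eq[OF Zplus_lbP_inj] g lb)
  show "mv c x y (lbP m f) \<in> lbP m ` Zplus m" using g lb by (metis imageI)
qed

lemma inv_mv_lbS:
  assumes "f \<in> Zsuper m" "x \<in> sel c (lbS m f)" "y \<notin> sel c (lbS m f)" "y = x + 1 \<or> x = y + 1"
  shows "inv_into (Zsuper m) (lbS m) (mv c x y (lbS m f)) = (if c then repl (Dneg m) x y f else repl Dpos x y f)"
    "mv c x y (lbS m f) \<in> lbS m ` Zsuper m"
proof -
  define g where "g = (if c then repl (Dneg m) x y f else repl Dpos x y f)"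
  have g: "g \<in> Zsuper m"
    using assms by (cases c) (auto simp: g_def sel_def lbS_def intro!: repl_Zsuper)
  have lb: "lbS m g = mv c x y (lbS m f)"
    using assms by (cases c) (auto simp: g_def sel_def mv_def lbS_def repl_image repl_image_off)
  show "inv_into (Zsuper m) (lbS m) (mv c x y (lbS m f)) = (if c then repl (Dneg m) x y f else repl Dpos x y f)"
    unfolding g_def[symmetric] by (intro inv_into_f_eq[OF Zsuper_lbS_inj] g lb)
  show "mv c x y (lbS m f) \<in> lbS m ` Zsuper m" using g lb by (metis imageI)
qed

section \<open>The two Fock spaces as instances\<close>

interpretation P: fock "Zplus m" "lbP m" "gen_plus m" "bruhat_less m" "inv_into (Zplus m) (lbP m)" for m
proof unfold_locales
  fix f g h :: idx and a :: int and c :: bool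
  show "finite (fst (lbP m f))" by (simp add: lbP_def)
  show "inj_on (lbP m) (Zplus m)" by (rule Zplus_lbP_inj)
  show "bruhat_less m h g \<Longrightarrow> bruhat_less m g f \<Longrightarrow> bruhat_less m h f"
    unfolding bruhat_less_def by (rule trancl_trans)
  assume f: "f \<in> Zplus m"
  show "\<exists>n. (\<forall>z < - n. z \<notin> snd (lbP m f)) \<and> (\<forall>z>n. z \<in> snd (lbP m f))" using f by (rule lbP_tail)
  have sets: "f ` Dneg m = fst (lbP m f)" "f ` Dpos = - snd (lbP m f)" by (auto simp: lbP_def)
  show "gen_plus m (EF c a) f =
       vadd (cond_vec (a \<in> sel c (lbP m f) \<and> a + 1 \<notin> sel c (lbP m f))
           (bvec (inv_into (Zplus m) (lbP m) (mv c a (a + 1) (lbP m f)))))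
         (cond_vec (a + 1 \<in> sel (\<not> c) (lbP m f) \<and> a \<notin> sel (\<not> c) (lbP m f))
           (vsmult (qpow (kV (sel c (lbP m f)) a)) (bvec (inv_into (Zplus m) (lbP m) (mv (\<not> c) (a + 1) a (lbP m f))))))"
  proof (cases c)
    case True
    then show ?thesis unfolding EF_def if_P[OF True] gen_plus.simps Let_def sets
      by (intro arg_cong2[where f = vadd] cond_vec_cong) (auto simp: inv_mv_lbP[OF f] sel_def)
  next
    case False
    then show ?thesis unfolding EF_def if_not_P[OF False] gen_plus.simps Let_def sets
      by (intro arg_cong2[where f = vadd] cond_vec_cong) (auto simp: inv_mv_lbP[OF f] sel_def kV_Compl)
  qed
  show "gen_plus m (K a) f = vsmult (qpow (kV (fst (lbP m f)) a + kW (snd (lbP m f)) a)) (bvec f)"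
    "gen_plus m (Kinv a) f = vsmult (qpow (- (kV (fst (lbP m f)) a + kW (snd (lbP m f)) a))) (bvec f)"
    by (simp_all add: lbP_def kV_Compl)
  assume g: "g \<in> Zplus m"
  show "swp (lbP m f) (lbP m g) \<Longrightarrow> bruhat_less m g f" using f g by (rule swp_bruhat)
  show "bruhat_less m g f \<Longrightarrow> \<Sum>(fst (lbP m g)) \<le> \<Sum>(fst (lbP m f))"
    using f g bruhat_less_sum_le by (simp add: lbP_def sum_image_Dneg Zplus_iff)
next
  fix p :: lab and x y :: int and c :: bool
  assume "p \<in> lbP m ` Zplus m"
  then show "x \<in> sel c p \<Longrightarrow> y \<notin> sel c p \<Longrightarrow> y = x + 1 \<or> x = y + 1 \<Longrightarrow> mv c x y p \<in> lbP m ` Zplus m"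
    using inv_mv_lbP(2) by blast
qed

interpretation S: fock "Zsuper m" "lbS m" "gen_super m" "super_less m" "inv_into (Zsuper m) (lbS m)" for m
proof unfold_locales
  fix f g h :: idx and a :: int and c :: bool
  show "finite (fst (lbS m f))" by (simp add: lbS_def)
  show "inj_on (lbS m) (Zsuper m)" by (rule Zsuper_lbS_inj)
  show "super_less m h g \<Longrightarrow> super_less m g f \<Longrightarrow> super_less m h f"
    unfolding super_less_def by (rule trancl_trans)
  assume f: "f \<in> Zsuper m"
  show "\<exists>n. (\<forall>z < - n. z \<notin> snd (lbS m f)) \<and> (\<forall>z>n. z \<in> snd (lbS m f))" using f by (rule lbS_tail)
  have sets: "f ` Dneg m = fst (lbS m f)" "f ` Dpos = snd (lbS m f)" by (auto simp: lbS_def)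
  show "gen_super m (EF c a) f =
       vadd (cond_vec (a \<in> sel c (lbS m f) \<and> a + 1 \<notin> sel c (lbS m f))
           (bvec (inv_into (Zsuper m) (lbS m) (mv c a (a + 1) (lbS m f)))))
         (cond_vec (a + 1 \<in> sel (\<not> c) (lbS m f) \<and> a \<notin> sel (\<not> c) (lbS m f))
           (vsmult (qpow (kV (sel c (lbS m f)) a)) (bvec (inv_into (Zsuper m) (lbS m) (mv (\<not> c) (a + 1) a (lbS m f))))))"
  proof (cases c)
    case True
    then show ?thesis unfolding EF_def if_P[OF True] gen_super.simps Let_def sets
      by (intro arg_cong2[where f = vadd] cond_vec_cong) (auto simp: inv_mv_lbS[OF f] sel_def)
  next
    case False
    then show ?thesis unfolding EF_def if_not_P[OF False] gen_super.simps Let_def sets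
      by (intro arg_cong2[where f = vadd] cond_vec_cong) (auto simp: inv_mv_lbS[OF f] sel_def kW_kV)
  qed
  show "gen_super m (K a) f = vsmult (qpow (kV (fst (lbS m f)) a + kW (snd (lbS m f)) a)) (bvec f)"
    "gen_super m (Kinv a) f = vsmult (qpow (- (kV (fst (lbS m f)) a + kW (snd (lbS m f)) a))) (bvec f)"
    by (simp_all add: lbS_def kV_Compl)
  assume g: "g \<in> Zsuper m"
  show "swp (lbS m f) (lbS m g) \<Longrightarrow> super_less m g f" using f g by (rule swp_super)
  show "super_less m g f \<Longrightarrow> \<Sum>(fst (lbS m g)) \<le> \<Sum>(fst (lbS m f))"
    using f g super_less_sum_le by (simp add: lbS_def sum_image_Dneg Zsuper_iff)
next
  fix p :: lab and x y :: int and c :: bool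
  assume "p \<in> lbS m ` Zsuper m"
  then show "x \<in> sel c p \<Longrightarrow> y \<notin> sel c p \<Longrightarrow> y = x + 1 \<or> x = y + 1 \<Longrightarrow> mv c x y p \<in> lbS m ` Zsuper m"
    using inv_mv_lbS(2) by blast
qed

section \<open>Completions and typical indices in terms of labels\<close>

lemma tail_iff_lower:
  assumes f: "f \<in> Zplus m" and n: "0 \<le> n"
  shows "(\<forall>k>n. f k = 1 - k) \<longleftrightarrow> snd (lbP m f) \<subseteq> {1 - n..}"
proof
  assume *: "\<forall>k>n. f k = 1 - k"
  show "snd (lbP m f) \<subseteq> {1 - n..}"
  proof (rule subsetI, rule ccontr)
    fix z assume z: "z \<in> snd (lbP m f)" "z \<notin> {1 - n..}"
    then have "z = f (1 - z)" using * by auto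
    then have "z \<in> f ` Dpos" using z n by (intro image_eqI[of _ _ "1 - z"]) (auto simp: Dpos_def)
    then show False using z by (simp add: lbP_def)
  qed
next
  assume *: "snd (lbP m f) \<subseteq> {1 - n..}"
  have dec: "f j < f i" if "0 < i" "i < j" for i j
    using f that unfolding Zplus_iff sdec_def by (auto simp: Dpos_def)
  obtain N where N: "\<forall>i\<ge>N. f i = 1 - i" using f unfolding Zplus_iff by blast
  show "\<forall>k>n. f k = 1 - k"
  proof (intro allI impI)
    fix k assume "n < k"
    then show "f k = 1 - k"
    \<comment> \<open>Downwards from the known tail: \<open>1 - k\<close> is a value of
      \<open>f\<close>, and the next value together with monotonicity leaves only position
      \<open>k\<close> for it.\<close>
    proof (induction "nat (N - k)" arbitrary: k rule: less_induct)
      case less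
      show ?case
      proof (cases "N \<le> k")
        case False
        then have nxt: "f (k + 1) = - k" using less by simp
        have "1 - k \<notin> snd (lbP m f)" using * less.prems by auto
        then obtain j where j: "j \<in> Dpos" "f j = 1 - k" by (auto simp: lbP_def)
        have "\<not> k + 1 < j" using dec[of "k + 1" j] nxt j less.prems n by auto
        moreover have "j \<noteq> k + 1" using nxt j by auto
        moreover have "\<not> j < k"
        proof
          assume "j < k"
          then have "f k < 1 - k" using dec[of j k] j by (auto simp: Dpos_def)
          moreover have "f (k + 1) < f k" using dec[of k "k + 1"] less.prems n by auto
          ultimately show False using nxt by simp
        qed
        ultimately have "j = k" by simp
        then show ?thesis using j by simp
      qed (use N in simp)
    qed
  qed
qed

lemma Ehat_plus_eq: "Ehat_plus m = P.Eh m"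
proof -
  have "(\<forall>n::nat. finite {f. u f \<noteq> 0 \<and> (\<forall>k > int n. f k = 1 - k)}) \<longleftrightarrow>
      (\<forall>d::nat. finite {f. u f \<noteq> 0 \<and> P.low m d f})" if "\<forall>f. u f \<noteq> 0 \<longrightarrow> f \<in> Zplus m" for u :: vec
  proof
    assume *: "\<forall>n::nat. finite {f. u f \<noteq> 0 \<and> (\<forall>k > int n. f k = 1 - k)}"
    show "\<forall>d::nat. finite {f. u f \<noteq> 0 \<and> P.low m d f}"
    proof
      fix d :: nat
      \<comment> \<open>The tail condition for \<open>n\<close> is the lower bound
        \<open>1 - n\<close>, so the bound \<open>- d\<close> corresponds to
        \<open>n = Suc d\<close>.\<close>
      have "{f. u f \<noteq> 0 \<and> P.low m d f} = {f. u f \<noteq> 0 \<and> (\<forall>k > int (Suc d). f k = 1 - k)}"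
      proof (intro Collect_cong conj_cong refl)
        fix f assume "u f \<noteq> 0"
        then have "f \<in> Zplus m" using that by blast
        from tail_iff_lower[OF this, of "int (Suc d)"]
        show "P.low m d f \<longleftrightarrow> (\<forall>k > int (Suc d). f k = 1 - k)"
          by simp
      qed
      then show "finite {f. u f \<noteq> 0 \<and> P.low m d f}"
        using *[rule_format, of "Suc d"] by (simp only:)
    qed
  next
    assume *: "\<forall>d::nat. finite {f. u f \<noteq> 0 \<and> P.low m d f}"
    show "\<forall>n::nat. finite {f. u f \<noteq> 0 \<and> (\<forall>k > int n. f k = 1 - k)}"
    proof
      fix n :: nat
      have "{f. u f \<noteq> 0 \<and> (\<forall>k > int n. f k = 1 - k)} \<subseteq> {f. u f \<noteq> 0 \<and> P.low m n f}"
      proof (intro Collect_mono impI conjI)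
        fix f assume f: "u f \<noteq> 0 \<and> (\<forall>k > int n. f k = 1 - k)"
        then show "u f \<noteq> 0" by blast
        then have "f \<in> Zplus m" using that by blast
        from tail_iff_lower[OF this, of "int n"] f
        have "snd (lbP m f) \<subseteq> {1 - int n..}" by (metis of_nat_0_le_iff)
        then show "P.low m n f" by auto
      qed
      then show "finite {f. u f \<noteq> 0 \<and> (\<forall>k > int n. f k = 1 - k)}"
        using *[rule_format, of n] by (rule finite_subset)
    qed
  qed
  then show ?thesis unfolding Ehat_plus_def P.Eh_def by blast
qed

lemma Ehat_super_eq: "Ehat_super m = S.Eh m"
proof -
  have "(\<forall>i > 0. f i \<ge> - d) \<longleftrightarrow> snd (lbS m f) \<subseteq> {- d..}" for f :: idx and d
    by (auto simp: lbS_def Dpos_def image_subset_iff)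
  then show ?thesis unfolding Ehat_super_def S.Eh_def by simp
qed

lemma typical_iff: "typical m f \<longleftrightarrow> f \<in> Zsuper m \<and> dset (lbS m f) = {}"
  by (simp add: typical_def lbS_def dset_def)

text \<open>A step permutes positions, so every value keeps its multiplicity.\<close>

lemma bruhat_step_fibre:
  assumes "bruhat_step m f g"
  shows "card {i \<in> Imi m. g i = v} = card {i \<in> Imi m. f i = v}"
proof -
  obtain i j where ij: "i \<in> Imi m" "j \<in> Imi m" "i < j" and g: "g = f(i := f j, j := f i)"
    using assms unfolding bruhat_step_def by blast
  define t where "t k = (if k = i then j else if k = j then i else k)" for k
  have t: "t (t k) = k" "g k = f (t k)" "k \<in> Imi m \<Longrightarrow> t k \<in> Imi m" for k
    using ij by (auto simp: t_def g)
  have "bij_betw t {i \<in> Imi m. g i = v} {i \<in> Imi m. f i = v}"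
    by (rule bij_betw_byWitness[where f' = t]) (use t in auto)
  then show ?thesis by (rule bij_betw_same_card)
qed

text \<open>Lexicographic growth persists along chains and makes the Bruhat order
  irreflexive.\<close>

lemma bruhat_step_lex:
  assumes "bruhat_step m f g"
  shows "\<exists>i\<in>Imi m. f i < g i \<and> (\<forall>k\<in>Imi m. k < i \<longrightarrow> f k = g k)"
proof -
  obtain i j where "i \<in> Imi m" "i < j" "f i < f j" "g = f(i := f j, j := f i)"
    using assms unfolding bruhat_step_def by blast
  then show ?thesis by (intro bexI[of _ i]) auto
qed

lemma bruhat_less_lex:
  assumes "bruhat_less m f g"
  shows "\<exists>i\<in>Imi m. f i < g i \<and> (\<forall>k\<in>Imi m. k < i \<longrightarrow> f k = g k)"
proof -
  have "(f, g) \<in> {(x, y). bruhat_step m x y}\<^sup>+" using assms by (simp add: bruhat_less_def)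
  then show ?thesis
  proof (induction rule: trancl_induct)
    case (step g h)
    obtain i where i: "i \<in> Imi m" "f i < g i" "\<forall>k\<in>Imi m. k < i \<longrightarrow> f k = g k" using step.IH by blast
    obtain j where j: "j \<in> Imi m" "g j < h j" "\<forall>k\<in>Imi m. k < j \<longrightarrow> g k = h k"
      using bruhat_step_lex step.hyps(2) by blast
    show ?case
    proof (cases "i \<le> j")
      case True
      then have "g i \<le> h i" using i j by (cases "i = j") auto
      then show ?thesis using i j True by (intro bexI[of _ i]) auto
    next
      case False
      then show ?thesis using i j by (intro bexI[of _ j]) auto
    qed
  qed (use bruhat_step_lex in blast)
qed

lemma fibre_Zplus:
  assumes "f \<in> Zplus m"
  shows "card {i \<in> Imi m. f i = v} = (if v \<in> f ` Dneg m then 1 else 0) + (if v \<in> f ` Dpos then 1 else 0)"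
proof -
  have one: "card {i \<in> D. f i = v} = (if v \<in> f ` D then 1 else 0) \<and> finite {i \<in> D. f i = v}" if "inj_on f D" for D
  proof (cases "v \<in> f ` D")
    case True
    then obtain i where "i \<in> D" "f i = v" by blast
    then have "{i \<in> D. f i = v} = {i}" using that by (auto dest: inj_onD)
    then show ?thesis using True by simp
  next
    case False
    then have "{i \<in> D. f i = v} = {}" by auto
    then show ?thesis using False by (simp only: card.empty finite.emptyI if_False)
  qed
  have inj: "inj_on f (Dneg m)" "inj_on f Dpos" using assms sdec_inj by (auto simp: Zplus_iff)
  have "{i \<in> Imi m. f i = v} = {i \<in> Dneg m. f i = v} \<union> {i \<in> Dpos. f i = v}" by (auto simp: Imi_def)
  moreover have "{i \<in> Dneg m. f i = v} \<inter> {i \<in> Dpos. f i = v} = {}" using Dneg_Dpos[of m] by blast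
  ultimately show ?thesis using one[OF inj(1)] one[OF inj(2)] by (simp add: card_Un_disjoint)
qed

text \<open>If A and B meet, a pair can be moved to an empty place far left. If not, A consists
  exactly of the values of multiplicity two, so an index below \<open>f\<close> has the same label
  and equals \<open>f\<close>, against irreflexivity.\<close>

lemma J_typical_iff: "J_typical m f \<longleftrightarrow> f \<in> Zplus m \<and> dset (lbP m f) = {}"
proof (intro iffI conjI)
  assume "J_typical m f"
  then show f: "f \<in> Zplus m" by (simp add: J_typical_def)
  show "dset (lbP m f) = {}"
  proof (rule ccontr)
    assume "dset (lbP m f) \<noteq> {}"
    then obtain x where x: "x \<in> dset (lbP m f)" by blast
    obtain n where n: "adm n (lbP m f) (lbP m f)" using P.ex_adm[OF f f] .
    define y where "y = min x (- n) - 1"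
    have "y < - n" "y < x" by (auto simp: y_def)
    then have "swp (lbP m f) (insert y (fst (lbP m f) - {x}), insert y (snd (lbP m f) - {x}))"
      using x n by (auto simp: swp_def adm_def site_def)
    then obtain g where "g \<in> Zplus m" "swp (lbP m f) (lbP m g)"
      using P.swp_closed f by (metis imageE imageI)
    then show False using \<open>J_typical m f\<close> swp_bruhat[OF f] by (auto simp: J_typical_def)
  qed
next
  assume f: "f \<in> Zplus m \<and> dset (lbP m f) = {}"
  have "\<not> bruhat_less m g f" if g: "g \<in> Zplus m" for g
  proof
    assume less: "bruhat_less m g f"
    then have "(g, f) \<in> {(x, y). bruhat_step m x y}\<^sup>+" by (simp add: bruhat_less_def)
    then have fib: "card {i \<in> Imi m. f i = v} = card {i \<in> Imi m. g i = v}" for v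
      by (induction rule: trancl_induct) (auto simp: bruhat_step_fibre)
    have eq: "(if v \<in> f ` Dneg m then 1 else 0) + (if v \<in> f ` Dpos then 1 else 0)
        = (if v \<in> g ` Dneg m then 1 else 0) + (if v \<in> g ` Dpos then 1 else (0::nat))" for v
      using fib[of v] fibre_Zplus[of f m v] fibre_Zplus[OF g, of v] f by simp
    have sub: "f ` Dneg m \<subseteq> f ` Dpos" using f by (auto simp: lbP_def dset_def)
    have "f ` Dneg m \<subseteq> g ` Dneg m"
    proof
      fix v assume "v \<in> f ` Dneg m"
      then show "v \<in> g ` Dneg m" using eq[of v] sub by (auto split: if_splits)
    qed
    moreover have "card (f ` Dneg m) = card (g ` Dneg m)"
    proof -
      have "inj_on f (Dneg m)" "inj_on g (Dneg m)" using f g sdec_inj unfolding Zplus_iff by blast+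
      then show ?thesis by (simp add: card_image)
    qed
    ultimately have neg: "f ` Dneg m = g ` Dneg m" by (intro card_subset_eq) auto
    have "f ` Dpos = g ` Dpos"
    proof (rule set_eqI)
      fix v
      show "v \<in> f ` Dpos \<longleftrightarrow> v \<in> g ` Dpos" using eq[of v] neg by (auto split: if_splits)
    qed
    then have "lbP m f = lbP m g" using neg by (simp add: lbP_def)
    then have "f = g" using Zplus_lbP_inj f g by (auto dest: inj_onD)
    then show False using bruhat_less_lex[OF less] by auto
  qed
  then show "J_typical m f" using f by (simp add: J_typical_def)
qed

lemma bar_plus_eq: "bar_plus m = P.psi m"
proof -
  have "is_bar_plus m = P.is_bar m"
    by (rule ext) (simp add: is_bar_plus_def P.is_bar_def Ehat_plus_eq J_typical_iff act_plus_def imp_conjL Ball_def)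
  then show ?thesis by (simp add: bar_plus_def P.The_is_bar)
qed

lemma bar_super_eq: "bar_super m = S.psi m"
proof -
  have "is_bar_super m = S.is_bar m"
    by (rule ext) (simp add: is_bar_super_def S.is_bar_def Ehat_super_eq typical_iff act_super_def imp_conjL Ball_def)
  then show ?thesis by (simp add: bar_super_def S.The_is_bar)
qed

lemma canonical_eqs:
  "U_plus m f = (THE x. P.canonical m in_qZq f x)"
  "L_plus m f = (THE x. P.canonical m in_qinvZqinv f x)"
  "U_super m f = (THE x. S.canonical m in_qZq f x)"
  "L_super m f = (THE x. S.canonical m in_qinvZqinv f x)"
  by (simp_all add: U_plus_def L_plus_def U_super_def L_super_def P.canonical_def S.canonical_def
      Ehat_plus_eq Ehat_super_eq bar_plus_eq bar_super_eq)

section \<open>The isomorphism\<close>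

lemma initial_segment:
  fixes S :: "nat set"
  assumes "finite S" "0 \<notin> S" and down: "\<And>k l. k \<in> S \<Longrightarrow> 1 \<le> l \<Longrightarrow> l \<le> k \<Longrightarrow> l \<in> S"
  shows "S = {1..card S}"
proof (cases "S = {}")
  case False
  have "S = {1..Max S}"
  proof (intro equalityI subsetI)
    fix k assume "k \<in> S"
    then show "k \<in> {1..Max S}" using assms(1,2) by (cases k) auto
  next
    fix k assume "k \<in> {1..Max S}"
    then show "k \<in> S" using down[of "Max S" k] assms(1) False by auto
  qed
  then show ?thesis by (metis card_atLeastAtMost diff_Suc_1)
qed simp

context
  fixes f :: idx and n :: int
  assumes dec: "sdec Dpos 1 f" and ev: "\<And>i. n \<le> i \<Longrightarrow> f i = 1 - i"
begin

lemma seq_step: "1 \<le> i \<Longrightarrow> i \<le> j \<Longrightarrow> f j + j \<le> f i + i"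
proof (induction "nat (j - i)" arbitrary: j)
  case (Suc d)
  have "f j < f (j - 1)"
    using dec[unfolded sdec_def, rule_format, of "j - 1" j] Suc by (auto simp: Dpos_def)
  moreover have "f (j - 1) + (j - 1) \<le> f i + i" using Suc by (intro Suc.hyps) auto
  ultimately show ?case by simp
qed simp

lemma seq_lower: "1 \<le> i \<Longrightarrow> 1 - i \<le> f i"
  using seq_step[of i "max i n"] ev[of "max i n"] by simp

text \<open>Both sides say that the box in row \<open>k\<close> and column \<open>i\<close> lies in
  the Young diagram. The column lengths are handled through this equivalence below.\<close>

lemma le_conj_part_iff:
  assumes "1 \<le> i" "1 \<le> k"
  shows "int k \<le> conj_part f i \<longleftrightarrow> i \<le> part_of f k"
proof -
  define S where "S = {k::nat. 1 \<le> k \<and> part_of f k \<ge> i}"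
  have "k \<le> nat n" if "k \<in> S" for k
  proof (rule ccontr)
    assume "\<not> k \<le> nat n"
    then have "part_of f k = 0" using ev[of "int k"] by (simp add: part_of_def)
    then show False using that assms(1) by (simp add: S_def)
  qed
  then have "finite S" by (meson finite_nat_set_iff_bounded_le)
  moreover have "l \<in> S" if "k \<in> S" "1 \<le> l" "l \<le> k" for k l
    using that seq_step[of "int l" "int k"] by (simp add: S_def part_of_def)
  ultimately have "S = {1..card S}" by (intro initial_segment) (auto simp: S_def)
  moreover have "k \<in> S \<longleftrightarrow> i \<le> part_of f k" using assms(2) by (simp add: S_def)
  moreover have "k \<in> {1..card S} \<longleftrightarrow> k \<le> card S" using assms(2) by simp
  ultimately show ?thesis unfolding conj_part_def S_def by simp
qed

lemma conj_part_nonneg: "0 \<le> conj_part f i"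
  by (simp add: conj_part_def)

lemma conj_part_antimono:
  assumes "1 \<le> i" "i \<le> j"
  shows "conj_part f j \<le> conj_part f i"
proof (cases "conj_part f j = 0")
  case False
  obtain k where k: "conj_part f j = int k" using conj_part_nonneg by (rule nonneg_int_cases)
  then show ?thesis using le_conj_part_iff[of j k] le_conj_part_iff[of i k] assms False by simp
qed (simp add: conj_part_nonneg)

lemma conj_part_eventually:
  assumes "1 \<le> i" "f 1 < i"
  shows "conj_part f i = 0"
  using le_conj_part_iff[of i 1] conj_part_nonneg[of i] assms by (simp add: part_of_def)

text \<open>The classical fact on Maya diagrams: boundary steps of the Young diagram are numbered by
  the integers, rows taking one part of them and columns the complementary part.\<close>

lemma image_conj_part: "(\<lambda>i. i - conj_part f i) ` Dpos = - (f ` Dpos)"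
proof (intro equalityI subsetI)
  fix z assume "z \<in> (\<lambda>i. i - conj_part f i) ` Dpos"
  then obtain i where i: "1 \<le> i" "z = i - conj_part f i" by (auto simp: Dpos_def)
  show "z \<in> - (f ` Dpos)"
  proof
    assume "z \<in> f ` Dpos"
    then obtain j where j: "1 \<le> j" "z = f j" by (auto simp: Dpos_def)
    then have "int (nat j) \<le> conj_part f i \<longleftrightarrow> i \<le> part_of f (nat j)" using i by (intro le_conj_part_iff) auto
    then show False using i j by (auto simp: part_of_def)
  qed
next
  fix z assume z: "z \<in> - (f ` Dpos)"
  \<comment> \<open>\<open>k\<close> is the first row whose value falls below \<open>z\<close>, so
    \<open>k - 1\<close> rows lie above the gap. The column through the gap should have this length,
    which dictates \<open>i\<close>.\<close>
  define k where "k = (LEAST k::nat. 1 \<le> k \<and> f (int k) < z)"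
  have ex: "1 \<le> nat (max (max n 1) (2 - z)) \<and> f (int (nat (max (max n 1) (2 - z)))) < z"
    using ev[of "max (max n 1) (2 - z)"] by auto
  have k: "1 \<le> k" "f (int k) < z"
    using LeastI[where P = "\<lambda>k. 1 \<le> k \<and> f (int k) < z", OF ex] by (simp_all add: k_def)
  have least: "k \<le> l" if "1 \<le> l" "f (int l) < z" for l
    unfolding k_def using that by (intro Least_le) simp
  define i where "i = z + int k - 1"
  have i: "1 \<le> i" using seq_lower[of "int k"] k by (simp add: i_def)
  have "\<not> int k \<le> conj_part f i"
    using le_conj_part_iff[OF i k(1)] k by (simp add: part_of_def i_def)
  moreover have "int (k - 1) \<le> conj_part f i"
  proof (cases "k = 1")
    case False
    then have k1: "1 \<le> k - 1" using k by simp
    then have "\<not> f (int (k - 1)) < z" using least[of "k - 1"] by auto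
    moreover have "f (int (k - 1)) \<noteq> z" using z k1 by (auto simp: Dpos_def)
    ultimately have "i \<le> part_of f (k - 1)" using k by (simp add: part_of_def i_def of_nat_diff)
    then show ?thesis using le_conj_part_iff[OF i k1] by simp
  qed (simp add: conj_part_nonneg)
  ultimately have "conj_part f i = int k - 1" using k by (simp add: of_nat_diff)
  then have "z = i - conj_part f i" by (simp add: i_def)
  then show "z \<in> (\<lambda>i. i - conj_part f i) ` Dpos" using i by (auto simp: Dpos_def)
qed

end

lemma
  assumes f: "f \<in> Zplus m"
  shows C_idx_Zsuper: "C_idx m f \<in> Zsuper m" and lbS_C_idx: "lbS m (C_idx m f) = lbP m f"
proof -
  obtain n where n: "\<And>i. n \<le> i \<Longrightarrow> f i = 1 - i" and dec: "sdec Dpos 1 f"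
    using f unfolding Zplus_iff by blast
  have pos: "C_idx m f i = i - conj_part f i" if "i \<in> Dpos" for i
    using that Dpos_not_Dneg by (simp add: C_idx_def)
  have neg: "C_idx m f i = f i" if "i \<in> Dneg m" for i using that by (simp add: C_idx_def)
  have "sdec Dpos (-1) (C_idx m f)"
    unfolding sdec_def
  proof (intro ballI impI)
    fix i j assume "i \<in> Dpos" "j \<in> Dpos" "i < j"
    then show "- 1 * C_idx m f j < - 1 * C_idx m f i"
      using conj_part_antimono[of f n i j, OF dec n] by (simp add: pos) (simp add: Dpos_def)
  qed
  moreover have "sdec (Dneg m) 1 (C_idx m f)" using f neg by (simp add: Zplus_iff sdec_def)
  moreover have "\<forall>i. i \<notin> Imi m \<longrightarrow> C_idx m f i = 0" by (simp add: C_idx_def Imi_def)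
  moreover have "\<forall>i \<ge> max 1 (f 1 + 1). C_idx m f i = i"
    using conj_part_eventually[of f n, OF dec n] pos by (auto simp: Dpos_def)
  ultimately show "C_idx m f \<in> Zsuper m" unfolding Zsuper_iff by blast
  have "C_idx m f ` Dpos = - (f ` Dpos)"
    using image_conj_part[of f n, OF dec n] pos by (metis (mono_tags, lifting) image_cong)
  moreover have "C_idx m f ` Dneg m = f ` Dneg m" using neg by (intro image_cong) auto
  ultimately show "lbS m (C_idx m f) = lbP m f" by (simp add: lbS_def lbP_def)
qed

lemma nth_incr_image:
  assumes "sdec Dpos (-1) g" "i \<in> Dpos"
  shows "nth_incr (g ` Dpos) i = g i"
proof -
  have mono: "g j < g k \<longleftrightarrow> j < k" if "j \<in> Dpos" "k \<in> Dpos" for j k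
    using assms(1)[unfolded sdec_def, rule_format, of j k] assms(1)[unfolded sdec_def, rule_format, of k j] that
    by (cases j k rule: linorder_cases) auto
  have card: "int (card {y \<in> g ` Dpos. y < g k}) = k - 1" if "k \<in> Dpos" for k
  proof -
    have "{y \<in> g ` Dpos. y < g k} = g ` {1..<k}" using mono that by (auto simp: Dpos_def)
    moreover have "inj_on g {1..<k}"
      using sdec_inj[OF assms(1)] by (rule inj_on_subset) (auto simp: Dpos_def)
    ultimately show ?thesis using that by (simp add: card_image Dpos_def)
  qed
  show ?thesis
    unfolding nth_incr_def using card assms(2) by (intro the_equality) auto
qed

text \<open>The sequence \<open>i - conj_part f i\<close> is increasing and has the complement as
  its set of values, so it is the enumeration.\<close>

lemma nat_idx_eq_C_idx:
  assumes "f \<in> Zplus m"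
  shows "nat_idx m f = C_idx m f"
proof
  fix i
  have im: "- (f ` Dpos) = C_idx m f ` Dpos" using lbS_C_idx[OF assms] by (simp add: lbS_def lbP_def)
  have "sdec Dpos (-1) (C_idx m f)" using C_idx_Zsuper[OF assms] by (simp add: Zsuper_iff)
  then show "nat_idx m f i = C_idx m f i"
    using nth_incr_image[of "C_idx m f" i] by (simp add: nat_idx_def im) (simp add: C_idx_def)
qed

text \<open>The reflection \<open>x \<mapsto> 1 - x\<close> exchanges the two kinds of sequences, so that
  conjugating with it inverts \<open>C_idx\<close>.\<close>

lemma C_idx_bij: "bij_betw (C_idx m) (Zplus m) (Zsuper m)"
  unfolding bij_betw_def
proof
  show inj: "inj_on (C_idx m) (Zplus m)"
    using lbS_C_idx Zplus_lbP_inj by (metis inj_on_def)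
  define fl where "fl g = (\<lambda>i. if i \<in> Dneg m then g i else if i \<in> Dpos then 1 - g i else (0::int))" for g
  have fl: "fl g ` Dpos = (\<lambda>x. 1 - x) ` g ` Dpos" "fl g ` Dneg m = g ` Dneg m" for g
    using Dpos_not_Dneg[of _ m] by (auto simp: fl_def image_image intro!: image_cong)
  have fl_Zplus: "fl g \<in> Zplus m" if g: "g \<in> Zsuper m" for g
  proof -
    obtain n where n: "\<forall>i\<ge>n. g i = i" using g unfolding Zsuper_iff by blast
    have "\<forall>i\<ge>max n 1. fl g i = 1 - i" using n by (auto simp: fl_def Dneg_def Dpos_def)
    moreover have "sdec Dpos 1 (fl g)" "sdec (Dneg m) 1 (fl g)"
      using g Dpos_not_Dneg[of _ m] by (auto simp: Zsuper_iff sdec_def fl_def)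
    moreover have "\<forall>i. i \<notin> Imi m \<longrightarrow> fl g i = 0" by (simp add: fl_def Imi_def)
    ultimately show ?thesis unfolding Zplus_iff by blast
  qed
  show "C_idx m ` Zplus m = Zsuper m"
  proof (intro equalityI subsetI)
    fix g assume g: "g \<in> Zsuper m"
    \<comment> \<open>Reflection turns B into its mirror image, \<open>C_idx\<close> complements it,
      and the second reflection gives the complement of B; \<open>lbP\<close> complements once more
      and returns B.\<close>
    define f where "f = fl (C_idx m (fl g))"
    have f: "f \<in> Zplus m" unfolding f_def using g by (intro fl_Zplus C_idx_Zsuper)
    have refl: "(\<lambda>x. 1 - x) ` (- S) = - ((\<lambda>x. 1 - x) ` S)" for S :: "int set"
    proof -
      have "bij (\<lambda>x::int. 1 - x)" by (rule bij_betw_byWitness[where f' = "\<lambda>x. 1 - x"]) auto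
      then show ?thesis by (rule bij_image_Compl_eq)
    qed
    have "lbS m (C_idx m (fl g)) = lbP m (fl g)" using fl_Zplus[OF g] by (rule lbS_C_idx)
    then have "C_idx m (fl g) ` Dpos = - ((\<lambda>x. 1 - x) ` g ` Dpos)" "C_idx m (fl g) ` Dneg m = g ` Dneg m"
      by (simp_all add: lbS_def lbP_def fl)
    then have "lbP m f = lbS m g"
      by (simp add: f_def lbP_def lbS_def fl refl image_image)
    then have "lbS m (C_idx m f) = lbS m g" using lbS_C_idx[OF f] by simp
    then have "C_idx m f = g" using Zsuper_lbS_inj g C_idx_Zsuper[OF f] by (auto dest: inj_onD)
    then show "g \<in> C_idx m ` Zplus m" using f by blast
  qed (auto simp: C_idx_Zsuper)
qed

lemma Zsuper_obtain:
  assumes "g \<in> Zsuper m"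
  obtains f where "f \<in> Zplus m" "g = C_idx m f"
  using assms C_idx_bij[of m] by (auto simp: bij_betw_def)

lemma C_idx_eq_iff: "f \<in> Zplus m \<Longrightarrow> g \<in> Zplus m \<Longrightarrow> C_idx m f = C_idx m g \<longleftrightarrow> f = g"
  using C_idx_bij[of m] by (auto simp: bij_betw_def dest: inj_onD)

section \<open>Transport of vectors, matrices and bases\<close>

lemma natural_map_C_idx:
  assumes "f \<in> Zplus m"
  shows "natural_map m u (C_idx m f) = u f"
proof -
  have "{k \<in> Zplus m. u k \<noteq> 0 \<and> C_idx m k = C_idx m f} = (if u f = 0 then {} else {f})"
    using assms by (auto simp: C_idx_eq_iff)
  then show ?thesis by (simp add: natural_map_def)
qed

lemma natural_map_off: "g \<notin> Zsuper m \<Longrightarrow> natural_map m u g = 0"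
proof -
  assume "g \<notin> Zsuper m"
  then have "{f \<in> Zplus m. u f \<noteq> 0 \<and> C_idx m f = g} = {}" using C_idx_Zsuper by blast
  then show ?thesis by (simp only: natural_map_def sum.empty)
qed

lemma natural_map_eqI:
  assumes "\<And>f. f \<in> Zplus m \<Longrightarrow> v (C_idx m f) = u f" "\<And>g. g \<notin> Zsuper m \<Longrightarrow> v g = 0"
  shows "natural_map m u = v"
proof
  fix g
  show "natural_map m u g = v g"
    using assms natural_map_C_idx natural_map_off by (cases "g \<in> Zsuper m") (metis Zsuper_obtain, metis)
qed

text \<open>Reindexing along the bijection \<open>C_idx\<close>: matrices with equal entries at
  corresponding indices define intertwined maps. Both the generators and the bar involutions are
  treated in this way.\<close>

lemma natural_map_ext:
  assumes supp: "\<And>f. u f \<noteq> 0 \<Longrightarrow> f \<in> Zplus m"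
    and M: "\<And>f g. f \<in> Zplus m \<Longrightarrow> g \<in> Zplus m \<Longrightarrow> M' (C_idx m f) (C_idx m g) = M f g"
    and M': "\<And>f g. f \<in> Zplus m \<Longrightarrow> g \<notin> Zsuper m \<Longrightarrow> M' (C_idx m f) g = 0"
  shows "natural_map m (ext M u) = ext M' (natural_map m u)"
proof (rule natural_map_eqI)
  fix g assume g: "g \<in> Zplus m"
  let ?A = "{f. u f \<noteq> 0 \<and> M f g \<noteq> 0}"
  have A: "{k. natural_map m u k \<noteq> 0 \<and> M' k (C_idx m g) \<noteq> 0} = C_idx m ` ?A"
  proof (intro equalityI subsetI)
    fix k assume k: "k \<in> {k. natural_map m u k \<noteq> 0 \<and> M' k (C_idx m g) \<noteq> 0}"
    then have "k \<in> Zsuper m" using natural_map_off by blast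
    then obtain f where "f \<in> Zplus m" "k = C_idx m f" by (rule Zsuper_obtain)
    then show "k \<in> C_idx m ` ?A" using k g M natural_map_C_idx by auto
  next
    fix k assume "k \<in> C_idx m ` ?A"
    then obtain f where "u f \<noteq> 0" "M f g \<noteq> 0" "k = C_idx m f" by blast
    then show "k \<in> {k. natural_map m u k \<noteq> 0 \<and> M' k (C_idx m g) \<noteq> 0}"
      using supp[of f] g M natural_map_C_idx[of f m u] by simp
  qed
  have inj: "inj_on (C_idx m) ?A" using supp by (auto simp: inj_on_def C_idx_eq_iff)
  show "ext M' (natural_map m u) (C_idx m g) = ext M u g"
    unfolding ext_def A sum.reindex[OF inj] o_def
    using supp g M natural_map_C_idx by (intro sum.cong) auto
next
  fix g assume g: "g \<notin> Zsuper m"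
  have "M' k g = 0" if "natural_map m u k \<noteq> 0" for k
  proof -
    have "k \<in> Zsuper m" using that natural_map_off by blast
    then obtain f where "f \<in> Zplus m" "k = C_idx m f" by (rule Zsuper_obtain)
    then show ?thesis using M' g by simp
  qed
  then have "{k. natural_map m u k \<noteq> 0 \<and> M' k g \<noteq> 0} = {}" by blast
  then show "ext M' (natural_map m u) g = 0" by (simp only: ext_def sum.empty)
qed

lemma natural_map_Eh:
  assumes u: "u \<in> P.Eh m"
  shows "natural_map m u \<in> S.Eh m"
proof (rule S.EhI)
  show "g \<in> Zsuper m" if "natural_map m u g \<noteq> 0" for g using that natural_map_off by blast
  fix d :: nat
  have "{g. natural_map m u g \<noteq> 0 \<and> S.low m d g}
      \<subseteq> C_idx m ` {f. u f \<noteq> 0 \<and> P.low m d f}"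
  proof
    fix g assume g: "g \<in> {g. natural_map m u g \<noteq> 0 \<and> S.low m d g}"
    then have "g \<in> Zsuper m" using natural_map_off by blast
    then obtain f where "f \<in> Zplus m" "g = C_idx m f" by (rule Zsuper_obtain)
    then show "g \<in> C_idx m ` {f. u f \<noteq> 0 \<and> P.low m d f}"
      using g by (simp add: natural_map_C_idx lbS_C_idx)
  qed
  then show "finite {g. natural_map m u g \<noteq> 0 \<and> S.low m d g}"
    using P.Eh_finite[OF u] by (meson finite_imageI finite_subset)
qed

lemma natural_map_surj:
  assumes v: "v \<in> S.Eh m"
  shows "\<exists>u \<in> P.Eh m. natural_map m u = v"
proof
  define u where "u f = (if f \<in> Zplus m then v (C_idx m f) else 0)" for f
  show "natural_map m u = v"
    using S.Eh_0[OF v] by (intro natural_map_eqI) (auto simp: u_def)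
  show "u \<in> P.Eh m"
  proof (rule P.EhI)
    show "f \<in> Zplus m" if "u f \<noteq> 0" for f using that by (simp add: u_def split: if_splits)
    fix d :: nat
    let ?A = "{f. u f \<noteq> 0 \<and> P.low m d f}"
    have "C_idx m ` ?A \<subseteq> {g. v g \<noteq> 0 \<and> S.low m d g}"
      by (auto simp: u_def lbS_C_idx split: if_splits)
    then have "finite (C_idx m ` ?A)" using S.Eh_finite[OF v] by (rule finite_subset)
    moreover have "inj_on (C_idx m) ?A"
      using C_idx_bij[of m] unfolding bij_betw_def by (elim conjE inj_on_subset) (auto simp: u_def split: if_splits)
    ultimately show "finite ?A" by (rule finite_imageD)
  qed
qed

lemma natural_map_inj: "inj_on (natural_map m) (P.Eh m)"
proof (rule inj_onI)
  fix u v assume uv: "u \<in> P.Eh m" "v \<in> P.Eh m" "natural_map m u = natural_map m v"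
  show "u = v"
  proof
    fix f
    show "u f = v f"
      using uv natural_map_C_idx[of f m u] natural_map_C_idx[of f m v] P.Eh_0
      by (cases "f \<in> Zplus m") metis+
  qed
qed

lemma natural_map_bvec:
  assumes f: "f \<in> Zplus m"
  shows "natural_map m (bvec f) = bvec (C_idx m f)"
  using f C_idx_Zsuper[OF f] by (intro natural_map_eqI) (auto simp: bvec_apply C_idx_eq_iff)

lemma inv_lbS:
  assumes "p \<in> lbP m ` Zplus m"
  shows "inv_into (Zsuper m) (lbS m) p = C_idx m (inv_into (Zplus m) (lbP m) p)"
proof -
  have "inv_into (Zplus m) (lbP m) p \<in> Zplus m" "lbP m (inv_into (Zplus m) (lbP m) p) = p"
    using inv_into_into[OF assms] f_inv_into_f[OF assms] .
  then show ?thesis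
    by (intro inv_into_f_eq[OF Zsuper_lbS_inj]) (auto simp: C_idx_Zsuper lbS_C_idx)
qed

text \<open>Both actions are the same formula in labels, and \<open>C_idx\<close> preserves
  labels.\<close>

lemma gen_super_C_idx:
  assumes f: "f \<in> Zplus m" and g: "g \<in> Zplus m"
  shows "gen_super m X (C_idx m f) (C_idx m g) = gen_plus m X f g"
proof -
  note C = C_idx_Zsuper[OF f]
  have B: "bvec (inv_into (Zsuper m) (lbS m) (mv c x y (lbP m f))) (C_idx m g)
      = bvec (inv_into (Zplus m) (lbP m) (mv c x y (lbP m f))) g"
    if "x \<in> sel c (lbP m f)" "y \<notin> sel c (lbP m f)" "y = x + 1 \<or> x = y + 1" for c x y
  proof -
    have "mv c x y (lbP m f) \<in> lbP m ` Zplus m" using that by (rule inv_mv_lbP(2)[OF f])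
    then show ?thesis using g inv_into_into[of "mv c x y (lbP m f)" "lbP m" "Zplus m"]
      by (simp add: inv_lbS bvec_apply C_idx_eq_iff)
  qed
  show ?thesis
  proof (cases X rule: P.gen_cases)
    case (1 c a)
    then show ?thesis unfolding 1 P.gn_EF[OF f] S.gn_EF[OF C] lbS_C_idx[OF f]
      by (simp add: cond_vec_apply B)
  next
    case (2 a)
    then show ?thesis unfolding 2 P.gn_K[OF f] S.gn_K[OF C] lbS_C_idx[OF f]
      using f g by (simp add: bvec_apply C_idx_eq_iff)
  next
    case (3 a)
    then show ?thesis unfolding 3 P.gn_Kinv[OF f] S.gn_Kinv[OF C] lbS_C_idx[OF f]
      using f g by (simp add: bvec_apply C_idx_eq_iff)
  qed
qed

lemma natural_map_act:
  assumes u: "u \<in> P.Eh m"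
  shows "natural_map m (ext (gen_plus m X) u) = ext (gen_super m X) (natural_map m u)"
proof (rule natural_map_ext)
  show "f \<in> Zplus m" if "u f \<noteq> 0" for f using u that by (rule P.Eh_supp)
  show "gen_super m X (C_idx m f) g = 0" if "f \<in> Zplus m" "g \<notin> Zsuper m" for f g
    using S.cmat_gn[of m X] that C_idx_Zsuper S.Eh_0 unfolding S.cmat_def by blast
qed (rule gen_super_C_idx)

lemma natural_map_psi:
  assumes u: "u \<in> P.Eh m"
  shows "natural_map m (P.psi m u) = S.psi m (natural_map m u)"
proof -
  have "natural_map m (ext (P.rr m) (vbar u)) = ext (S.rr m) (natural_map m (vbar u))"
  proof (rule natural_map_ext)
    show "f \<in> Zplus m" if "vbar u f \<noteq> 0" for f using P.vbar_Eh[OF u] that by (rule P.Eh_supp)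
  qed (auto simp: P.rr_def S.rr_def C_idx_Zsuper lbS_C_idx)
  moreover have "natural_map m (vbar u) = vbar (natural_map m u)"
    by (intro natural_map_eqI) (auto simp: natural_map_C_idx natural_map_off)
  ultimately show ?thesis using u natural_map_Eh[OF u] by (simp add: P.psi_eq S.psi_eq)
qed

text \<open>The image of a monic fixed vector is monic and fixed, hence canonical for the other
  order; uniqueness on that side identifies it, without any comparison of the orders.\<close>

lemma natural_map_canonical:
  assumes P: "\<And>c. P c \<Longrightarrow> bar_q c = c \<Longrightarrow> c = 0" "\<And>c c'. P c \<Longrightarrow> P c' \<Longrightarrow> P (c - c')" "P 0"
    and f: "f \<in> Zplus m" and x: "P.monic m P f x" "P.psi m x = x"
  shows "natural_map m (THE x. P.canonical m P f x) = (THE x. S.canonical m P (C_idx m f) x)"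
proof -
  have xEh: "x \<in> P.Eh m" using x(1) by (simp add: P.monic_def)
  have "S.monic m P (C_idx m f) (natural_map m x)"
    unfolding S.monic_def
  proof (intro conjI allI impI)
    show "natural_map m x \<in> S.Eh m" using xEh by (rule natural_map_Eh)
    show "natural_map m x (C_idx m f) = 1" using x(1) f by (simp add: natural_map_C_idx P.monic_def)
    fix g
    show "g \<in> Zsuper m" if "natural_map m x g \<noteq> 0" using that natural_map_off by blast
    show "dominates (lbS m (C_idx m f)) (lbS m g)" if nz: "natural_map m x g \<noteq> 0"
    proof -
      have "g \<in> Zsuper m" using nz natural_map_off by blast
      then obtain k where k: "k \<in> Zplus m" "g = C_idx m k" by (rule Zsuper_obtain)
      then show ?thesis using nz x(1) f by (simp add: natural_map_C_idx lbS_C_idx P.monic_def)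
    qed
    show "P (natural_map m x g)" if "g \<noteq> C_idx m f"
    proof (cases "g \<in> Zsuper m")
      case True
      then obtain k where k: "k \<in> Zplus m" "g = C_idx m k" by (rule Zsuper_obtain)
      then show ?thesis using that x(1) f by (auto simp: natural_map_C_idx P.monic_def)
    qed (simp add: natural_map_off P(3))
  qed
  moreover have "S.psi m (natural_map m x) = natural_map m x"
    using natural_map_psi[OF xEh] x(2) by simp
  ultimately have "S.canonical m P (C_idx m f) (natural_map m x)"
    by (intro S.canonicalI C_idx_Zsuper f)
  then have "(THE x. S.canonical m P (C_idx m f) x) = natural_map m x"
    by (intro S.The_canonical P C_idx_Zsuper f)
  moreover have "(THE x. P.canonical m P f x) = x"
    using P.canonicalI[OF f x] by (intro P.The_canonical P f)
  ultimately show ?thesis by simp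
qed

theorem theorem6p7:
  fixes m :: nat
  shows "(\<forall>f\<in>Zplus m. nat_idx m f \<in> Zsuper m)
    \<and> natural_map m ` Ehat_plus m = Ehat_super m
    \<and> inj_on (natural_map m) (Ehat_plus m)
    \<and> (\<forall>u\<in>Ehat_plus m. \<forall>v\<in>Ehat_plus m. natural_map m (vadd u v) = vadd (natural_map m u) (natural_map m v))
    \<and> (\<forall>c. \<forall>u\<in>Ehat_plus m. natural_map m (vsmult c u) = vsmult c (natural_map m u))
    \<and> (\<forall>X. \<forall>u\<in>Ehat_plus m. natural_map m (act_plus m X u) = act_super m X (natural_map m u))
    \<and> (\<forall>f\<in>Zplus m. natural_map m (bvec f) = bvec (nat_idx m f))
    \<and> (\<forall>u\<in>Ehat_plus m. natural_map m (bar_plus m u) = bar_super m (natural_map m u))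
    \<and> (\<forall>f\<in>Zplus m. natural_map m (L_plus m f) = L_super m (nat_idx m f))
    \<and> (\<forall>f\<in>Zplus m. natural_map m (U_plus m f) = U_super m (nat_idx m f))"
  unfolding Ehat_plus_eq Ehat_super_eq bar_plus_eq bar_super_eq act_plus_def act_super_def canonical_eqs
proof (intro conjI ballI allI)
  show "natural_map m ` P.Eh m = S.Eh m"
    using natural_map_Eh natural_map_surj by (auto simp: image_iff) metis
  show "inj_on (natural_map m) (P.Eh m)" by (rule natural_map_inj)
  show "natural_map m (vadd u v) = vadd (natural_map m u) (natural_map m v)" for u v
    by (intro natural_map_eqI) (auto simp: natural_map_C_idx natural_map_off)
  show "natural_map m (vsmult c u) = vsmult c (natural_map m u)" for c u
    by (intro natural_map_eqI) (auto simp: natural_map_C_idx natural_map_off)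
  fix f assume f: "f \<in> Zplus m"
  show "nat_idx m f \<in> Zsuper m" using f by (simp add: nat_idx_eq_C_idx C_idx_Zsuper)
  show "natural_map m (bvec f) = bvec (nat_idx m f)" using f by (simp add: nat_idx_eq_C_idx natural_map_bvec)
  obtain x where "P.monic m in_qinvZqinv f x" "P.psi m x = x" using P.monic_qinvZqinv_ex[OF f] by blast
  then show "natural_map m (THE x. P.canonical m in_qinvZqinv f x) = (THE x. S.canonical m in_qinvZqinv (nat_idx m f) x)"
    unfolding nat_idx_eq_C_idx[OF f] using f bar_invariant_in_qinvZqinv in_qinvZqinv_diff
    by (intro natural_map_canonical) (auto simp: in_qinvZqinv_iff_bar)
  obtain y where "P.monic m in_qZq f y" "P.psi m y = y" using P.monic_qZq_ex[OF f] by blast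
  then show "natural_map m (THE x. P.canonical m in_qZq f x) = (THE x. S.canonical m in_qZq (nat_idx m f) x)"
    unfolding nat_idx_eq_C_idx[OF f] using f bar_invariant_in_qZq in_qZq_diff
    by (intro natural_map_canonical) auto
next
  fix u assume u: "u \<in> P.Eh m"
  show "natural_map m (ext (gen_plus m X) u) = ext (gen_super m X) (natural_map m u)" for X
    using u by (rule natural_map_act)
  show "natural_map m (P.psi m u) = S.psi m (natural_map m u)"
    using u by (rule natural_map_psi)
qed

end
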